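(* The self-adjoint operator $-\bar{\mathcal D}^2:D(\bar{\mathcal D}^2)\to\bar H$ has spectrum $$\sigma(-\bar{\mathcal D}^2)=\Big\{\Big(\frac{2\pi k}{T(E)}\Big)^2:k\in\mathbb N_0,\ U_0(0)\le E\le E_0\Big\},$$ and this spectrum is purely essential, $\sigma_{ess}(-\bar{\mathcal D}^2)=\sigma(-\bar{\mathcal D}^2)$.
   Context: Plane symmetric setting: $x\in\mathbb R$, $v=(v_1,\bar v)\in\mathbb R\times\mathbb R^2$. Steady state $f_0(x,v)=\varphi(E,\bar v)=\alpha(E)\beta(\bar v)$ with $E=\tfrac12v_1^2+U_0(x)$, where $\beta\ge0$ is continuous with compact support and $\int\beta=1$, $\alpha(E)=(E_0-E)_+^k$ with $k>\tfrac12$ or $\alpha(E)=(e^{E_0-E}-1)_+$ ($t_+^k=t^k$ for $t>0$, else $0$), $\rho_0(x)=\int f_0(x,v)dv$, $U_0(x)=2\pi\int|x-y|\rho_0(y)dy$; $U_0,\rho_0$ are even, $\mathrm{supp}\,\rho_0=[-R_0,R_0]$, $U_0$ is convex and strictly increasing on $[0,\infty[$, $E_0=U_0(R_0)$. For $E>U_0(0)$ let $x_-(E)=-x_+(E)<0<x_+(E)$ solve $U_0(x)=E$ and $T(E)=2\int_{x_-(E)}^{x_+(E)}\frac{dx}{\sqrt{2E-2U_0(x)}}$; set $T(U_0(0)):=\sqrt{\pi/\rho_0(0)}$ (the limit as $E\to U_0(0)$). Let $\bar\Omega_0=\{f_0>0\}$ and $\varphi'=\partial_E\varphi=\alpha'(E)\beta(\bar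 v)$. $\bar H$ is the Hilbert space of measurable $g:\bar\Omega_0\to\mathbb R$ with $\|g\|_{\bar H}^2=\int_{\bar\Omega_0}|\varphi'(E,\bar v)|^{-1}|g|^2d(x,v)<\infty$. For $g\in L^1_{loc}(\bar\Omega_0)$, $\bar{\mathcal D}g=\mu$ weakly if $\mu\in L^1_{loc}$ and $\int|\varphi'|^{-1}g\,\bar{\mathcal D}\xi=-\int|\varphi'|^{-1}\mu\xi$ for all $\xi\in C^1_c(\bar\Omega_0)$, where $\bar{\mathcal D}\xi=v_1\partial_x\xi-U_0'(x)\partial_{v_1}\xi$. $D(\bar{\mathcal D})=\{g\in\bar H:\bar{\mathcal D}g$ exists weakly and lies in $\bar H\}$, $D(\bar{\mathcal D}^2)=\{g\in D(\bar{\mathcal D}):\bar{\mathcal D}g\in D(\bar{\mathcal D})\}$. *)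

theory Defs
  imports "HOL-Analysis.Analysis"
begin

text \<open>Phase-space points z = (x, v1, vbar) with x, v1 real and vbar in R^2
  (represented as real \<times> real).\<close>

type_synonym phase = "real \<times> real \<times> (real \<times> real)"

definition energy :: "(real \<Rightarrow> real) \<Rightarrow> phase \<Rightarrow> real" where
  "energy U0 z = (fst (snd z))\<^sup>2 / 2 + U0 (fst z)"

definition f0 :: "(real \<Rightarrow> real) \<Rightarrow> (real \<times> real \<Rightarrow> real) \<Rightarrow> (real \<Rightarrow> real) \<Rightarrow> phase \<Rightarrow> real" where
  "f0 alpha beta U0 z = alpha (energy U0 z) * beta (snd (snd z))"

definition Omega0 :: "(real \<Rightarrow> real) \<Rightarrow> (real \<times> real \<Rightarrow> real) \<Rightarrow> (real \<Rightarrow> real) \<Rightarrow> phase set" where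
  "Omega0 alpha beta U0 = {z. f0 alpha beta U0 z > 0}"

definition phi' :: "(real \<Rightarrow> real) \<Rightarrow> (real \<times> real \<Rightarrow> real) \<Rightarrow> (real \<Rightarrow> real) \<Rightarrow> phase \<Rightarrow> real" where
  "phi' alpha beta U0 z = deriv alpha (energy U0 z) * beta (snd (snd z))"

text \<open>Membership in the weighted Hilbert space H (elements are functions, identified
  up to null sets on \<Omega>0 via the seminorm below).\<close>
definition inH :: "(real \<Rightarrow> real) \<Rightarrow> (real \<times> real \<Rightarrow> real) \<Rightarrow> (real \<Rightarrow> real) \<Rightarrow> (phase \<Rightarrow> real) \<Rightarrow> bool" where
  "inH alpha beta U0 g \<longleftrightarrow> g \<in> borel_measurable lborel \<and>
     (\<integral>\<^sup>+ z \<in> Omega0 alpha beta U0. ennreal ((g z)\<^sup>2 / \<bar>phi' alpha beta U0 z\<bar>) \<partial>lborel) < \<infinity>"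

definition normH :: "(real \<Rightarrow> real) \<Rightarrow> (real \<times> real \<Rightarrow> real) \<Rightarrow> (real \<Rightarrow> real) \<Rightarrow> (phase \<Rightarrow> real) \<Rightarrow> real" where
  "normH alpha beta U0 g =
     sqrt (LINT z : Omega0 alpha beta U0 | lborel. (g z)\<^sup>2 / \<bar>phi' alpha beta U0 z\<bar>)"

definition L1loc :: "phase set \<Rightarrow> (phase \<Rightarrow> real) \<Rightarrow> bool" where
  "L1loc \<Omega> g \<longleftrightarrow> (\<forall>K. compact K \<and> K \<subseteq> \<Omega> \<longrightarrow> set_integrable lborel K g)"

definition C1c :: "phase set \<Rightarrow> (phase \<Rightarrow> real) \<Rightarrow> bool" where
  "C1c \<Omega> \<xi> \<longleftrightarrow>
     (\<exists>\<xi>'. (\<forall>z. (\<xi> has_derivative \<xi>' z) (at z)) \<and> (\<forall>w. continuous_on UNIV (\<lambda>z. \<xi>' z w))) \<and>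
     (\<exists>K. compact K \<and> K \<subseteq> \<Omega> \<and> (\<forall>z. z \<notin> K \<longrightarrow> \<xi> z = 0))"

definition Dtest :: "(real \<Rightarrow> real) \<Rightarrow> (phase \<Rightarrow> real) \<Rightarrow> phase \<Rightarrow> real" where
  "Dtest U0 \<xi> z = fst (snd z) * (frechet_derivative \<xi> (at z)) (1, 0, 0, 0)
                 - deriv U0 (fst z) * (frechet_derivative \<xi> (at z)) (0, 1, 0, 0)"

definition weakD :: "(real \<Rightarrow> real) \<Rightarrow> (real \<times> real \<Rightarrow> real) \<Rightarrow> (real \<Rightarrow> real)
    \<Rightarrow> (phase \<Rightarrow> real) \<Rightarrow> (phase \<Rightarrow> real) \<Rightarrow> bool" where
  "weakD alpha beta U0 g \<mu> \<longleftrightarrow>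
     (let \<Omega> = Omega0 alpha beta U0; w = (\<lambda>z. 1 / \<bar>phi' alpha beta U0 z\<bar>) in
      L1loc \<Omega> g \<and> L1loc \<Omega> \<mu> \<and>
      (\<forall>\<xi>. C1c \<Omega> \<xi> \<longrightarrow>
         (LINT z : \<Omega> | lborel. w z * g z * Dtest U0 \<xi> z)
           = - (LINT z : \<Omega> | lborel. w z * \<mu> z * \<xi> z)))"

text \<open>Graph of the operator A = -D^2 with domain D(D^2):
  Aop g h  iff  g \<in> D(D^2) and h = -D^2 g.\<close>
definition Aop :: "(real \<Rightarrow> real) \<Rightarrow> (real \<times> real \<Rightarrow> real) \<Rightarrow> (real \<Rightarrow> real)
    \<Rightarrow> (phase \<Rightarrow> real) \<Rightarrow> (phase \<Rightarrow> real) \<Rightarrow> bool" where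
  "Aop alpha beta U0 g h \<longleftrightarrow>
     inH alpha beta U0 g \<and> inH alpha beta U0 h \<and>
     (\<exists>\<mu>. inH alpha beta U0 \<mu> \<and> weakD alpha beta U0 g \<mu> \<and>
          weakD alpha beta U0 \<mu> (\<lambda>z. - h z))"

text \<open>Spectrum (the Hilbert space is real, and the operator is self-adjoint, so the
  spectrum is taken as a set of reals): \<lambda> is in the resolvent set iff A - \<lambda>
  is a bijection D(A) \<rightarrow> H (modulo null functions) with bounded inverse.\<close>
definition spectrumA :: "(real \<Rightarrow> real) \<Rightarrow> (real \<times> real \<Rightarrow> real) \<Rightarrow> (real \<Rightarrow> real) \<Rightarrow> real set" where
  "spectrumA alpha beta U0 = {lam. \<not> (\<exists>C.
      (\<forall>f. inH alpha beta U0 f \<longrightarrow>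
         (\<exists>g h. Aop alpha beta U0 g h \<and> normH alpha beta U0 (\<lambda>z. h z - lam * g z - f z) = 0)) \<and>
      (\<forall>g h. Aop alpha beta U0 g h \<longrightarrow>
         normH alpha beta U0 g \<le> C * normH alpha beta U0 (\<lambda>z. h z - lam * g z)))}"

definition is_eigenvalue :: "(real \<Rightarrow> real) \<Rightarrow> (real \<times> real \<Rightarrow> real) \<Rightarrow> (real \<Rightarrow> real) \<Rightarrow> real \<Rightarrow> bool" where
  "is_eigenvalue alpha beta U0 lam \<longleftrightarrow>
     (\<exists>g. Aop alpha beta U0 g (\<lambda>z. lam * g z) \<and> normH alpha beta U0 g \<noteq> 0)"

definition finite_multiplicity :: "(real \<Rightarrow> real) \<Rightarrow> (real \<times> real \<Rightarrow> real) \<Rightarrow> (real \<Rightarrow> real) \<Rightarrow> real \<Rightarrow> bool" where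
  "finite_multiplicity alpha beta U0 lam \<longleftrightarrow>
     (\<exists>F. finite F \<and> (\<forall>e\<in>F. Aop alpha beta U0 e (\<lambda>z. lam * e z)) \<and>
        (\<forall>g. Aop alpha beta U0 g (\<lambda>z. lam * g z) \<longrightarrow>
           (\<exists>c. normH alpha beta U0 (\<lambda>z. g z - (\<Sum>e\<in>F. c e * e z)) = 0)))"

definition disc_spectrumA :: "(real \<Rightarrow> real) \<Rightarrow> (real \<times> real \<Rightarrow> real) \<Rightarrow> (real \<Rightarrow> real) \<Rightarrow> real set" where
  "disc_spectrumA alpha beta U0 = {lam \<in> spectrumA alpha beta U0.
      \<not> lam islimpt spectrumA alpha beta U0 \<and> is_eigenvalue alpha beta U0 lam \<and>
      finite_multiplicity alpha beta U0 lam}"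

definition ess_spectrumA :: "(real \<Rightarrow> real) \<Rightarrow> (real \<times> real \<Rightarrow> real) \<Rightarrow> (real \<Rightarrow> real) \<Rightarrow> real set" where
  "ess_spectrumA alpha beta U0 = spectrumA alpha beta U0 - disc_spectrumA alpha beta U0"

definition xplus :: "(real \<Rightarrow> real) \<Rightarrow> real \<Rightarrow> real" where
  "xplus U0 E = (THE x. 0 < x \<and> U0 x = E)"

definition period :: "(real \<Rightarrow> real) \<Rightarrow> (real \<Rightarrow> real) \<Rightarrow> real \<Rightarrow> real" where
  "period U0 rho0 E =
     (if E = U0 0 then sqrt (pi / rho0 0)
      else 2 * (LINT x : {- xplus U0 E .. xplus U0 E} | lborel. 1 / sqrt (2 * E - 2 * U0 x)))"

end

theory Submission
  imports Defs
begin

text \<open>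
With \<open>q x = sgn x * sqrt (2 * (U\<^sub>0 x - U\<^sub>0 0))\<close> the energy above the bottom of the well is
\<open>e = (v\<^sub>1\<^sup>2 + (q x)\<^sup>2) / 2\<close>. In polar coordinates \<open>(e, s)\<close> of the plane \<open>(- q, v\<^sub>1)\<close> the transport operator is
\<open>(1 / \<kappa> e s) * \<partial>\<^sub>s\<close> with \<open>\<kappa> = 1 / q'\<close>, the volume element \<open>dx dv\<^sub>1\<close> is \<open>\<kappa> e s de ds\<close>, and the period is
\<open>T = \<integral>\<kappa> e s ds\<close>; since \<open>q' 0 = sqrt (4 * pi * \<rho>\<^sub>0 0)\<close>, it is continuous down to \<open>e = 0\<close> with value
\<open>sqrt (pi / \<rho>\<^sub>0 0)\<close>. A pair is in the graph of the weak operator iff on almost every energy circle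
one function is a periodic primitive of the other with respect to \<open>\<kappa> ds\<close>, which is tested with
trigonometric moments.

The spectral problem thus becomes a family of periodic problems \<open>- y'' = \<lambda> y + f\<close> in the
time variable \<open>t\<close>, over circles of length \<open>T\<close>. If \<open>\<lambda>\<close> avoids the closed set of resonances
\<open>(2 * pi * n / T)\<^sup>2\<close>, the Green kernel \<open>C (\<bar>t - t'\<bar> - T / 2) / (2 * S (T / 2))\<close> with \<open>C'' = - \<lambda> C\<close> and \<open>S = C'\<close>
is bounded uniformly in the energy and yields a bounded resolvent. If \<open>\<lambda>\<close> is resonant for some
energy, then \<open>cos (2 * pi * n * t / T)\<close>, cut off to nearby energies, is an approximate eigenfunction.
There is no discrete spectrum, because an eigenfunction may be multiplied by arbitrary
polynomials in the transversal velocity.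
\<close>

section \<open>Integration on intervals and boxes\<close>

text \<open>The obstacle is regularity. Test functions must be \<open>C1\<close> on phase space with
  compact support in the domain, but the angle is not differentiable at the bottom of the well, and
  \<open>q\<close> is only known to be once continuously differentiable. The tests are therefore
  built from invariants and from the real parts of powers of \<open>- q + i v\<close>, which on an
  energy circle are pure cosines and sines. They are countably many, so one null set of circles
  serves for all. The weight \<open>1 / |phi'|\<close> is a function of the invariants, constant on
  each circle, and never enters the one-dimensional problems.

  Keeping \<open>C\<close> and \<open>S\<close> abstract lets one kernel serve positive
  \<open>lambda\<close> (cosine) and negative \<open>lambda\<close> (hyperbolic cosine). Uniformity
  in the energy comes from compactness: the period is continuous and positive on the closed energy
  interval, so \<open>S (T / 2)\<close> stays away from zero as soon as it vanishes nowhere. The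
  same continuity puts the resonances at the two end energies into the spectrum, although almost
  every orbit has an energy strictly inside.\<close>

lemma AE_zero_of_box_integrals:
  fixes f :: "'a::euclidean_space \<Rightarrow> real"
  assumes f: "integrable lborel f"
    and box: "\<And>a b. (LINT x:box a b|lborel. f x) = 0"
  shows "AE x in lborel. f x = 0"
proof (rule sigma_finite_measure.density_zero[OF lborel.sigma_finite_measure_axioms f])
  have fs: "set_integrable lborel A f" if "A \<in> sets borel" for A
    using that f by (auto simp: set_integrable_def intro!: integrable_mult_indicator[of _ lborel f, simplified])
  \<comment> \<open>The complement step of the induction needs the integral over the whole space,
    obtained as a limit over growing centred boxes.\<close>
  have total: "(LINT x|lborel. f x) = 0"
  proof -
    let ?A = "\<lambda>n::nat. box (- (real n *\<^sub>R One)) (real n *\<^sub>R One) :: 'a set"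
    have "(\<lambda>n. LINT x|lborel. indicator (?A n) x *\<^sub>R f x) \<longlonglongrightarrow> (LINT x|lborel. f x)"
    proof (rule integral_dominated_convergence[where w = "\<lambda>x. norm (f x)"])
      show "AE x in lborel. (\<lambda>n. indicator (?A n) x *\<^sub>R f x) \<longlonglongrightarrow> f x"
      proof (rule AE_I2)
        fix x :: 'a
        obtain m where m: "x \<in> ?A m" using UN_box_eq_UNIV[where 'a='a] by blast
        have "x \<in> ?A n" if "n \<ge> m" for n
        proof -
          have "real m \<le> real n" using that by simp
          then show ?thesis using m by (force simp: mem_box)
        qed
        then have "eventually (\<lambda>n. indicator (?A n) x *\<^sub>R f x = f x) sequentially"
          by (auto simp: eventually_sequentially intro!: exI[of _ m])
        then show "(\<lambda>n. indicator (?A n) x *\<^sub>R f x) \<longlonglongrightarrow> f x"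
          by (rule tendsto_eventually)
      qed
    qed (use f in \<open>auto simp: indicator_def intro!: integrable_norm\<close>)
    moreover have "(LINT x|lborel. indicator (?A n) x *\<^sub>R f x) = 0" for n
      using box by (simp add: set_lebesgue_integral_def)
    ultimately show ?thesis by (simp add: LIMSEQ_const_iff)
  qed
  \<comment> \<open>Boxes are stable under intersection and generate the Borel sets; the sets of
    integral zero are closed under complement and countable disjoint union, so they are all Borel
    sets.\<close>
  have istab: "Int_stable (range (\<lambda>(a, b). box a b :: 'a set))"
    by (auto simp: Int_stable_def box_Int_box)
  have pow: "range (\<lambda>(a, b). box a b :: 'a set) \<subseteq> Pow UNIV" by simp
  have "set_lebesgue_integral lborel A f = 0"
    if "A \<in> sigma_sets UNIV (range (\<lambda>(a, b). box a b :: 'a set))" for A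
    using istab pow that
  proof (induction rule: sigma_sets_induct_disjoint)
    case (basic A) then show ?case using box by auto
  next
    case empty then show ?case by (simp add: set_lebesgue_integral_def)
  next
    case (compl A)
    have A: "A \<in> sets borel" using compl(1) by (simp add: borel_eq_box)
    have "(LINT x|lborel. f x) = (LINT x:(A \<union> (UNIV - A))|lborel. f x)"
      by (simp add: set_lebesgue_integral_def)
    also have "\<dots> = (LINT x:A|lborel. f x) + (LINT x:(UNIV-A)|lborel. f x)"
      by (rule set_integral_Un) (use A in \<open>auto intro!: fs\<close>)
    finally show ?case using compl total by simp
  next
    case (union A)
    have A: "A i \<in> sets borel" for i using union(2) by (auto simp: borel_eq_box)
    have "(LINT x:(\<Union>i. A i)|lborel. f x) = (\<Sum>i. (LINT x:A i|lborel. f x))"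
      by (rule lebesgue_integral_countable_add) (use A union(1) in \<open>auto intro!: fs simp: disjoint_family_on_def\<close>)
    then show ?case using union(3) by simp
  qed
  then show "set_lebesgue_integral lborel A f = 0" if "A \<in> sets lborel" for A
    using that by (simp add: borel_eq_box)
qed

text \<open>The exceptional set is meant for the diagonal of the Green kernel, whose derivative
  jumps at one angle of the circle.\<close>

lemma set_integral_FTC_except:
  fixes F f :: "real \<Rightarrow> real"
  assumes "a \<le> b" "finite K" "continuous_on {a..b} F"
    and "\<And>x. x \<in> {a<..<b} - K \<Longrightarrow> (F has_real_derivative f x) (at x)"
    and "set_integrable lborel {a..b} f"
  shows "(LINT x:{a..b}|lborel. f x) = F b - F a"
proof -
  have "(f has_integral (F b - F a)) {a..b}"
    using assms by (intro fundamental_theorem_of_calculus_interior_strong[of K])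
      (auto simp: has_real_derivative_iff_has_vector_derivative)
  then show ?thesis
    using set_borel_integral_eq_integral(2)[OF assms(5)] by (simp add: integral_unique)
qed

lemma set_integrable_mult_bounded:
  fixes f g :: "'a \<Rightarrow> real"
  assumes f: "set_integrable M A f" and g: "set_borel_measurable M A g"
    and b: "\<And>x. x \<in> A \<Longrightarrow> \<bar>g x\<bar> \<le> B"
  shows "set_integrable M A (\<lambda>x. f x * g x)"
proof -
  have "integrable M (\<lambda>x. (indicator A x *\<^sub>R f x) * (indicator A x *\<^sub>R g x))"
  proof (rule Bochner_Integration.integrable_bound[where f = "\<lambda>x. B * (indicator A x *\<^sub>R f x)"])
    show "AE x in M. norm ((indicator A x *\<^sub>R f x) * (indicator A x *\<^sub>R g x)) \<le> norm (B * (indicator A x *\<^sub>R f x))"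
    proof (rule AE_I2)
      fix x
      show "norm ((indicator A x *\<^sub>R f x) * (indicator A x *\<^sub>R g x)) \<le> norm (B * (indicator A x *\<^sub>R f x))"
        using b[of x] mult_left_mono[of "\<bar>g x\<bar>" "\<bar>B\<bar>" "\<bar>f x\<bar>"]
        by (cases "x \<in> A") (auto simp: abs_mult mult.commute)
    qed
  qed (use f g in \<open>auto simp: set_integrable_def set_borel_measurable_def\<close>)
  moreover have "(indicator A x *\<^sub>R f x) * (indicator A x *\<^sub>R g x) = indicator A x *\<^sub>R (f x * g x)" for x
    by (auto simp: indicator_def)
  ultimately show ?thesis by (simp only: set_integrable_def)
qed

lemma set_integrable_mult_continuous:
  fixes f g :: "real \<Rightarrow> real"
  assumes f: "set_integrable lborel {a..b} f" and g: "continuous_on {a..b} g"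
  shows "set_integrable lborel {a..b} (\<lambda>x. f x * g x)"
proof -
  have "bounded (g ` {a..b})" by (intro compact_imp_bounded compact_continuous_image g) simp
  then obtain B where "\<forall>x\<in>{a..b}. \<bar>g x\<bar> \<le> B" by (auto simp: bounded_iff)
  then have "\<And>x. x \<in> {a..b} \<Longrightarrow> \<bar>g x\<bar> \<le> B" by blast
  moreover have "set_borel_measurable lborel {a..b} g"
    using borel_measurable_continuous_on_indicator[OF _ g] by (simp add: set_borel_measurable_def)
  ultimately show ?thesis using set_integrable_mult_bounded[OF f] by blast
qed

lemma set_integrable_continuous_Icc:
  fixes g :: "real \<Rightarrow> real"
  assumes "continuous_on {a..b} g"
  shows "set_integrable lborel {a..b} g"
  using borel_integrable_compact[OF _ assms] by (simp add: set_integrable_def)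

text \<open>Fubini for a bounded kernel between two merely integrable densities, dominated by
  \<open>M\<close> times their product. It allows a primitive to be taken under the integral that
  defines a Green solution.\<close>

lemma set_integral_swap_bounded:
  fixes h :: "real \<Rightarrow> real \<Rightarrow> real" and K F :: "real \<Rightarrow> real"
  assumes h: "(\<lambda>(u, r). h u r) \<in> borel_measurable (borel \<Otimes>\<^sub>M borel)"
    and bound: "\<And>u r. u \<in> A \<Longrightarrow> r \<in> B \<Longrightarrow> \<bar>h u r\<bar> \<le> M"
    and K: "set_integrable lborel A K" and F: "set_integrable lborel B F"
  shows "(LINT r:B|lborel. (LINT u:A|lborel. h u r * K u) * F r)
       = (LINT u:A|lborel. (LINT r:B|lborel. h u r * F r) * K u)"
    and "set_integrable lborel A (\<lambda>u. (LINT r:B|lborel. h u r * F r) * K u)"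
proof -
  define K' where "K' u = indicator A u *\<^sub>R K u" for u
  define F' where "F' u = indicator B u *\<^sub>R F u" for u
  have iK: "integrable lborel K'" using K by (simp add: K'_def[abs_def] set_integrable_def)
  have iF: "integrable lborel F'" using F by (simp add: F'_def[abs_def] set_integrable_def)
  have [measurable]: "K' \<in> borel_measurable borel" "F' \<in> borel_measurable borel"
    using borel_measurable_integrable[OF iK] borel_measurable_integrable[OF iF] by auto
  note [measurable] = h
  let ?h = "\<lambda>(u,r). h u r * (K' u * F' r)"
  have base: "integrable (lborel \<Otimes>\<^sub>M lborel) (\<lambda>(u,r). K' u * F' r)"
  proof (rule lborel_pair.Fubini_integrable)
    show "integrable lborel (\<lambda>u. LINT y|lborel. norm (case (u, y) of (u, r) \<Rightarrow> K' u * F' r))"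
      using integrable_norm[OF iK] integrable_norm[OF iF] by (simp add: abs_mult)
    show "AE u in lborel. integrable lborel (\<lambda>y. case (u, y) of (u, r) \<Rightarrow> K' u * F' r)"
      using iF by simp
  qed measurable
  have H: "integrable (lborel \<Otimes>\<^sub>M lborel) ?h"
  proof (rule Bochner_Integration.integrable_bound)
    show "integrable (lborel \<Otimes>\<^sub>M lborel) (\<lambda>z. \<bar>M\<bar> * (case z of (u,r) \<Rightarrow> K' u * F' r))"
      using base by simp
    show "?h \<in> borel_measurable (lborel \<Otimes>\<^sub>M lborel)" by measurable
    show "AE z in lborel \<Otimes>\<^sub>M lborel. norm (?h z) \<le> norm (\<bar>M\<bar> * (case z of (u,r) \<Rightarrow> K' u * F' r))"
    proof (rule AE_I2)
      fix z :: "real \<times> real"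
      obtain u r where z: "z = (u, r)" by (cases z)
      show "norm (?h z) \<le> norm (\<bar>M\<bar> * (case z of (u,r) \<Rightarrow> K' u * F' r))"
      proof (cases "u \<in> A \<and> r \<in> B")
        case True
        then have "\<bar>h u r\<bar> \<le> \<bar>M\<bar>" using bound[of u r] by linarith
        from mult_right_mono[OF this, of "\<bar>K' u * F' r\<bar>"] show ?thesis by (simp add: z abs_mult)
      qed (auto simp: z K'_def F'_def)
    qed
  qed
  have inner1: "(LINT u|lborel. ?h (u,r)) = indicator B r *\<^sub>R ((LINT u:A|lborel. h u r * K u) * F r)" for r
  proof -
    have "(\<lambda>u. ?h (u,r)) = (\<lambda>u. F' r * (indicator A u *\<^sub>R (h u r * K u)))"
      by (auto simp: fun_eq_iff K'_def)
    then show ?thesis by (simp add: set_lebesgue_integral_def F'_def)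
  qed
  have inner2: "(LINT r|lborel. ?h (u,r)) = indicator A u *\<^sub>R ((LINT r:B|lborel. h u r * F r) * K u)" for u
  proof -
    have "(\<lambda>r. ?h (u,r)) = (\<lambda>r. K' u * (indicator B r *\<^sub>R (h u r * F r)))"
      by (auto simp: fun_eq_iff F'_def)
    then show ?thesis by (simp add: set_lebesgue_integral_def K'_def)
  qed
  show "(LINT r:B|lborel. (LINT u:A|lborel. h u r * K u) * F r)
       = (LINT u:A|lborel. (LINT r:B|lborel. h u r * F r) * K u)"
    using lborel_pair.Fubini_integral[of "\<lambda>u r. ?h (u,r)"] H
    by (simp only: inner1 inner2 set_lebesgue_integral_def[symmetric]) (simp add: split_beta')
  show "set_integrable lborel A (\<lambda>u. (LINT r:B|lborel. h u r * F r) * K u)"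
    using lborel_pair.integrable_fst'[OF H] by (simp only: inner2 set_integrable_def)
qed

text \<open>Fubini over the triangle \<open>u <= x\<close>, encoded by a 0-1 kernel. It stands in
  for the classical product rule, since the primitive of an integrable \<open>m\<close> need not be
  differentiable at a given point.\<close>

lemma set_integral_primitive_mult_Fubini:
  fixes m p :: "real \<Rightarrow> real"
  assumes m: "set_integrable lborel {a..b} m" and p: "continuous_on {a..b} p"
  shows "(LINT x:{a..b}|lborel. (LINT u:{a..x}|lborel. m u) * p x)
       = (LINT u:{a..b}|lborel. m u * (LINT x:{u..b}|lborel. p x))"
    and "set_integrable lborel {a..b} (\<lambda>x. (LINT u:{a..x}|lborel. m u) * p x)"
proof -
  let ?h = "\<lambda>x u::real. if u \<le> x then 1 else (0::real)"
  have h: "(\<lambda>(x, u). ?h x u) \<in> borel_measurable (borel \<Otimes>\<^sub>M borel)" by measurable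
  have "\<bar>?h x u\<bar> \<le> 1" for x u by simp
  note sw = set_integral_swap_bounded[OF h this set_integrable_continuous_Icc[OF p] m]
  have 1: "(LINT u:{a..b}|lborel. ?h x u * m u) = (LINT u:{a..x}|lborel. m u)" if "x \<in> {a..b}" for x
    unfolding set_lebesgue_integral_def
    by (intro Bochner_Integration.integral_cong) (use that in \<open>auto simp: indicator_def\<close>)
  have 2: "(LINT x:{a..b}|lborel. ?h x u * p x) = (LINT x:{u..b}|lborel. p x)" if "u \<in> {a..b}" for u
    unfolding set_lebesgue_integral_def
    by (intro Bochner_Integration.integral_cong) (use that in \<open>auto simp: indicator_def\<close>)
  have "(LINT x:{a..b}|lborel. (LINT u:{a..x}|lborel. m u) * p x) = (LINT x:{a..b}|lborel. (LINT u:{a..b}|lborel. ?h x u * m u) * p x)"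
    by (intro set_lebesgue_integral_cong) (use 1 in auto)
  also have "\<dots> = (LINT u:{a..b}|lborel. (LINT x:{a..b}|lborel. ?h x u * p x) * m u)"
    by (rule sw(1)[symmetric])
  also have "\<dots> = (LINT u:{a..b}|lborel. m u * (LINT x:{u..b}|lborel. p x))"
    by (intro set_lebesgue_integral_cong) (use 2 in auto)
  finally show "(LINT x:{a..b}|lborel. (LINT u:{a..x}|lborel. m u) * p x) = \<dots>" .
  show "set_integrable lborel {a..b} (\<lambda>x. (LINT u:{a..x}|lborel. m u) * p x)"
    using sw(2) by (rule set_integrable_cong[THEN iffD1, rotated -1]) (use 1 in auto)
qed

lemma set_integral_split_Icc:
  fixes m :: "real \<Rightarrow> real"
  assumes m: "set_integrable lborel {a..b} m" and "a \<le> x" "x \<le> b"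
  shows "(LINT u:{a..b}|lborel. m u) = (LINT u:{a..x}|lborel. m u) + (LINT u:{x..b}|lborel. m u)"
proof -
  have i: "set_integrable lborel {a..x} m" "set_integrable lborel {x..b} m"
    using assms by (auto intro: set_integrable_subset)
  have "(LINT u:{a..b}|lborel. m u) = (LINT u:({a..x} \<union> {x..b})|lborel. m u)"
    using assms by (simp add: ivl_disj_un_two_touch)
  also have "\<dots> = (LINT u:{a..x}|lborel. m u) + (LINT u:{x..b}|lborel. m u)"
  proof (rule set_integral_Un_AE)
    have "AE u in lborel. u \<noteq> x" by (simp add: AE_lborel_singleton)
    then show "AE u in lborel. \<not> (u \<in> {a..x} \<and> u \<in> {x..b})" by eventually_elim auto
  qed (use i in auto)
  finally show ?thesis .
qed

lemma set_integral_primitive_by_parts: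
  fixes m p p' :: "real \<Rightarrow> real"
  assumes ab: "a \<le> b" and m: "set_integrable lborel {a..b} m"
    and p: "\<And>x. x \<in> {a..b} \<Longrightarrow> (p has_real_derivative p' x) (at x)"
    and p': "continuous_on {a..b} p'"
  shows "(LINT x:{a..b}|lborel. (c + (LINT u:{a..x}|lborel. m u)) * p' x)
       = (c + (LINT u:{a..b}|lborel. m u)) * p b - c * p a - (LINT u:{a..b}|lborel. m u * p u)"
    and "set_integrable lborel {a..b} (\<lambda>x. (c + (LINT u:{a..x}|lborel. m u)) * p' x)"
proof -
  have cp: "continuous_on {a..b} p"
    using p by (meson DERIV_isCont continuous_at_imp_continuous_on)
  have FTC: "(LINT x:{u..b}|lborel. p' x) = p b - p u" if "u \<in> {a..b}" for u
  proof (rule set_integral_FTC_except[where K="{}"])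
    show "continuous_on {u..b} p" using cp that by (auto intro: continuous_on_subset)
    show "set_integrable lborel {u..b} p'"
      using that by (intro set_integrable_continuous_Icc continuous_on_subset[OF p']) auto
  qed (use that p in auto)
  note F = set_integral_primitive_mult_Fubini[OF m p']
  have i1: "set_integrable lborel {a..b} (\<lambda>x. c * p' x)"
    using set_integrable_continuous_Icc[OF p'] by simp
  show int: "set_integrable lborel {a..b} (\<lambda>x. (c + (LINT u:{a..x}|lborel. m u)) * p' x)"
    using set_integral_add(1)[OF i1 F(2)] by (simp add: distrib_right)
  have "(LINT x:{a..b}|lborel. (c + (LINT u:{a..x}|lborel. m u)) * p' x)
      = c * (p b - p a) + (LINT x:{a..b}|lborel. (LINT u:{a..x}|lborel. m u) * p' x)"
    using set_integral_add(2)[OF i1 F(2)] FTC[of a] ab by (simp add: distrib_right)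
  also have "(LINT x:{a..b}|lborel. (LINT u:{a..x}|lborel. m u) * p' x)
      = (LINT u:{a..b}|lborel. m u * p b - m u * p u)"
    unfolding F(1) by (intro set_lebesgue_integral_cong) (auto simp: FTC algebra_simps)
  also have "\<dots> = (LINT u:{a..b}|lborel. m u) * p b - (LINT u:{a..b}|lborel. m u * p u)"
    using set_integral_diff(2)[of lborel "{a..b}" "\<lambda>u. m u * p b" "\<lambda>u. m u * p u"]
      set_integrable_mult_continuous[OF m cp] m by simp
  finally show "(LINT x:{a..b}|lborel. (c + (LINT u:{a..x}|lborel. m u)) * p' x)
       = (c + (LINT u:{a..b}|lborel. m u)) * p b - c * p a - (LINT u:{a..b}|lborel. m u * p u)"
    by (simp add: algebra_simps)
qed

section \<open>Trigonometric moments on the circle\<close>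

inductive trig_poly :: "(complex \<Rightarrow> real) \<Rightarrow> bool" where
  monom: "(\<And>z. norm z = 1 \<Longrightarrow> g z = Re (c * z ^ n)) \<Longrightarrow> trig_poly g"
| add: "trig_poly f \<Longrightarrow> trig_poly g \<Longrightarrow> (\<And>z. norm z = 1 \<Longrightarrow> h z = f z + g z) \<Longrightarrow> trig_poly h"

lemma Re_mult_Re: "Re a * Re b = Re (a * b / 2) + Re (a * cnj b / 2)"
  by (simp add: field_simps)

lemma cnj_power_mult_power:
  assumes "norm z = 1"
  shows "z ^ (n + m) * cnj (z ^ m) = z ^ n"
proof -
  have "z ^ m * cnj (z ^ m) = 1"
    using assms by (simp only: complex_norm_square[symmetric] norm_power) simp
  then show ?thesis by (simp only: power_add mult.assoc) simp
qed

lemma trig_poly_monom_mult: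
  assumes "trig_poly g" "\<And>z. norm z = 1 \<Longrightarrow> f z = Re (c * z ^ n)"
  shows "trig_poly (\<lambda>z. f z * g z)"
  using assms
proof (induction arbitrary: rule: trig_poly.induct)
  case (monom g d m)
  have 1: "trig_poly (\<lambda>z. Re (c * d / 2 * z ^ (n + m)))"
    by (rule trig_poly.monom[where c="c * d / 2" and n="n + m"]) simp
  \<comment> \<open>The mixed term has exponent \<open>n - m\<close>, which may be negative; in that
    case pass to the conjugate, which has the same real part.\<close>
  have 2: "trig_poly (\<lambda>z. Re (c * z ^ n * cnj (d * z ^ m) / 2))"
  proof (cases "m \<le> n")
    case True
    show ?thesis
    proof (rule trig_poly.monom)
      fix z :: complex assume z: "norm z = 1"
      have "z ^ n * cnj (z ^ m) = z ^ (n - m)"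
        using cnj_power_mult_power[OF z, of "n - m" m] True by simp
      moreover have "c * z ^ n * cnj (d * z ^ m) / 2 = (c * cnj d / 2) * (z ^ n * cnj (z ^ m))"
        by simp
      ultimately show "Re (c * z ^ n * cnj (d * z ^ m) / 2) = Re ((c * cnj d / 2) * z ^ (n - m))"
        by (simp only:)
    qed
  next
    case False
    show ?thesis
    proof (rule trig_poly.monom)
      fix z :: complex assume z: "norm z = 1"
      have "z ^ m * cnj (z ^ n) = z ^ (m - n)"
        using cnj_power_mult_power[OF z, of "m - n" n] False by simp
      moreover have "c * z ^ n * cnj (d * z ^ m) / 2 = cnj ((cnj c * d / 2) * (z ^ m * cnj (z ^ n)))"
        by simp
      ultimately have "c * z ^ n * cnj (d * z ^ m) / 2 = cnj ((cnj c * d / 2) * z ^ (m - n))"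
        by (simp only:)
      then show "Re (c * z ^ n * cnj (d * z ^ m) / 2) = Re ((cnj c * d / 2) * z ^ (m - n))"
        by (simp only: cnj.sel)
    qed
  qed
  show ?case
  proof (rule trig_poly.add[OF 1 2])
    fix z :: complex assume "norm z = 1"
    then show "f z * g z = Re (c * d / 2 * z ^ (n + m)) + Re (c * z ^ n * cnj (d * z ^ m) / 2)"
      using monom Re_mult_Re[of "c * z ^ n" "d * z ^ m"] by (simp add: power_add mult_ac)
  qed
next
  case (add g1 g2 h)
  show ?case
    by (rule trig_poly.add[OF add.IH]) (use add in \<open>auto simp: algebra_simps\<close>)
qed

lemma trig_poly_mult: "trig_poly f \<Longrightarrow> trig_poly g \<Longrightarrow> trig_poly (\<lambda>z. f z * g z)"
proof (induction rule: trig_poly.induct)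
  case (monom f c n)
  then show ?case using trig_poly_monom_mult[of g f c n] by auto
next
  case (add f1 f2 h)
  show ?case
    by (rule trig_poly.add[OF add.IH]) (use add in \<open>auto simp: algebra_simps\<close>)
qed

lemma trig_poly_real_polynomial:
  fixes g :: "complex \<Rightarrow> real"
  shows "real_polynomial_function g \<Longrightarrow> trig_poly g"
proof (induction rule: real_polynomial_function.induct)
  case (linear f)
  \<comment> \<open>A real-linear functional on the plane is the real part of multiplication by the
    conjugate of its gradient.\<close>
  have "f z = Re (Complex (f 1) (- f \<i>) * z ^ 1)" for z
  proof -
    have z: "z = Re z *\<^sub>R 1 + Im z *\<^sub>R \<i>" by (simp add: complex_eq_iff)
    have "f z = f (Re z *\<^sub>R 1 + Im z *\<^sub>R \<i>)" by (rule arg_cong[OF z])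
    also have "\<dots> = Re z * f 1 + Im z * f \<i>"
      by (simp only: linear_add[OF bounded_linear.linear[OF linear]]
          linear_scale[OF bounded_linear.linear[OF linear]] real_scaleR_def)
    also have "\<dots> = Re (Complex (f 1) (- f \<i>) * z ^ 1)" by simp
    finally show ?thesis .
  qed
  then show ?case by (rule trig_poly.monom)
next
  case (const c)
  show ?case by (rule trig_poly.monom[where c="of_real c" and n=0]) simp
next
  case (add f g) show ?case by (rule trig_poly.add[OF add.IH]) simp
next
  case (mult f g) show ?case by (rule trig_poly_mult[OF mult.IH])
qed

lemma set_integral_trig_poly_zero:
  assumes V: "set_integrable lborel {-pi..pi} V"
    and zero: "\<And>c n. (LINT s:{-pi..pi}|lborel. V s * Re (c * cis s ^ n)) = 0"
  shows "trig_poly g \<Longrightarrow> set_integrable lborel {-pi..pi} (\<lambda>s. V s * g (cis s)) \<and>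
     (LINT s:{-pi..pi}|lborel. V s * g (cis s)) = 0"
proof (induction rule: trig_poly.induct)
  case (monom g c n)
  have "set_integrable lborel {-pi..pi} (\<lambda>s. V s * Re (c * cis s ^ n))"
    by (intro set_integrable_mult_continuous V continuous_intros)
  then show ?case using monom zero[of c n] by simp
next
  case (add f g h)
  then show ?case
    using set_integral_add[of lborel "{-pi..pi}" "\<lambda>s. V s * f (cis s)" "\<lambda>s. V s * g (cis s)"]
    by (simp add: distrib_left)
qed

text \<open>Stone-Weierstrass on the circle: an approximation error \<open>e\<close> costs at most
  \<open>e\<close> times the L1 norm of \<open>V\<close>, and polynomials in the real and imaginary
  parts restrict to trigonometric polynomials.\<close>

lemma set_integral_continuous_circle_zero:
  assumes V: "set_integrable lborel {-pi..pi} V"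
    and zero: "\<And>c n. (LINT s:{-pi..pi}|lborel. V s * Re (c * cis s ^ n)) = 0"
    and F: "continuous_on (sphere 0 1) F"
  shows "(LINT s:{-pi..pi}|lborel. V s * F (cis s)) = 0"
proof -
  let ?I = "{-pi..pi}"
  define M where "M = (LINT s:?I|lborel. \<bar>V s\<bar>)"
  have Vabs: "set_integrable lborel ?I (\<lambda>s. \<bar>V s\<bar>)" using V by (rule set_integrable_abs)
  have M0: "M \<ge> 0" unfolding M_def set_lebesgue_integral_def by (intro integral_nonneg_AE) auto
  have cF: "continuous_on ?I (\<lambda>s. F (cis s))"
    by (rule continuous_on_compose2[OF F]) (auto intro!: continuous_intros)
  have VF: "set_integrable lborel ?I (\<lambda>s. V s * F (cis s))"
    by (intro set_integrable_mult_continuous V cF)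
  have bound: "\<bar>LINT s:?I|lborel. V s * F (cis s)\<bar> \<le> e * M" if e: "e > 0" for e
  proof -
    obtain g where g: "real_polynomial_function g" "\<And>x. x \<in> sphere 0 1 \<Longrightarrow> \<bar>F x - g x\<bar> < e"
      using Stone_Weierstrass_real_polynomial_function[OF compact_sphere F e] by blast
    note T = set_integral_trig_poly_zero[OF V zero trig_poly_real_polynomial[OF g(1)]]
    have "(LINT s:?I|lborel. V s * F (cis s)) = (LINT s:?I|lborel. V s * F (cis s) - V s * g (cis s))"
      using set_integral_diff(2)[OF VF, of "\<lambda>s. V s * g (cis s)"] T by simp
    also have "\<bar>\<dots>\<bar> \<le> (LINT s:?I|lborel. e * \<bar>V s\<bar>)"
      unfolding set_lebesgue_integral_def
    proof (rule integral_abs_bound[THEN order_trans], rule integral_mono)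
      show "integrable lborel (\<lambda>x. \<bar>indicat_real ?I x *\<^sub>R (V x * F (cis x) - V x * g (cis x))\<bar>)"
        using set_integral_diff(1)[OF VF, of "\<lambda>s. V s * g (cis s)"] T
        by (simp add: set_integrable_def)
      show "integrable lborel (\<lambda>x. indicat_real ?I x *\<^sub>R (e * \<bar>V x\<bar>))"
        using Vabs by (simp add: set_integrable_def mult.left_commute)
      fix x
      have "\<bar>V x * F (cis x) - V x * g (cis x)\<bar> = \<bar>V x\<bar> * \<bar>F (cis x) - g (cis x)\<bar>"
        by (simp add: abs_mult flip: right_diff_distrib)
      also have "\<dots> \<le> \<bar>V x\<bar> * e"
        using g(2)[of "cis x"] by (intro mult_left_mono) auto
      finally show "\<bar>indicat_real ?I x *\<^sub>R (V x * F (cis x) - V x * g (cis x))\<bar> \<le> indicat_real ?I x *\<^sub>R (e * \<bar>V x\<bar>)"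
        by (auto simp: indicator_def mult.commute)
    qed
    also have "\<dots> = e * M" by (simp add: M_def)
    finally show ?thesis .
  qed
  have "\<bar>LINT s:?I|lborel. V s * F (cis s)\<bar> \<le> 0 + e" if e: "e > 0" for e
  proof -
    \<comment> \<open>Dividing by \<open>M + 1\<close> avoids a case distinction for
      \<open>M = 0\<close>.\<close>
    have "e / (M + 1) * M \<le> e" using e M0 by (simp add: field_simps)
    then show ?thesis using bound[of "e / (M + 1)"] e M0 by auto
  qed
  then show ?thesis using field_le_epsilon by (metis abs_le_zero_iff)
qed

text \<open>The seam is excluded on purpose: both ends of the interval are sent to -1, so there the
  parameter cannot be recovered from the point.\<close>

lemma cis_mem_image_diff:
  assumes s: "s \<in> {-pi<..<pi}" and "B \<subseteq> {-pi..pi}"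
  shows "cis s \<in> cis ` B \<longleftrightarrow> s \<in> B"
proof
  assume "cis s \<in> cis ` B"
  then obtain t where t: "t \<in> B" "cis s = cis t" by auto
  have tr: "t \<in> {-pi..pi}" using t assms by auto
  have Arg_s: "Arg (cis s) = s" using s by (intro Arg_cis) auto
  have "t \<noteq> - pi"
  proof
    assume "t = - pi"
    then have "cis s = cis pi" using t by (simp add: complex_eq_iff)
    then have "Arg (cis s) = Arg (cis pi)" by (rule arg_cong)
    also have "Arg (cis pi) = pi" by (intro Arg_cis) auto
    finally show False using s Arg_s by simp
  qed
  then have "Arg (cis t) = t" using tr by (intro Arg_cis) auto
  then have "s = t" using Arg_s t(2) by simp
  then show "s \<in> B" using t(1) by simp
qed auto

lemma circle_zero_of_trig_moments:
  assumes V: "set_integrable lborel {-pi..pi} V"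
    and zero: "\<And>c n. (LINT s:{-pi..pi}|lborel. V s * Re (c * cis s ^ n)) = 0"
  shows "AE s in lborel. s \<in> {-pi..pi} \<longrightarrow> V s = 0"
proof -
  let ?I = "{-pi..pi}"
  have "AE s in lborel. indicator ?I s *\<^sub>R V s = 0"
  proof (rule AE_zero_of_box_integrals)
    show "integrable lborel (\<lambda>s. indicator ?I s *\<^sub>R V s)" using V by (simp add: set_integrable_def)
    fix a b :: real
    \<comment> \<open>The closed set to be avoided, with the seam point -1 thrown in. The functions
      \<open>F n\<close> are continuous on the circle, vanish on \<open>C\<close>, and increase to
      the indicator of its complement, the arc over the part of the interval inside
      \<open>{-pi<..<pi}\<close>.\<close>
    define C where "C = insert (cis pi) (cis ` (?I - {a<..<b}))"
    have "compact (?I - {a<..<b})" by (intro compact_diff) auto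
    then have clC: "closed C" unfolding C_def
      by (intro compact_imp_closed compact_insert compact_continuous_image continuous_intros)
    define F where "F n z = min 1 (real n * infdist z C)" for n z
    have "(\<lambda>n. LINT s|lborel. indicator ?I s *\<^sub>R (V s * F n (cis s))) \<longlonglongrightarrow>
        (LINT s|lborel. indicator {a<..<b} s *\<^sub>R (indicator ?I s *\<^sub>R V s))"
    proof (rule integral_dominated_convergence[where w = "\<lambda>s. indicator ?I s *\<^sub>R \<bar>V s\<bar>"])
      have V_meas: "(\<lambda>s. indicator ?I s *\<^sub>R V s) \<in> borel_measurable lborel"
        using V by (auto simp: set_integrable_def)
      show "(\<lambda>s. indicator {a<..<b} s *\<^sub>R (indicator ?I s *\<^sub>R V s)) \<in> borel_measurable lborel"
        using V_meas by measurable
      have "(\<lambda>s. F n (cis s)) \<in> borel_measurable lborel" for n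
        unfolding F_def by (auto intro!: borel_measurable_continuous_onI continuous_intros)
      from borel_measurable_times[OF V_meas this]
      show "(\<lambda>s. indicator ?I s *\<^sub>R (V s * F n (cis s))) \<in> borel_measurable lborel" for n
        by (simp add: mult.assoc)
      show "integrable lborel (\<lambda>s. indicator ?I s *\<^sub>R \<bar>V s\<bar>)"
        using set_integrable_abs[OF V] by (simp add: set_integrable_def)
      show "AE s in lborel. norm (indicator ?I s *\<^sub>R (V s * F n (cis s))) \<le> indicator ?I s *\<^sub>R \<bar>V s\<bar>" for n
        by (rule AE_I2) (auto simp: F_def indicator_def abs_mult infdist_nonneg intro!: mult_left_le)
      have "AE s in lborel. s \<noteq> pi" "AE s in lborel. s \<noteq> - pi" by (simp_all add: AE_lborel_singleton)
      then show "AE s in lborel. (\<lambda>n. indicator ?I s *\<^sub>R (V s * F n (cis s))) \<longlonglongrightarrow>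
          indicator {a<..<b} s *\<^sub>R (indicator ?I s *\<^sub>R V s)"
      proof eventually_elim
        fix s assume s: "s \<noteq> pi" "s \<noteq> - pi"
        show "(\<lambda>n. indicator ?I s *\<^sub>R (V s * F n (cis s))) \<longlonglongrightarrow>
          indicator {a<..<b} s *\<^sub>R (indicator ?I s *\<^sub>R V s)"
        proof (cases "s \<in> ?I")
          case True
          then have s': "s \<in> {-pi<..<pi}" using s by auto
          have Ceq: "C = cis ` (insert pi (?I - {a<..<b}))" by (simp add: C_def)
          have mem: "cis s \<in> C \<longleftrightarrow> s \<notin> {a<..<b}"
            unfolding Ceq using cis_mem_image_diff[OF s', of "insert pi (?I - {a<..<b})"] s' by auto
          have Cne: "C \<noteq> {}" by (simp add: C_def)
          have "(\<lambda>n. F n (cis s)) \<longlonglongrightarrow> indicator {a<..<b} s"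
          proof (cases "s \<in> {a<..<b}")
            case in_ab: True
            then have pos: "infdist (cis s) C > 0"
              using mem in_closed_iff_infdist_zero[OF clC Cne, of "cis s"] infdist_nonneg[of "cis s" C] by auto
            obtain N where N: "1 / infdist (cis s) C < real N" using reals_Archimedean2 by blast
            have "F n (cis s) = 1" if "n \<ge> N" for n
            proof -
              have "1 / infdist (cis s) C < real n" using N that by (meson less_le_trans of_nat_le_iff)
              then show ?thesis using pos by (simp add: F_def field_simps)
            qed
            then show ?thesis using in_ab
              by (intro tendsto_eventually) (auto simp: eventually_sequentially)
          next
            case False
            then have "infdist (cis s) C = 0"
              using mem in_closed_iff_infdist_zero[OF clC Cne, of "cis s"] by auto
            then show ?thesis using False by (simp add: F_def)
          qed
          from tendsto_mult_left[OF this, of "V s"] show ?thesis using True by (simp add: mult.commute)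
        qed simp
      qed
    qed
    moreover have "(LINT s|lborel. indicator ?I s *\<^sub>R (V s * F n (cis s))) = 0" for n
      using set_integral_continuous_circle_zero[OF V zero, of "F n"]
      by (simp add: set_lebesgue_integral_def F_def continuous_intros)
    ultimately show "(LINT s:box a b|lborel. indicator ?I s *\<^sub>R V s) = 0"
      by (simp add: set_lebesgue_integral_def LIMSEQ_const_iff)
  qed
  then show ?thesis by eventually_elim (auto simp: indicator_def)
qed

lemma set_integral_cos_sin_nat:
  assumes "n \<ge> 1"
  shows "(LINT s:{-pi..pi}|lborel. cos (real n * s)) = 0"
    "(LINT s:{-pi..pi}|lborel. sin (real n * s)) = 0"
proof -
  have "(LINT s:{-pi..pi}|lborel. cos (real n * s)) = sin (real n * pi) / real n - sin (real n * (-pi)) / real n"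
    using assms by (intro set_integral_FTC_except[where K="{}"] set_integrable_continuous_Icc continuous_intros)
      (auto intro!: derivative_eq_intros)
  then show "(LINT s:{-pi..pi}|lborel. cos (real n * s)) = 0" by simp
  have "(LINT s:{-pi..pi}|lborel. sin (real n * s)) = (- cos (real n * pi) / real n) - (- cos (real n * (-pi)) / real n)"
    using assms by (intro set_integral_FTC_except[where K="{}"] set_integrable_continuous_Icc continuous_intros)
      (auto intro!: derivative_eq_intros)
  then show "(LINT s:{-pi..pi}|lborel. sin (real n * s)) = 0" by simp
qed

text \<open>Subtracting the mean removes the moment of order zero and changes no other, so the
  preceding criterion applies to \<open>V - c\<close>.\<close>

lemma circle_const_of_trig_moments:
  assumes V: "set_integrable lborel {-pi..pi} V"
    and cos: "\<And>n. n \<ge> 1 \<Longrightarrow> (LINT s:{-pi..pi}|lborel. V s * cos (real n * s)) = 0"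
    and sin: "\<And>n. n \<ge> 1 \<Longrightarrow> (LINT s:{-pi..pi}|lborel. V s * sin (real n * s)) = 0"
  shows "\<exists>c. AE s in lborel. s \<in> {-pi..pi} \<longrightarrow> V s = c"
proof -
  let ?I = "{-pi..pi}"
  define c where "c = (LINT s:?I|lborel. V s) / (2 * pi)"
  have ic: "set_integrable lborel ?I (\<lambda>s. c)" by (intro set_integrable_continuous_Icc continuous_intros)
  have iV: "set_integrable lborel ?I (\<lambda>s. V s - c)" by (rule set_integral_diff(1)[OF V ic])
  have zero: "(LINT s:?I|lborel. (V s - c) * Re (d * cis s ^ n)) = 0" for d n
  proof (cases "n = 0")
    case True
    have "(LINT s:?I|lborel. c) = c * (2 * pi)"
      by (simp add: set_lebesgue_integral_def)
    then have "(LINT s:?I|lborel. V s - c) = 0"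
      using set_integral_diff(2)[OF V ic] by (simp add: c_def)
    then show ?thesis using True by simp
  next
    case False
    then have n: "n \<ge> 1" by simp
    have co: "set_integrable lborel ?I (\<lambda>s. W s * cos (real n * s))"
      and si: "set_integrable lborel ?I (\<lambda>s. W s * sin (real n * s))"
      if "set_integrable lborel ?I W" for W
      by (intro set_integrable_mult_continuous that continuous_intros)+
    have 1: "(LINT s:?I|lborel. (V s - c) * cos (real n * s)) = 0"
      using set_integral_diff(2)[OF co[OF V] co[OF ic]] cos[OF n] set_integral_cos_sin_nat(1)[OF n]
      by (simp add: left_diff_distrib)
    have 2: "(LINT s:?I|lborel. (V s - c) * sin (real n * s)) = 0"
      using set_integral_diff(2)[OF si[OF V] si[OF ic]] sin[OF n] set_integral_cos_sin_nat(2)[OF n]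
      by (simp add: left_diff_distrib)
    have "(LINT s:?I|lborel. (V s - c) * Re (d * cis s ^ n)) =
      (LINT s:?I|lborel. Re d * ((V s - c) * cos (real n * s)) - Im d * ((V s - c) * sin (real n * s)))"
      by (simp add: Complex.DeMoivre algebra_simps)
    also have "\<dots> = (LINT s:?I|lborel. Re d * ((V s - c) * cos (real n * s)))
        - (LINT s:?I|lborel. Im d * ((V s - c) * sin (real n * s)))"
      using co[OF iV] si[OF iV] by (intro set_integral_diff(2)) auto
    finally show ?thesis using 1 2 by simp
  qed
  show ?thesis
    using circle_zero_of_trig_moments[OF iV zero] by (intro exI[of _ c]) (auto elim: eventually_mono)
qed

section \<open>Periodic primitives and the Green kernel\<close>

lemma primitive_continuous_on:
  fixes g :: "real \<Rightarrow> real"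
  assumes "set_integrable lborel {a..b} g"
  shows "continuous_on {a..b} (\<lambda>s. LINT u:{a..s}|lborel. g u)"
proof -
  have "continuous_on {a..b} (\<lambda>s. integral {a..s} g)"
    by (rule indefinite_integral_continuous_1) (rule set_borel_integral_eq_integral(1)[OF assms])
  moreover have "integral {a..s} g = (LINT u:{a..s}|lborel. g u)" if "s \<in> {a..b}" for s
    using that by (intro set_borel_integral_eq_integral(2)[symmetric] set_integrable_subset[OF assms]) auto
  ultimately show ?thesis by (subst continuous_on_cong[OF refl, of _ _ "\<lambda>s. integral {a..s} g"]) auto
qed

lemma DERIV_eventually_eq:
  "(f has_real_derivative D) (at x) \<Longrightarrow> eventually (\<lambda>s. g s = f s) (nhds x) \<Longrightarrow> (g has_real_derivative D) (at x)"
  using DERIV_cong_ev[of x x g f D D] by simp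

lemma primitive_has_real_derivative:
  fixes g :: "real \<Rightarrow> real"
  assumes g: "continuous_on {a..b} g" and s: "s \<in> {a<..<b}"
  shows "((\<lambda>s. LINT u:{a..s}|lborel. g u) has_real_derivative g s) (at s)"
proof -
  have eq: "integral {a..s} g = (LINT u:{a..s}|lborel. g u)" if "s \<in> {a..b}" for s
    using that g by (intro set_borel_integral_eq_integral(2)[symmetric] set_integrable_continuous_Icc)
      (auto intro: continuous_on_subset)
  have "((\<lambda>s. integral {a..s} g) has_real_derivative g s) (at s within {a..b})"
    using s by (intro integral_has_real_derivative[OF g]) auto
  then have "((\<lambda>s. integral {a..s} g) has_real_derivative g s) (at s within {a<..<b})"
    by (rule DERIV_subset) auto
  then have "((\<lambda>s. integral {a..s} g) has_real_derivative g s) (at s)"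
    using s by (simp add: at_within_open[of s "{a<..<b}"])
  moreover have "eventually (\<lambda>s. s \<in> {a<..<b}) (nhds s)"
    using s by (intro eventually_nhds_in_open) auto
  then have "eventually (\<lambda>s. integral {a..s} g = (LINT u:{a..s}|lborel. g u)) (nhds s)"
    by eventually_elim (auto intro: eq)
  ultimately show ?thesis by (subst DERIV_cong_ev[OF refl _ refl, of _ "\<lambda>s. integral {a..s} g"]) (auto elim: eventually_mono)
qed

lemma set_integral_singleton_zero:
  fixes g :: "real \<Rightarrow> real"
  shows "(LINT u:{a}|lborel. g u) = 0"
proof -
  have "(LINT u|lborel. indicator {a} u *\<^sub>R g u) = (LINT u|lborel. indicator {a} u *\<^sub>R g a)"
    by (rule Bochner_Integration.integral_cong) (auto simp: indicator_def)
  then show ?thesis by (simp add: set_lebesgue_integral_def)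
qed

text \<open>The parameter \<open>k\<close> is the density of the time variable on the circle: \<open>m\<close> is \<open>dy/dt\<close> where \<open>dt = k ds\<close>.\<close>
definition circ_prim :: "(real \<Rightarrow> real) \<Rightarrow> (real \<Rightarrow> real) \<Rightarrow> (real \<Rightarrow> real) \<Rightarrow> bool" where
  "circ_prim k y m \<longleftrightarrow> set_integrable lborel {-pi..pi} (\<lambda>s. m s * k s) \<and>
     (LINT s:{-pi..pi}|lborel. m s * k s) = 0 \<and>
     (\<exists>c. AE s in lborel. s \<in> {-pi..pi} \<longrightarrow> y s = c + (LINT u:{-pi..s}|lborel. m u * k u))"

lemma circ_primI:
  assumes m: "set_integrable lborel {-pi..pi} (\<lambda>s. m s * k s)"
    and y: "\<And>s. s \<in> {-pi..pi} \<Longrightarrow> y s - y (-pi) = (LINT u:{-pi..s}|lborel. m u * k u)"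
    and per: "y pi = y (-pi)"
  shows "circ_prim k y m"
  unfolding circ_prim_def
proof (intro conjI exI[of _ "y (-pi)"] AE_I2 impI)
  show "(LINT s:{-pi..pi}|lborel. m s * k s) = 0" using y[of pi] per by simp
qed (use m y in force)+

lemma circ_prim_cmult:
  assumes "circ_prim k y m"
  shows "circ_prim k (\<lambda>s. a * y s) (\<lambda>s. a * m s)"
proof -
  obtain c where c: "AE s in lborel. s \<in> {-pi..pi} \<longrightarrow> y s = c + (LINT u:{-pi..s}|lborel. m u * k u)"
    using assms by (auto simp: circ_prim_def)
  have "AE s in lborel. s \<in> {-pi..pi} \<longrightarrow> a * y s = a * c + (LINT u:{-pi..s}|lborel. a * (m u * k u))"
    using c by eventually_elim (auto simp: distrib_left)
  then show ?thesis using assms by (auto simp: circ_prim_def mult.assoc)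
qed

lemma circ_prim_diff:
  assumes "circ_prim k y m" "circ_prim k y' m'"
  shows "circ_prim k (\<lambda>s. y s - y' s) (\<lambda>s. m s - m' s)"
proof -
  obtain c where c: "AE s in lborel. s \<in> {-pi..pi} \<longrightarrow> y s = c + (LINT u:{-pi..s}|lborel. m u * k u)"
    using assms by (auto simp: circ_prim_def)
  obtain c' where c': "AE s in lborel. s \<in> {-pi..pi} \<longrightarrow> y' s = c' + (LINT u:{-pi..s}|lborel. m' u * k u)"
    using assms by (auto simp: circ_prim_def)
  have i: "set_integrable lborel {-pi..s} (\<lambda>u. m u * k u)" "set_integrable lborel {-pi..s} (\<lambda>u. m' u * k u)"
    if "s \<in> {-pi..pi}" for s
    using assms that by (auto simp: circ_prim_def intro: set_integrable_subset)
  have "AE s in lborel. s \<in> {-pi..pi} \<longrightarrow>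
      y s - y' s = (c - c') + (LINT u:{-pi..s}|lborel. m u * k u - m' u * k u)"
    using c c'
  proof eventually_elim
    case (elim s)
    show ?case
    proof
      assume s: "s \<in> {-pi..pi}"
      show "y s - y' s = (c - c') + (LINT u:{-pi..s}|lborel. m u * k u - m' u * k u)"
        using set_integral_diff(2)[OF i[OF s]] elim s by simp
    qed
  qed
  moreover have "set_integrable lborel {-pi..pi} (\<lambda>u. m u * k u - m' u * k u)"
    "(LINT u:{-pi..pi}|lborel. m u * k u - m' u * k u) = 0"
    using set_integral_diff[OF i[of pi]] assms by (auto simp: circ_prim_def)
  ultimately show ?thesis by (auto simp: circ_prim_def left_diff_distrib)
qed

text \<open>The boundary terms cancel because \<open>p\<close> is periodic and \<open>m * k\<close>
  has total integral zero.\<close>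

lemma circ_prim_by_parts:
  assumes ym: "circ_prim k y m" and y[measurable]: "y \<in> borel_measurable borel"
    and p: "\<And>x. x \<in> {-pi..pi} \<Longrightarrow> (p has_real_derivative p' x) (at x)"
    and p': "continuous_on {-pi..pi} p'" and per: "p pi = p (-pi)"
  shows "(LINT s:{-pi..pi}|lborel. y s * p' s) = - (LINT s:{-pi..pi}|lborel. m s * k s * p s)"
proof -
  obtain c where c: "AE s in lborel. s \<in> {-pi..pi} \<longrightarrow> y s = c + (LINT u:{-pi..s}|lborel. m u * k u)"
    using ym by (auto simp: circ_prim_def)
  have mi: "set_integrable lborel {-pi..pi} (\<lambda>s. m s * k s)" and m0: "(LINT s:{-pi..pi}|lborel. m s * k s) = 0"
    using ym by (auto simp: circ_prim_def)
  note bp = set_integral_primitive_by_parts[OF _ mi p p', of c]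
  have "(LINT s:{-pi..pi}|lborel. (c + (LINT u:{-pi..s}|lborel. m u * k u)) * p' s)
      = - (LINT s:{-pi..pi}|lborel. m s * k s * p s)"
    using bp(1) per m0 by simp
  moreover have "(LINT s:{-pi..pi}|lborel. y s * p' s)
     = (LINT s:{-pi..pi}|lborel. (c + (LINT u:{-pi..s}|lborel. m u * k u)) * p' s)"
    unfolding set_lebesgue_integral_def[of lborel "{-pi..pi}"]
  proof (rule integral_cong_AE)
    have [measurable]: "(\<lambda>s. indicator {-pi..pi} s *\<^sub>R p' s) \<in> borel_measurable borel"
      using borel_measurable_continuous_on_indicator[OF _ p'] by simp
    have "(\<lambda>s. y s * (indicator {-pi..pi} s *\<^sub>R p' s)) \<in> borel_measurable borel" by measurable
    then show "(\<lambda>s. indicator {-pi..pi} s *\<^sub>R (y s * p' s)) \<in> borel_measurable lborel"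
      by (simp add: mult_ac)
    show "(\<lambda>s. indicator {-pi..pi} s *\<^sub>R ((c + (LINT u:{-pi..s}|lborel. m u * k u)) * p' s)) \<in> borel_measurable lborel"
      using bp(2) by (auto simp: set_integrable_def)
    show "AE s in lborel. indicator {-pi..pi} s *\<^sub>R (y s * p' s) =
        indicator {-pi..pi} s *\<^sub>R ((c + (LINT u:{-pi..s}|lborel. m u * k u)) * p' s)"
      using c by eventually_elim (auto simp: indicator_def)
  qed
  ultimately show ?thesis by simp
qed


section \<open>The time variable on one circle and its Green kernel\<close>

locale circle_weight =
  fixes k :: "real \<Rightarrow> real"
  assumes k_cont: "continuous_on UNIV k" and k_pos: "\<And>s. k s > 0"
begin

definition t :: "real \<Rightarrow> real" where "t s = (LINT u:{-pi..s}|lborel. k u)"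
definition T :: real where "T = t pi"

lemma k_int: "set_integrable lborel {a..b} k"
  by (intro set_integrable_continuous_Icc continuous_on_subset[OF k_cont]) auto

lemma t_lower [simp]: "t (-pi) = 0"
  by (simp add: t_def set_integral_singleton_zero)

lemma t_cont: "continuous_on {-pi..pi} t"
  unfolding t_def by (intro primitive_continuous_on k_int)

lemma t_deriv: "s \<in> {-pi<..<pi} \<Longrightarrow> (t has_real_derivative k s) (at s)"
  unfolding t_def by (intro primitive_has_real_derivative[of _ pi] continuous_on_subset[OF k_cont]) auto

lemma t_mono: "s \<le> r \<Longrightarrow> t s \<le> t r"
proof -
  assume "s \<le> r"
  then show ?thesis unfolding t_def set_lebesgue_integral_def
    using k_int[of "-pi" s] k_int[of "-pi" r] k_pos[THEN less_imp_le]
    by (intro integral_mono) (auto simp: set_integrable_def indicator_def)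
qed

lemma t_range: "s \<in> {-pi..pi} \<Longrightarrow> t s \<in> {0..T}"
  using t_mono[of "-pi" s] t_mono[of s pi] by (simp add: T_def)

lemma t_meas [measurable]: "t \<in> borel_measurable borel"
  by (rule borel_measurable_mono) (auto simp: mono_def t_mono)

lemma T_pos: "T > 0"
proof -
  have "T = integral {-pi..pi} k"
    unfolding T_def t_def by (rule set_borel_integral_eq_integral(2)[OF k_int])
  moreover have "integral {-pi..pi} k \<noteq> 0"
    using integral_eq_0_iff[of "-pi" pi k] continuous_on_subset[OF k_cont] k_pos
    by (auto simp: less_le)
  ultimately show ?thesis using t_range[of pi] by (simp add: T_def)
qed

text \<open>Chain rule in the time variable: functions of time whose values at 0 and
  \<open>T\<close> agree give periodic pairs. The trial functions at resonance are of this
  kind.\<close>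

lemma circ_prim_clock:
  assumes p: "\<And>u. (p has_real_derivative p' u) (at u)" and p': "continuous_on UNIV p'" and per: "p T = p 0"
  shows "circ_prim k (\<lambda>s. p (t s)) (\<lambda>s. p' (t s))"
proof (rule circ_primI)
  have pc: "continuous_on UNIV p" by (rule DERIV_continuous_on, rule DERIV_subset[OF p]) simp
  have int: "set_integrable lborel {-pi..s} (\<lambda>u. p' (t u) * k u)" if "s \<in> {-pi..pi}" for s
    using that by (intro set_integrable_continuous_Icc continuous_intros continuous_on_compose2[OF p']
        continuous_on_subset[OF t_cont] continuous_on_subset[OF k_cont]) auto
  show "set_integrable lborel {-pi..pi} (\<lambda>u. p' (t u) * k u)" by (rule int) simp
  show "p (t s) - p (t (-pi)) = (LINT u:{-pi..s}|lborel. p' (t u) * k u)" if s: "s \<in> {-pi..pi}" for s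
  proof (rule set_integral_FTC_except[where K="{}", symmetric])
    show "continuous_on {-pi..s} (\<lambda>u. p (t u))"
      using s by (intro continuous_on_compose2[OF pc] continuous_on_subset[OF t_cont]) auto
    show "((\<lambda>u. p (t u)) has_real_derivative p' (t x) * k x) (at x)" if "x \<in> {-pi<..<s} - {}" for x
      by (rule DERIV_chain2[OF p t_deriv]) (use s that in auto)
  qed (use s int in auto)
  show "p (t pi) = p (t (-pi))" using per by (simp add: T_def)
qed

end

text \<open>\<open>C\<close> stands for a cosine or a hyperbolic cosine. The parities let the kernel
  depend on the time distance only, and \<open>C 0\<close> and \<open>lam\<close> being nonzero
  makes the conserved quantity of the oscillator nonzero.\<close>

locale circle_kernel = circle_weight +
  fixes C S :: "real \<Rightarrow> real" and lam :: real
  assumes C_deriv: "\<And>u. (C has_real_derivative S u) (at u)"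
    and S_deriv: "\<And>u. (S has_real_derivative (- lam * C u)) (at u)"
    and C_even: "\<And>u. C (- u) = C u" and S_odd: "\<And>u. S (- u) = - S u"
    and C0: "C 0 \<noteq> 0" and lam0: "lam \<noteq> 0"
begin

text \<open>The even solution centred at half a period. If \<open>S (T / 2)\<close> is nonzero, the
  normalisation gives \<open>G1 0 = - 1 / 2\<close> and \<open>G1 T = 1 / 2\<close>, hence a unit
  jump once the ends are glued.\<close>

definition G :: "real \<Rightarrow> real" where "G u = C (u - T / 2) / (2 * S (T / 2))"
definition G1 :: "real \<Rightarrow> real" where "G1 u = S (u - T / 2) / (2 * S (T / 2))"
definition kern :: "real \<Rightarrow> real \<Rightarrow> real" where "kern s r = G \<bar>t s - t r\<bar>"
text \<open>The derivative of \<open>kern\<close> in the time of its first argument. On the diagonal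
  it takes the value \<open>- G1 0\<close> from the side \<open>s <= r\<close>; this is why the jump
  term below carries a strict inequality.\<close>

definition kern1 :: "real \<Rightarrow> real \<Rightarrow> real" where
  "kern1 s r = (if r < s then G1 (t s - t r) else - G1 (t r - t s))"

definition solution :: "(real \<Rightarrow> real) \<Rightarrow> real \<Rightarrow> real" where
  "solution f s = (LINT r:{-pi..pi}|lborel. kern s r * (f r * k r))"
definition solution1 :: "(real \<Rightarrow> real) \<Rightarrow> real \<Rightarrow> real" where
  "solution1 f s = (LINT r:{-pi..pi}|lborel. kern1 s r * (f r * k r))"

lemma C_meas [measurable]: "C \<in> borel_measurable borel"
  by (intro borel_measurable_continuous_onI DERIV_continuous_on[OF C_deriv[THEN DERIV_subset]]) auto

lemma S_meas [measurable]: "S \<in> borel_measurable borel"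
  by (intro borel_measurable_continuous_onI DERIV_continuous_on[OF S_deriv[THEN DERIV_subset]]) auto

lemma kern_meas: "(\<lambda>(s, r). kern s r) \<in> borel_measurable (borel \<Otimes>\<^sub>M borel)"
  unfolding kern_def G_def by measurable

lemma kern1_meas: "(\<lambda>(s, r). kern1 s r) \<in> borel_measurable (borel \<Otimes>\<^sub>M borel)"
  unfolding kern1_def G1_def by measurable

text \<open>Reflection in the half period exchanges the two one-sided formulas, which is why the
  kernel closes up periodically.\<close>

lemma G_reflect: "G (T - u) = G u" "G1 (T - u) = - G1 u"
proof -
  have "T - u - T / 2 = - (u - T / 2)" by (simp add: field_simps)
  then show "G (T - u) = G u" "G1 (T - u) = - G1 u"
    by (simp_all only: G_def G1_def C_even S_odd minus_divide_left)
qed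

text \<open>The energy of the oscillator. It reappears as the determinant of the linear system in
  the uniqueness proof.\<close>

lemma energy_const: "(S u)\<^sup>2 + lam * (C u)\<^sup>2 = lam * (C 0)\<^sup>2"
proof -
  have "((\<lambda>u. (S u)\<^sup>2 + lam * (C u)\<^sup>2) has_real_derivative 0) (at u)" for u
    by (auto intro!: derivative_eq_intros C_deriv S_deriv)
  then have "(S u)\<^sup>2 + lam * (C u)\<^sup>2 = (S 0)\<^sup>2 + lam * (C 0)\<^sup>2"
    by (intro DERIV_isconst_all) auto
  moreover have "S 0 = 0" using S_odd[of 0] by simp
  ultimately show ?thesis by simp
qed

end

locale circle_nonres = circle_kernel +
  assumes ST: "S (T / 2) \<noteq> 0"
begin

lemma G_deriv:
  "(G has_real_derivative G1 u) (at u)" "(G1 has_real_derivative (- lam * G u)) (at u)"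
proof -
  have "((\<lambda>u. C (u - T / 2)) has_real_derivative S (u - T / 2) * 1) (at u)"
    by (rule DERIV_chain2[OF C_deriv]) (auto intro!: derivative_eq_intros)
  from DERIV_cdivide[OF this, of "2 * S (T / 2)"] show "(G has_real_derivative G1 u) (at u)"
    by (simp add: G_def[abs_def] G1_def)
  have "((\<lambda>u. S (u - T / 2)) has_real_derivative (- lam * C (u - T / 2)) * 1) (at u)"
    by (rule DERIV_chain2[OF S_deriv]) (auto intro!: derivative_eq_intros)
  from DERIV_cdivide[OF this, of "2 * S (T / 2)"] show "(G1 has_real_derivative (- lam * G u)) (at u)"
    by (simp add: G_def G1_def[abs_def])
qed

lemma G1_0: "G1 0 = - 1 / 2"
  using ST S_odd[of "T / 2"] by (simp add: G1_def)

lemma G_cont: "continuous_on A G" "continuous_on A G1"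
  by (rule DERIV_continuous_on, rule DERIV_subset[OF _ subset_UNIV], rule G_deriv)+

text \<open>Away from the diagonal the kernel solves the homogeneous equation. On it
  \<open>kern\<close> is continuous, and adding \<open>of_bool (r < s)\<close> repairs the downward
  unit jump of \<open>kern1\<close>, so both are primitives of their piecewise derivatives.\<close>

lemma kern_primitive:
  assumes s: "s \<in> {-pi..pi}" and r: "r \<in> {-pi..pi}"
  shows "(LINT u:{-pi..s}|lborel. kern1 u r * k u) = kern s r - kern (-pi) r"
    and "(LINT u:{-pi..s}|lborel. - lam * kern u r * k u) = kern1 s r + of_bool (r < s) - kern1 (-pi) r"
proof -
  obtain M where M: "\<And>u. u \<in> {-T..T} \<Longrightarrow> \<bar>G u\<bar> \<le> M \<and> \<bar>G1 u\<bar> \<le> M"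
  proof -
    have "bounded (G ` {-T..T})" "bounded (G1 ` {-T..T})"
      by (intro compact_imp_bounded compact_continuous_image G_cont; simp)+
    then obtain a b where "\<forall>x\<in>{-T..T}. \<bar>G x\<bar> \<le> a" "\<forall>x\<in>{-T..T}. \<bar>G1 x\<bar> \<le> b"
      by (auto simp: bounded_iff)
    then show thesis by (intro that[of "max a b"]) force
  qed
  have dist: "t u - t r \<in> {-T..T}" "t r - t u \<in> {-T..T}" "\<bar>t u - t r\<bar> \<in> {-T..T}" if "u \<in> {-pi..s}" for u
    using t_range[of u] t_range[OF r] s that by auto
  have sub: "{-pi..s} \<subseteq> {-pi..pi}" using s by auto
  have tc: "continuous_on {-pi..s} t" by (rule continuous_on_subset[OF t_cont sub])
  have der: "((\<lambda>u. G \<bar>t u - t r\<bar>) has_real_derivative kern1 u r * k u) (at u)"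
     "((\<lambda>u. kern1 u r + of_bool (r < u)) has_real_derivative - lam * kern u r * k u) (at u)"
    if u: "u \<in> {-pi<..<s} - {r}" for u
  proof -
    have td: "(t has_real_derivative k u) (at u)" using t_deriv u s by auto
    consider "r < u" | "u < r" using u by fastforce
    then have "((\<lambda>u. G \<bar>t u - t r\<bar>) has_real_derivative kern1 u r * k u) (at u) \<and>
      ((\<lambda>u. kern1 u r + of_bool (r < u)) has_real_derivative - lam * kern u r * k u) (at u)"
    proof cases
      case 1
      have ev: "eventually (\<lambda>u. u \<in> {r<..}) (nhds u)" using 1 by (intro eventually_nhds_in_open) auto
      have d: "((\<lambda>u. t u - t r) has_real_derivative k u) (at u)" using td by (auto intro!: derivative_eq_intros)
      have e1: "eventually (\<lambda>u. G \<bar>t u - t r\<bar> = G (t u - t r)) (nhds u)"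
        using ev by eventually_elim (use t_mono in \<open>auto intro!: arg_cong[where f=G] abs_of_nonneg\<close>)
      have e2: "eventually (\<lambda>u. kern1 u r + of_bool (r < u) = G1 (t u - t r) + 1) (nhds u)"
        using ev by eventually_elim (auto simp: kern1_def)
      have "((\<lambda>u. G (t u - t r)) has_real_derivative G1 (t u - t r) * k u) (at u)"
        by (rule DERIV_chain2[OF G_deriv(1) d])
      moreover have "((\<lambda>u. G1 (t u - t r) + 1) has_real_derivative (- lam * G (t u - t r)) * k u) (at u)"
        using DERIV_chain2[OF G_deriv(2) d] by (auto intro!: derivative_eq_intros)
      moreover have "kern1 u r = G1 (t u - t r)" "kern u r = G (t u - t r)"
        using 1 t_mono[of r u] by (auto simp: kern1_def kern_def)
      ultimately show ?thesis
        using DERIV_cong_ev[OF refl e1 refl] DERIV_cong_ev[OF refl e2 refl] by simp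
    next
      case 2
      have ev: "eventually (\<lambda>u. u \<in> {..<r}) (nhds u)" using 2 by (intro eventually_nhds_in_open) auto
      have d: "((\<lambda>u. t r - t u) has_real_derivative - k u) (at u)" using td by (auto intro!: derivative_eq_intros)
      have e1: "eventually (\<lambda>u. G \<bar>t u - t r\<bar> = G (t r - t u)) (nhds u)"
        using ev by eventually_elim (use t_mono in \<open>auto intro!: arg_cong[where f=G]\<close>)
      have e2: "eventually (\<lambda>u. kern1 u r + of_bool (r < u) = - G1 (t r - t u)) (nhds u)"
        using ev by eventually_elim (auto simp: kern1_def)
      have "((\<lambda>u. G (t r - t u)) has_real_derivative G1 (t r - t u) * - k u) (at u)"
        by (rule DERIV_chain2[OF G_deriv(1) d])
      moreover have "((\<lambda>u. - G1 (t r - t u)) has_real_derivative - ((- lam * G (t r - t u)) * - k u)) (at u)"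
        by (rule DERIV_minus[OF DERIV_chain2[OF G_deriv(2) d]])
      moreover have "kern1 u r = - G1 (t r - t u)" "kern u r = G (t r - t u)"
        using 2 t_mono[of u r] by (auto simp: kern1_def kern_def)
      ultimately show ?thesis
        using DERIV_cong_ev[OF refl e1 refl] DERIV_cong_ev[OF refl e2 refl] by simp
    qed
    then show "((\<lambda>u. G \<bar>t u - t r\<bar>) has_real_derivative kern1 u r * k u) (at u)"
     "((\<lambda>u. kern1 u r + of_bool (r < u)) has_real_derivative - lam * kern u r * k u) (at u)" by auto
  qed
  have c1: "continuous_on {-pi..s} (\<lambda>u. G \<bar>t u - t r\<bar>)"
    by (rule continuous_on_compose2[OF G_cont(1)[of UNIV]]) (auto intro!: continuous_intros tc)
  \<comment> \<open>The two branches meet at \<open>r\<close> because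
    \<open>- G1 0 = G1 0 + 1\<close>.\<close>
  have c2: "continuous_on {-pi..s} (\<lambda>u. kern1 u r + of_bool (r < u))"
  proof -
    have "continuous_on ({-pi..s} \<inter> {..r} \<union> {-pi..s} \<inter> {r..}) (\<lambda>u. if u \<le> r then - G1 (t r - t u) else G1 (t u - t r) + 1)"
    proof (rule continuous_on_If)
      show "continuous_on ({-pi..s} \<inter> {..r}) (\<lambda>u. - G1 (t r - t u))"
        by (intro continuous_on_minus continuous_on_compose2[OF G_cont(2)[of UNIV]] continuous_intros
            continuous_on_subset[OF tc]) auto
      show "continuous_on ({-pi..s} \<inter> {r..}) (\<lambda>u. G1 (t u - t r) + 1)"
        by (intro continuous_on_add continuous_on_compose2[OF G_cont(2)[of UNIV]] continuous_intros
            continuous_on_subset[OF tc]) auto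
    qed (auto simp: G1_0)
    moreover have "{-pi..s} \<inter> {..r} \<union> {-pi..s} \<inter> {r..} = {-pi..s}" by auto
    moreover have "(if u \<le> r then - G1 (t r - t u) else G1 (t u - t r) + 1) = kern1 u r + of_bool (r < u)" for u
      by (auto simp: kern1_def)
    ultimately show ?thesis by simp
  qed
  have [measurable]: "k \<in> borel_measurable borel" by (rule borel_measurable_continuous_onI[OF k_cont])
  have km: "(\<lambda>u. kern u r) \<in> borel_measurable borel" "(\<lambda>u. kern1 u r) \<in> borel_measurable borel"
    unfolding kern_def kern1_def G_def G1_def by measurable
  have i1: "set_integrable lborel {-pi..s} (\<lambda>u. k u * kern1 u r)"
    by (rule set_integrable_mult_bounded[where B=M, OF k_int])
       (use km dist M in \<open>auto simp: set_borel_measurable_def kern1_def\<close>)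
  have i2: "set_integrable lborel {-pi..s} (\<lambda>u. k u * kern u r)"
    by (rule set_integrable_mult_bounded[where B=M, OF k_int])
       (use km dist M in \<open>auto simp: set_borel_measurable_def kern_def\<close>)
  have "(LINT u:{-pi..s}|lborel. kern1 u r * k u) = G \<bar>t s - t r\<bar> - G \<bar>t (-pi) - t r\<bar>"
    by (rule set_integral_FTC_except[where K="{r}"]) (use s c1 der i1 in \<open>auto simp: mult.commute\<close>)
  then show "(LINT u:{-pi..s}|lborel. kern1 u r * k u) = kern s r - kern (-pi) r"
    by (simp only: kern_def)
  have i3: "set_integrable lborel {-pi..s} (\<lambda>u. - lam * kern u r * k u)"
    using i2[THEN set_integrable_mult_right, of "- lam"] by (simp add: mult_ac)
  have "(LINT u:{-pi..s}|lborel. - lam * kern u r * k u) = kern1 s r + of_bool (r < s) - (kern1 (-pi) r + of_bool (r < -pi))"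
    by (rule set_integral_FTC_except[where K="{r}", OF _ _ c2 der(2) i3]) (use s in auto)
  then show "(LINT u:{-pi..s}|lborel. - lam * kern u r * k u) = kern1 s r + of_bool (r < s) - kern1 (-pi) r"
    using r by simp
qed

text \<open>The majorant is explicit, unlike a compactness bound on one circle, so that a single
  \<open>M\<close> can later be used for all energies.\<close>

lemma kern_bounds:
  assumes M: "\<And>u. \<bar>u\<bar> \<le> T / 2 \<Longrightarrow> \<bar>C u\<bar> \<le> M * (2 * \<bar>S (T / 2)\<bar>) \<and> \<bar>S u\<bar> \<le> M * (2 * \<bar>S (T / 2)\<bar>)"
    and s: "s \<in> {-pi..pi}" and r: "r \<in> {-pi..pi}"
  shows "\<bar>kern s r\<bar> \<le> M" "\<bar>kern1 s r\<bar> \<le> M"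
proof -
  have 1: "\<bar>G u\<bar> \<le> M" "\<bar>G1 u\<bar> \<le> M" if "0 \<le> u" "u \<le> T" for u
  proof -
    have "\<bar>u - T / 2\<bar> \<le> T / 2" using that by (simp add: abs_le_iff field_simps)
    from M[OF this] show "\<bar>G u\<bar> \<le> M" "\<bar>G1 u\<bar> \<le> M"
      using ST by (auto simp: G_def G1_def abs_divide abs_mult divide_le_eq)
  qed
  show "\<bar>kern s r\<bar> \<le> M" unfolding kern_def
    using t_range[OF s] t_range[OF r] by (intro 1) auto
  show "\<bar>kern1 s r\<bar> \<le> M" unfolding kern1_def
    using t_range[OF s] t_range[OF r] t_mono[of s r] t_mono[of r s] by (auto intro!: 1)
qed

lemma exists_kern_bound:
  obtains M where "\<And>s r. s \<in> {-pi..pi} \<Longrightarrow> r \<in> {-pi..pi} \<Longrightarrow> \<bar>kern s r\<bar> \<le> M"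
    "\<And>s r. s \<in> {-pi..pi} \<Longrightarrow> r \<in> {-pi..pi} \<Longrightarrow> \<bar>kern1 s r\<bar> \<le> M"
proof -
  have "bounded (G ` {0..T})" "bounded (G1 ` {0..T})"
    by (intro compact_imp_bounded compact_continuous_image G_cont; simp)+
  then obtain a b where ab: "\<forall>x\<in>{0..T}. \<bar>G x\<bar> \<le> a" "\<forall>x\<in>{0..T}. \<bar>G1 x\<bar> \<le> b"
    by (auto simp: bounded_iff)
  show thesis
  proof (rule that[of "max a b"])
    fix s r assume s: "s \<in> {-pi..pi}" and r: "r \<in> {-pi..pi}"
    show "\<bar>kern s r\<bar> \<le> max a b" unfolding kern_def
      using t_range[OF s] t_range[OF r] by (intro max.coboundedI1 bspec[OF ab(1)]) auto
    show "\<bar>kern1 s r\<bar> \<le> max a b" unfolding kern1_def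
      using t_range[OF s] t_range[OF r] t_mono[of s r] t_mono[of r s]
      by (auto intro!: max.coboundedI2 bspec[OF ab(2)])
  qed
qed

lemma kern_section_meas: "(\<lambda>r. kern s r) \<in> borel_measurable borel" "(\<lambda>r. kern1 s r) \<in> borel_measurable borel"
  using measurable_Pair2[OF kern_meas, of s] measurable_Pair2[OF kern1_meas, of s] by simp_all

lemma kern_mult_integrable:
  assumes f: "set_integrable lborel {-pi..pi} (\<lambda>s. f s * k s)" and s: "s \<in> {-pi..pi}"
  shows "set_integrable lborel {-pi..pi} (\<lambda>r. kern s r * (f r * k r))"
    "set_integrable lborel {-pi..pi} (\<lambda>r. kern1 s r * (f r * k r))"
proof -
  obtain M where M: "\<And>s r. s \<in> {-pi..pi} \<Longrightarrow> r \<in> {-pi..pi} \<Longrightarrow> \<bar>kern s r\<bar> \<le> M"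
    "\<And>s r. s \<in> {-pi..pi} \<Longrightarrow> r \<in> {-pi..pi} \<Longrightarrow> \<bar>kern1 s r\<bar> \<le> M"
    using exists_kern_bound by blast
  have "set_integrable lborel {-pi..pi} (\<lambda>r. (f r * k r) * kern s r)"
    by (rule set_integrable_mult_bounded[where B=M, OF f])
       (use kern_section_meas M s in \<open>auto simp: set_borel_measurable_def\<close>)
  then show "set_integrable lborel {-pi..pi} (\<lambda>r. kern s r * (f r * k r))" by (simp add: mult.commute)
  have "set_integrable lborel {-pi..pi} (\<lambda>r. (f r * k r) * kern1 s r)"
    by (rule set_integrable_mult_bounded[where B=M, OF f])
       (use kern_section_meas M s in \<open>auto simp: set_borel_measurable_def\<close>)
  then show "set_integrable lborel {-pi..pi} (\<lambda>r. kern1 s r * (f r * k r))" by (simp add: mult.commute)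
qed

lemma solution_bound:
  assumes M: "\<And>s r. s \<in> {-pi..pi} \<Longrightarrow> r \<in> {-pi..pi} \<Longrightarrow> \<bar>kern s r\<bar> \<le> M"
    "\<And>s r. s \<in> {-pi..pi} \<Longrightarrow> r \<in> {-pi..pi} \<Longrightarrow> \<bar>kern1 s r\<bar> \<le> M"
    and f: "set_integrable lborel {-pi..pi} (\<lambda>s. f s * k s)" and s: "s \<in> {-pi..pi}"
  shows "\<bar>solution f s\<bar> \<le> M * (LINT r:{-pi..pi}|lborel. \<bar>f r\<bar> * k r)"
    "\<bar>solution1 f s\<bar> \<le> M * (LINT r:{-pi..pi}|lborel. \<bar>f r\<bar> * k r)"
proof -
  have fa: "set_integrable lborel {-pi..pi} (\<lambda>r. \<bar>f r\<bar> * k r)"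
    using set_integrable_abs[OF f] k_pos[THEN less_imp_le] by (simp add: abs_mult)
  have gen: "\<bar>LINT r:{-pi..pi}|lborel. h r * (f r * k r)\<bar> \<le> M * (LINT r:{-pi..pi}|lborel. \<bar>f r\<bar> * k r)"
    if h: "set_integrable lborel {-pi..pi} (\<lambda>r. h r * (f r * k r))"
      and hM: "\<And>r. r \<in> {-pi..pi} \<Longrightarrow> \<bar>h r\<bar> \<le> M" for h
  proof -
    have "\<bar>LINT r:{-pi..pi}|lborel. h r * (f r * k r)\<bar> \<le> (LINT r:{-pi..pi}|lborel. \<bar>h r * (f r * k r)\<bar>)"
      using h unfolding set_lebesgue_integral_def set_integrable_def
      by (rule_tac order_trans[OF integral_abs_bound]) (simp add: abs_mult)
    also have "\<dots> \<le> (LINT r:{-pi..pi}|lborel. M * (\<bar>f r\<bar> * k r))"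
    proof (rule set_integral_mono)
      show "set_integrable lborel {-pi..pi} (\<lambda>r. \<bar>h r * (f r * k r)\<bar>)" by (rule set_integrable_abs[OF h])
      show "set_integrable lborel {-pi..pi} (\<lambda>r. M * (\<bar>f r\<bar> * k r))" using fa by simp
      fix r :: real assume "r \<in> {-pi..pi}"
      from mult_right_mono[OF hM[OF this], of "\<bar>f r\<bar> * k r"]
      show "\<bar>h r * (f r * k r)\<bar> \<le> M * (\<bar>f r\<bar> * k r)"
        using k_pos[of r] by (simp add: abs_mult)
    qed
    finally show ?thesis by simp
  qed
  show "\<bar>solution f s\<bar> \<le> M * (LINT r:{-pi..pi}|lborel. \<bar>f r\<bar> * k r)"
    unfolding solution_def by (intro gen kern_mult_integrable f s M)
  show "\<bar>solution1 f s\<bar> \<le> M * (LINT r:{-pi..pi}|lborel. \<bar>f r\<bar> * k r)"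
    unfolding solution1_def by (intro gen kern_mult_integrable f s M)
qed

lemma kern_swap:
  assumes f: "set_integrable lborel {-pi..pi} (\<lambda>s. f s * k s)" and s: "s \<in> {-pi..pi}"
  shows "(LINT r:{-pi..pi}|lborel. (LINT u:{-pi..s}|lborel. kern1 u r * k u) * (f r * k r))
     = (LINT u:{-pi..s}|lborel. solution1 f u * k u)"
    "(LINT r:{-pi..pi}|lborel. (LINT u:{-pi..s}|lborel. kern u r * k u) * (f r * k r))
     = (LINT u:{-pi..s}|lborel. solution f u * k u)"
    "set_integrable lborel {-pi..s} (\<lambda>u. solution1 f u * k u)"
    "set_integrable lborel {-pi..s} (\<lambda>u. solution f u * k u)"
proof -
  obtain M where M: "\<And>s r. s \<in> {-pi..pi} \<Longrightarrow> r \<in> {-pi..pi} \<Longrightarrow> \<bar>kern s r\<bar> \<le> M"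
    "\<And>s r. s \<in> {-pi..pi} \<Longrightarrow> r \<in> {-pi..pi} \<Longrightarrow> \<bar>kern1 s r\<bar> \<le> M"
    using exists_kern_bound by blast
  have M': "\<And>u r. u \<in> {-pi..s} \<Longrightarrow> r \<in> {-pi..pi} \<Longrightarrow> \<bar>kern u r\<bar> \<le> M"
    "\<And>u r. u \<in> {-pi..s} \<Longrightarrow> r \<in> {-pi..pi} \<Longrightarrow> \<bar>kern1 u r\<bar> \<le> M"
    using M s by auto
  show "(LINT r:{-pi..pi}|lborel. (LINT u:{-pi..s}|lborel. kern1 u r * k u) * (f r * k r))
     = (LINT u:{-pi..s}|lborel. solution1 f u * k u)"
    "set_integrable lborel {-pi..s} (\<lambda>u. solution1 f u * k u)"
    using set_integral_swap_bounded[OF kern1_meas M'(2) k_int f] unfolding solution1_def by auto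
  show "(LINT r:{-pi..pi}|lborel. (LINT u:{-pi..s}|lborel. kern u r * k u) * (f r * k r))
     = (LINT u:{-pi..s}|lborel. solution f u * k u)"
    "set_integrable lborel {-pi..s} (\<lambda>u. solution f u * k u)"
    using set_integral_swap_bounded[OF kern_meas M'(1) k_int f] unfolding solution_def by auto
qed

text \<open>The kernel identity is integrated against the source and the integrals are exchanged;
  the periodic closure comes from \<open>G (T - u) = G u\<close>.\<close>

lemma solution_circ_prim:
  assumes f: "set_integrable lborel {-pi..pi} (\<lambda>s. f s * k s)"
  shows "circ_prim k (solution f) (solution1 f)"
proof (rule circ_primI)
  show "set_integrable lborel {-pi..pi} (\<lambda>s. solution1 f s * k s)" by (rule kern_swap(3)[OF f]) simp
  show "solution f s - solution f (- pi) = (LINT u:{-pi..s}|lborel. solution1 f u * k u)" if s: "s \<in> {-pi..pi}" for s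
  proof -
    have "solution f s - solution f (- pi) = (LINT r:{-pi..pi}|lborel. kern s r * (f r * k r) - kern (-pi) r * (f r * k r))"
      unfolding solution_def by (rule set_integral_diff(2)[symmetric]) (intro kern_mult_integrable f, use s in auto)+
    also have "\<dots> = (LINT r:{-pi..pi}|lborel. (LINT u:{-pi..s}|lborel. kern1 u r * k u) * (f r * k r))"
      by (intro set_lebesgue_integral_cong) (auto simp: kern_primitive[OF s] left_diff_distrib)
    also have "\<dots> = (LINT u:{-pi..s}|lborel. solution1 f u * k u)" by (rule kern_swap[OF f s])
    finally show ?thesis .
  qed
  have "kern pi r = kern (-pi) r" if "r \<in> {-pi..pi}" for r
  proof -
    have "\<bar>t pi - t r\<bar> = T - t r" "\<bar>t (-pi) - t r\<bar> = t r" using t_range[OF that] by (auto simp: T_def)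
    then show ?thesis by (simp only: kern_def G_reflect)
  qed
  then show "solution f pi = solution f (-pi)"
    unfolding solution_def by (intro set_lebesgue_integral_cong) auto
qed

text \<open>The jump term of the kernel identity integrates to the primitive of \<open>f\<close>:
  this is how the source enters the equation.\<close>

lemma solution1_circ_prim:
  assumes f: "set_integrable lborel {-pi..pi} (\<lambda>s. f s * k s)"
  shows "circ_prim k (solution1 f) (\<lambda>s. - (lam * solution f s + f s))"
proof (rule circ_primI)
  have i: "set_integrable lborel {-pi..s} (\<lambda>s. solution f s * k s)"
    "set_integrable lborel {-pi..s} (\<lambda>s. f s * k s)" if "s \<in> {-pi..pi}" for s
    using kern_swap(4)[OF f] f that by (auto intro: set_integrable_subset)
  have eq: "- (lam * solution f s + f s) * k s = - lam * (solution f s * k s) - f s * k s" for s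
    by (simp add: algebra_simps)
  have i2: "set_integrable lborel {-pi..s} (\<lambda>s. - lam * (solution f s * k s))" if "s \<in> {-pi..pi}" for s
    using set_integrable_mult_right[OF i(1)[OF that], of "- lam"] by blast
  show "set_integrable lborel {-pi..pi} (\<lambda>s. - (lam * solution f s + f s) * k s)"
    unfolding eq by (intro set_integral_diff(1) i2 i) auto
  show "solution1 f s - solution1 f (- pi) = (LINT u:{-pi..s}|lborel. - (lam * solution f u + f u) * k u)"
    if s: "s \<in> {-pi..pi}" for s
  proof -
    have ind: "(LINT r:{-pi..pi}|lborel. of_bool (r < s) * (f r * k r)) = (LINT r:{-pi..s}|lborel. f r * k r)"
      and ind_i: "set_integrable lborel {-pi..pi} (\<lambda>r. of_bool (r < s) * (f r * k r))"
    proof -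
      have "set_integrable lborel {-pi..pi} (\<lambda>r. (f r * k r) * of_bool (r < s))"
        by (rule set_integrable_mult_bounded[OF f, where B=1]) (auto simp: set_borel_measurable_def)
      then show ind_i: "set_integrable lborel {-pi..pi} (\<lambda>r. of_bool (r < s) * (f r * k r))"
        by (simp add: mult.commute)
      show "(LINT r:{-pi..pi}|lborel. of_bool (r < s) * (f r * k r)) = (LINT r:{-pi..s}|lborel. f r * k r)"
        unfolding set_lebesgue_integral_def
      proof (rule integral_cong_AE)
        show "AE r in lborel. indicator {-pi..pi} r *\<^sub>R (of_bool (r < s) * (f r * k r)) = indicator {-pi..s} r *\<^sub>R (f r * k r)"
          using AE_lborel_singleton[of s] by eventually_elim (use s in \<open>auto simp: indicator_def\<close>)
      qed (use ind_i i(2)[OF s] in \<open>auto simp: set_integrable_def\<close>)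
    qed
    have lk: "(LINT u:{-pi..s}|lborel. - lam * kern u r * k u) = - lam * (LINT u:{-pi..s}|lborel. kern u r * k u)" for r
      by (subst set_integral_mult_right[symmetric]) (simp add: mult.assoc)
    have kp: "(LINT u:{-pi..s}|lborel. - lam * kern u r * k u) * (f r * k r)
        = kern1 s r * (f r * k r) + of_bool (r < s) * (f r * k r) - kern1 (-pi) r * (f r * k r)"
      if "r \<in> {-pi..pi}" for r
      by (simp only: kern_primitive(2)[OF s that] distrib_right left_diff_distrib)
    have sw_i: "set_integrable lborel {-pi..pi} (\<lambda>r. (LINT u:{-pi..s}|lborel. - lam * kern u r * k u) * (f r * k r))"
    proof -
      have "set_integrable lborel {-pi..pi} (\<lambda>r. kern1 s r * (f r * k r) + of_bool (r < s) * (f r * k r) - kern1 (-pi) r * (f r * k r))"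
        by (intro set_integral_diff(1) set_integral_add(1) kern_mult_integrable f ind_i s) simp
      then show ?thesis
        by (subst set_integrable_cong[OF refl refl kp])
    qed
    have "solution1 f s - solution1 f (- pi) = (LINT r:{-pi..pi}|lborel. kern1 s r * (f r * k r) - kern1 (-pi) r * (f r * k r))"
      unfolding solution1_def by (rule set_integral_diff(2)[symmetric]) (intro kern_mult_integrable f, use s in auto)+
    also have "\<dots> = (LINT r:{-pi..pi}|lborel. (LINT u:{-pi..s}|lborel. - lam * kern u r * k u) * (f r * k r)
         - of_bool (r < s) * (f r * k r))"
    proof (intro set_lebesgue_integral_cong allI impI)
      fix r :: real assume "r \<in> {-pi..pi}"
      note kp = kp[OF this]
      show "kern1 s r * (f r * k r) - kern1 (- pi) r * (f r * k r) =
        (LINT u:{-pi..s}|lborel. - lam * kern u r * k u) * (f r * k r) - of_bool (r < s) * (f r * k r)"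
        unfolding kp by simp
    qed simp
    also have "\<dots> = (LINT r:{-pi..pi}|lborel. (LINT u:{-pi..s}|lborel. - lam * kern u r * k u) * (f r * k r))
        - (LINT r:{-pi..s}|lborel. f r * k r)"
      using set_integral_diff(2)[OF sw_i ind_i] by (simp only: ind)
    also have "(LINT r:{-pi..pi}|lborel. (LINT u:{-pi..s}|lborel. - lam * kern u r * k u) * (f r * k r))
       = (LINT u:{-pi..s}|lborel. - lam * (solution f u * k u))"
      by (simp only: lk mult.assoc set_integral_mult_right kern_swap(2)[OF f s])
    also have "\<dots> - (LINT r:{-pi..s}|lborel. f r * k r) = (LINT u:{-pi..s}|lborel. - lam * (solution f u * k u) - f u * k u)"
      by (rule set_integral_diff(2)[symmetric]) (intro i2 i s)+
    finally show ?thesis unfolding eq .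
  qed
  \<comment> \<open>At \<open>r = pi\<close> the diagonal convention of \<open>kern1\<close> breaks
    the identity; the end points form a null set.\<close>
  have "kern1 pi r = kern1 (-pi) r" if "r \<in> {-pi<..<pi}" for r
  proof -
    have "t pi - t r = T - t r" "t r - t (-pi) = t r" by (auto simp: T_def)
    then show ?thesis using that by (simp add: kern1_def G_reflect)
  qed
  then show "solution1 f pi = solution1 f (-pi)"
    unfolding solution1_def set_lebesgue_integral_def
  proof (intro integral_cong_AE)
    have "AE r in lborel. r \<noteq> pi" "AE r in lborel. r \<noteq> - pi" by (simp_all add: AE_lborel_singleton)
    then show "AE r in lborel. indicator {-pi..pi} r *\<^sub>R (kern1 pi r * (f r * k r)) = indicator {-pi..pi} r *\<^sub>R (kern1 (-pi) r * (f r * k r))"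
      by eventually_elim (use \<open>\<And>r. r \<in> {-pi<..<pi} \<Longrightarrow> kern1 pi r = kern1 (-pi) r\<close> in \<open>auto simp: indicator_def\<close>)
  qed (use kern_mult_integrable(2)[OF f] in \<open>auto simp: set_integrable_def\<close>)
qed

text \<open>Two combinations of the unknown pair with the explicit solution centred at half a period
  are constant. Comparing the ends, where \<open>p\<close> agrees and \<open>q\<close> changes sign,
  forces zero initial data because \<open>S (T / 2)\<close> is nonzero.\<close>

lemma eigen_unique:
  assumes y: "circ_prim k y m" and m: "circ_prim k m (\<lambda>s. - lam * y s)"
  shows "AE s in lborel. s \<in> {-pi..pi} \<longrightarrow> y s = 0"
proof -
  obtain c where c: "AE s in lborel. s \<in> {-pi..pi} \<longrightarrow> y s = c + (LINT u:{-pi..s}|lborel. m u * k u)"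
    using y by (auto simp: circ_prim_def)
  obtain e where e: "AE s in lborel. s \<in> {-pi..pi} \<longrightarrow> m s = e + (LINT u:{-pi..s}|lborel. - lam * y u * k u)"
    using m by (auto simp: circ_prim_def)
  \<comment> \<open>\<open>y\<close> and \<open>m\<close> are given only almost everywhere;
    \<open>Y\<close> and \<open>N\<close> are their continuous representatives and satisfy the
    differential equations classically inside the interval.\<close>
  define Y where "Y s = c + (LINT u:{-pi..s}|lborel. m u * k u)" for s
  define N where "N s = e + (LINT u:{-pi..s}|lborel. - lam * y u * k u)" for s
  have mi: "set_integrable lborel {-pi..pi} (\<lambda>s. m s * k s)" and yi: "set_integrable lborel {-pi..pi} (\<lambda>s. - lam * y s * k s)"
    and m0: "(LINT s:{-pi..pi}|lborel. m s * k s) = 0" and y0: "(LINT s:{-pi..pi}|lborel. - lam * y s * k s) = 0"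
    using y m by (auto simp: circ_prim_def)
  have Yc: "continuous_on {-pi..pi} Y" and Nc: "continuous_on {-pi..pi} N"
    unfolding Y_def N_def by (intro continuous_intros primitive_continuous_on mi yi)+
  have kc: "continuous_on A k" for A by (rule continuous_on_subset[OF k_cont]) simp
  have AEy: "AE s in lborel. s \<in> {-pi..pi} \<longrightarrow> y s = Y s" using c by (simp add: Y_def)
  have AEm: "AE s in lborel. s \<in> {-pi..pi} \<longrightarrow> m s = N s" using e by (simp add: N_def)
  have Nki: "set_integrable lborel {-pi..pi} (\<lambda>s. N s * k s)" "set_integrable lborel {-pi..pi} (\<lambda>s. - lam * Y s * k s)"
    by (intro set_integrable_continuous_Icc continuous_intros Nc Yc kc)+
  have cong: "(LINT u:{-pi..s}|lborel. g u) = (LINT u:{-pi..s}|lborel. h u)"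
    if "set_integrable lborel {-pi..pi} g" "set_integrable lborel {-pi..pi} h"
      "AE s in lborel. s \<in> {-pi..pi} \<longrightarrow> g s = h s" "s \<in> {-pi..pi}" for g h :: "real \<Rightarrow> real" and s
    unfolding set_lebesgue_integral_def
  proof (rule integral_cong_AE)
    show "AE u in lborel. indicator {-pi..s} u *\<^sub>R g u = indicator {-pi..s} u *\<^sub>R h u"
      using that(3) by eventually_elim (use that(4) in \<open>auto simp: indicator_def\<close>)
    have "set_integrable lborel {-pi..s} g" "set_integrable lborel {-pi..s} h"
      using that(4) by (auto intro: set_integrable_subset[OF that(1)] set_integrable_subset[OF that(2)])
    then show "(\<lambda>x. indicator {-pi..s} x *\<^sub>R g x) \<in> borel_measurable lborel"
      "(\<lambda>x. indicator {-pi..s} x *\<^sub>R h x) \<in> borel_measurable lborel"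
      by (auto simp: set_integrable_def)
  qed
  have Yeq: "Y s = c + (LINT u:{-pi..s}|lborel. N u * k u)" if "s \<in> {-pi..pi}" for s
  proof -
    have "AE s in lborel. s \<in> {-pi..pi} \<longrightarrow> m s * k s = N s * k s"
      using AEm by eventually_elim auto
    from cong[OF mi Nki(1) this that] show ?thesis by (simp add: Y_def)
  qed
  have Neq: "N s = e + (LINT u:{-pi..s}|lborel. - lam * Y u * k u)" if "s \<in> {-pi..pi}" for s
  proof -
    have "AE s in lborel. s \<in> {-pi..pi} \<longrightarrow> - lam * y s * k s = - lam * Y s * k s"
      using AEy by eventually_elim auto
    from cong[OF yi Nki(2) this that] show ?thesis by (simp add: N_def)
  qed
  have ev: "eventually (\<lambda>s. s \<in> {-pi<..<pi}) (nhds s)" if "s \<in> {-pi<..<pi}" for s :: real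
    using that by (intro eventually_nhds_in_open) auto
  have Yd: "(Y has_real_derivative N s * k s) (at s)" if s: "s \<in> {-pi<..<pi}" for s
  proof -
    have "((\<lambda>s. c + (LINT u:{-pi..s}|lborel. N u * k u)) has_real_derivative N s * k s) (at s)"
    proof (rule DERIV_add[OF DERIV_const primitive_has_real_derivative, simplified add_0])
      show "continuous_on {-pi..pi} (\<lambda>u. N u * k u)" by (intro continuous_intros Nc kc)
    qed (rule s)
    moreover have "eventually (\<lambda>s. Y s = c + (LINT u:{-pi..s}|lborel. N u * k u)) (nhds s)"
      using ev[OF s] by eventually_elim (rule Yeq, auto)
    ultimately show ?thesis by (rule DERIV_eventually_eq)
  qed
  have Nd: "(N has_real_derivative - lam * Y s * k s) (at s)" if s: "s \<in> {-pi<..<pi}" for s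
  proof -
    have "((\<lambda>s. e + (LINT u:{-pi..s}|lborel. - lam * Y u * k u)) has_real_derivative - lam * Y s * k s) (at s)"
    proof (rule DERIV_add[OF DERIV_const primitive_has_real_derivative, simplified add_0])
      show "continuous_on {-pi..pi} (\<lambda>u. - lam * Y u * k u)" by (intro continuous_intros Yc kc)
    qed (rule s)
    moreover have "eventually (\<lambda>s. N s = e + (LINT u:{-pi..s}|lborel. - lam * Y u * k u)) (nhds s)"
      using ev[OF s] by eventually_elim (rule Neq, auto)
    ultimately show ?thesis by (rule DERIV_eventually_eq)
  qed
  define p where "p s = C (t s - T / 2)" for s
  define q where "q s = S (t s - T / 2)" for s
  have Cc: "continuous_on UNIV C" "continuous_on UNIV S"
    by (intro DERIV_continuous_on[OF C_deriv[THEN DERIV_subset]] DERIV_continuous_on[OF S_deriv[THEN DERIV_subset]]; simp)+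
  have pc: "continuous_on {-pi..pi} p" and qc: "continuous_on {-pi..pi} q"
    unfolding p_def q_def by (intro continuous_on_compose2[OF Cc(1)] continuous_on_compose2[OF Cc(2)] continuous_intros t_cont; simp)+
  have td: "((\<lambda>s. t s - T / 2) has_real_derivative k s) (at s)" if "s \<in> {-pi<..<pi}" for s
    using t_deriv[OF that] by (auto intro!: derivative_eq_intros)
  have pd: "(p has_real_derivative q s * k s) (at s)" if "s \<in> {-pi<..<pi}" for s
    unfolding p_def[abs_def] q_def by (rule DERIV_chain2[OF C_deriv td[OF that]])
  have qd: "(q has_real_derivative (- lam * p s) * k s) (at s)" if "s \<in> {-pi<..<pi}" for s
    unfolding q_def[abs_def] p_def by (rule DERIV_chain2[OF S_deriv td[OF that]])
  \<comment> \<open>\<open>W1\<close> is a Wronskian, \<open>W2\<close> the polarised form of the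
    oscillator energy.\<close>
  define W1 where "W1 s = Y s * q s - N s * p s" for s
  define W2 where "W2 s = lam * Y s * p s + N s * q s" for s
  have W1: "W1 s = W1 (-pi)" if "s \<in> {-pi..pi}" for s
  proof (rule DERIV_isconst2[where a = "-pi" and b = pi])
    show "continuous_on {-pi..pi} W1" unfolding W1_def by (intro continuous_intros Yc Nc pc qc)
    fix x :: real assume "-pi < x" "x < pi"
    then have x: "x \<in> {-pi<..<pi}" by simp
    show "(W1 has_real_derivative 0) (at x)" unfolding W1_def[abs_def]
      using Yd[OF x] Nd[OF x] pd[OF x] qd[OF x]
      by (auto intro!: derivative_eq_intros simp: algebra_simps)
  qed (use that in auto)
  have W2: "W2 s = W2 (-pi)" if "s \<in> {-pi..pi}" for s
  proof (rule DERIV_isconst2[where a = "-pi" and b = pi])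
    show "continuous_on {-pi..pi} W2" unfolding W2_def by (intro continuous_intros Yc Nc pc qc)
    fix x :: real assume "-pi < x" "x < pi"
    then have x: "x \<in> {-pi<..<pi}" by simp
    show "(W2 has_real_derivative 0) (at x)" unfolding W2_def[abs_def]
      using Yd[OF x] Nd[OF x] pd[OF x] qd[OF x]
      by (auto intro!: derivative_eq_intros simp: algebra_simps)
  qed (use that in auto)
  have per: "Y pi = Y (-pi)" "N pi = N (-pi)"
    using m0 y0 by (simp_all add: Y_def N_def set_integral_singleton_zero)
  have ends: "p pi = C (T/2)" "q pi = S (T/2)" "p (-pi) = C (T/2)" "q (-pi) = - S (T/2)"
    using C_even[of "T/2"] S_odd[of "T/2"] by (simp_all add: p_def q_def T_def[symmetric])
  have Y0: "Y (-pi) = 0" using W1[of pi] ST per ends by (simp add: W1_def)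
  have N0: "N (-pi) = 0" using W2[of pi] ST per ends Y0 by (simp add: W2_def)
  have "Y s = 0" if s: "s \<in> {-pi..pi}" for s
  proof -
    have a: "Y s * q s - N s * p s = 0" using W1[OF s] Y0 N0 by (simp add: W1_def)
    have b: "lam * Y s * p s + N s * q s = 0" using W2[OF s] Y0 N0 by (simp add: W2_def)
    \<comment> \<open>The linear system \<open>a\<close>, \<open>b\<close> is solved for
      \<open>Y s\<close>; its determinant is \<open>lam * (C 0)^2\<close>.\<close>
    have "Y s * ((q s)\<^sup>2 + lam * (p s)\<^sup>2) = (Y s * q s - N s * p s) * q s + (lam * Y s * p s + N s * q s) * p s"
      by (simp add: algebra_simps power2_eq_square)
    also have "\<dots> = 0" using a b by simp
    finally show ?thesis using energy_const[of "t s - T / 2"] lam0 C0 by (simp add: p_def q_def)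
  qed
  with AEy show ?thesis by (auto elim: eventually_mono)
qed

text \<open>Uniqueness applied to the difference from the Green solution. It turns the kernel bound
  into an a priori estimate for every element of the operator domain.\<close>

lemma representation:
  assumes y: "circ_prim k y m" and m: "circ_prim k m (\<lambda>s. - h s)"
    and f: "set_integrable lborel {-pi..pi} (\<lambda>s. (h s - lam * y s) * k s)"
  shows "AE s in lborel. s \<in> {-pi..pi} \<longrightarrow> y s = solution (\<lambda>s. h s - lam * y s) s"
proof -
  let ?f = "\<lambda>s. h s - lam * y s"
  have 1: "circ_prim k (\<lambda>s. y s - solution ?f s) (\<lambda>s. m s - solution1 ?f s)"
    by (rule circ_prim_diff[OF y solution_circ_prim[OF f]])
  have 2: "circ_prim k (\<lambda>s. m s - solution1 ?f s) (\<lambda>s. - lam * (y s - solution ?f s))"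
    using circ_prim_diff[OF m solution1_circ_prim[OF f]] by (simp add: algebra_simps)
  from eigen_unique[OF 1 2] show ?thesis by simp
qed

end

section \<open>Energy-angle coordinates of a potential well\<close>

lemma nn_integral_split_sign:
  fixes f :: "real \<Rightarrow> real"
  assumes [measurable]: "f \<in> borel_measurable borel" and f: "\<And>v. f v \<ge> 0"
  shows "(\<integral>\<^sup>+v. f v \<partial>lborel) = (\<integral>\<^sup>+v. f v * indicator {0<..} v \<partial>lborel) + (\<integral>\<^sup>+v. f (- v) * indicator {0<..} v \<partial>lborel)"
proof -
  have "(\<integral>\<^sup>+v. f v \<partial>lborel) = (\<integral>\<^sup>+v. ennreal (f v * indicator {0<..} v) + ennreal (f v * indicator {..<0} v) \<partial>lborel)"
  proof (intro nn_integral_cong_AE)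
    have "AE v in lborel. v \<noteq> (0::real)" by (simp add: AE_lborel_singleton)
    then show "AE v in lborel. ennreal (f v) = ennreal (f v * indicator {0<..} v) + ennreal (f v * indicator {..<0} v)"
      by eventually_elim (auto simp: indicator_def)
  qed
  also have "\<dots> = (\<integral>\<^sup>+v. f v * indicator {0<..} v \<partial>lborel) + (\<integral>\<^sup>+v. f v * indicator {..<0} v \<partial>lborel)"
    by (rule nn_integral_add) measurable
  also have "(\<integral>\<^sup>+v. f v * indicator {..<0} v \<partial>lborel) = (\<integral>\<^sup>+v. f (- v) * indicator {..<0} (- v) \<partial>lborel)"
    by (subst nn_integral_real_affine[where c="-1" and t=0]) simp_all
  also have "(\<lambda>v::real. indicator {..<0} (- v) :: real) = indicator {0<..}"
    by (simp add: fun_eq_iff indicator_def)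
  finally show ?thesis .
qed

lemma nn_integral_split_symmetric:
  fixes f :: "real \<Rightarrow> real"
  assumes f_meas [measurable]: "f \<in> borel_measurable borel" and f: "\<And>v. f v \<ge> 0"
  shows "(\<integral>\<^sup>+v. f v * indicator {-a..a} v \<partial>lborel) = (\<integral>\<^sup>+v. f v * indicator {0..a} v \<partial>lborel) + (\<integral>\<^sup>+v. f (- v) * indicator {0..a} v \<partial>lborel)"
proof -
  have "(\<integral>\<^sup>+v. f v * indicator {-a..a} v \<partial>lborel) = (\<integral>\<^sup>+v. ennreal (f v * indicator {0..a} v) + ennreal (f v * indicator {0..a} (- v)) \<partial>lborel)"
  proof (intro nn_integral_cong_AE)
    have "AE v in lborel. v \<noteq> (0::real)" by (simp add: AE_lborel_singleton)
    then show "AE v in lborel. ennreal (f v * indicator {-a..a} v) = ennreal (f v * indicator {0..a} v) + ennreal (f v * indicator {0..a} (- v))"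
      by eventually_elim (auto simp: indicator_def)
  qed
  also have "\<dots> = (\<integral>\<^sup>+v. f v * indicator {0..a} v \<partial>lborel) + (\<integral>\<^sup>+v. f v * indicator {0..a} (- v) \<partial>lborel)"
    by (rule nn_integral_add) measurable
  also have "(\<integral>\<^sup>+v. f v * indicator {0..a} (- v) \<partial>lborel) = (\<integral>\<^sup>+v. f (- v) * indicator {0..a} v \<partial>lborel)"
    by (subst nn_integral_real_affine[where c="-1" and t=0]) simp_all
  finally show ?thesis .
qed

text \<open>Surjectivity of \<open>q\<close> is the confinement: it makes the energy circle of every
  radius complete. Positivity and continuity of \<open>A\<close> keep \<open>kap\<close> free of
  singularities at the turning points.\<close>

locale well_coords =
  fixes q A :: "real \<Rightarrow> real"
  assumes q_deriv: "\<And>x. (q has_real_derivative A x) (at x)"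
    and A_cont: "continuous_on UNIV A" and A_pos: "\<And>x. A x > 0" and q_surj: "surj q"
begin

text \<open>A point \<open>((e, w), s)\<close> consists of energy, transversal velocity and angle. The half-angle formula
  for \<open>ang\<close> breaks down only on the null set \<open>s = \<plusminus>pi\<close>, where its denominator vanishes.\<close>
definition X :: "real \<Rightarrow> real" where "X = inv q"
definition kap :: "real \<Rightarrow> real \<Rightarrow> real" where "kap e s = 1 / A (X (- sqrt (2 * e) * cos s))"
definition Zc :: "(real \<times> (real \<times> real)) \<times> real \<Rightarrow> real \<times> real \<times> (real \<times> real)" where
  "Zc = (\<lambda>((e, w), s). (X (- sqrt (2 * e) * cos s), sqrt (2 * e) * sin s, w))"
definition en :: "real \<times> real \<times> (real \<times> real) \<Rightarrow> real" where
  "en z = (fst (snd z))\<^sup>2 / 2 + (q (fst z))\<^sup>2 / 2"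
definition ang :: "real \<times> real \<times> (real \<times> real) \<Rightarrow> real" where
  "ang z = 2 * arctan (fst (snd z) / (sqrt (2 * en z) - q (fst z)))"
definition J :: "(real \<times> (real \<times> real)) \<times> real \<Rightarrow> real" where
  "J = (\<lambda>((e, w), s). indicator {0<..} e * indicator {-pi..pi} s * kap e s)"

lemma q_strict: "x < y \<Longrightarrow> q x < q y"
  using DERIV_pos_imp_increasing[of x y q] q_deriv A_pos by blast

lemma q_less [simp]: "q x < q y \<longleftrightarrow> x < y"
  using q_strict by (metis not_less_iff_gr_or_eq)

lemma q_le [simp]: "q x \<le> q y \<longleftrightarrow> x \<le> y"
  using q_less by (simp add: linorder_not_less[symmetric])

lemma q_inj: "inj q"
  by (metis injI q_less less_irrefl linorder_cases)

lemma q_X [simp]: "q (X y) = y"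
  using q_surj by (simp add: X_def surj_f_inv_f)

lemma X_q [simp]: "X (q x) = x"
  using q_inj by (simp add: X_def)

lemma X_less [simp]: "X a < X b \<longleftrightarrow> a < b"
  using q_less[of "X a" "X b"] by simp

lemma X_le [simp]: "X a \<le> X b \<longleftrightarrow> a \<le> b"
  using q_le[of "X a" "X b"] by simp

lemma q_cont: "continuous_on S q"
  using q_deriv by (auto intro: DERIV_continuous_on DERIV_subset)

lemma X_isCont: "isCont X y"
proof -
  have "isCont X (q (X y))"
    by (rule isCont_inverse_function[where d=1]) (use q_cont[of UNIV] in \<open>auto simp: continuous_on_eq_continuous_at\<close>)
  then show ?thesis by simp
qed

lemma X_cont: "continuous_on S X"
  by (intro continuous_at_imp_continuous_on ballI X_isCont)

lemma X_deriv: "(X has_real_derivative 1 / A (X y)) (at y)"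
  using DERIV_inverse_function[of q "A (X y)" X y "y - 1" "y + 1"] q_deriv A_pos[of "X y"] X_isCont
  by (simp add: inverse_eq_divide)

lemma kap_pos: "kap e s > 0"
  by (simp add: kap_def A_pos)

text \<open>The bottom energy \<open>e = 0\<close> is included, and so are negative
  \<open>e\<close>, because \<open>sqrt\<close> is continuous on all reals. The continuity of the
  period at the bottom rests on this.\<close>

lemma kap_cont2: "continuous_on UNIV (\<lambda>(e, s). kap e s)"
proof -
  have "continuous_on UNIV (\<lambda>p::real\<times>real. 1 / A (X (- sqrt (2 * fst p) * cos (snd p))))"
    by (intro continuous_intros continuous_on_compose2[OF A_cont] continuous_on_compose2[OF X_cont[of UNIV]])
       (auto simp: A_pos less_imp_neq[OF A_pos, symmetric])
  then show ?thesis by (simp add: split_beta' kap_def)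
qed

lemma kap_cont: "continuous_on S (kap e)"
  using continuous_on_compose2[OF kap_cont2, of S "\<lambda>s. (e, s)"] by (simp add: continuous_on_Pair)

lemma kap_meas [measurable]: "(\<lambda>(e, s). kap e s) \<in> borel_measurable (borel \<Otimes>\<^sub>M borel)"
  using borel_measurable_continuous_onI[OF kap_cont2] by (simp add: borel_prod)

lemma kap_meas' [measurable (raw)]:
  "f \<in> borel_measurable M \<Longrightarrow> g \<in> borel_measurable M \<Longrightarrow> (\<lambda>x. kap (f x) (g x)) \<in> borel_measurable M"
  using measurable_compose[OF _ kap_meas, of "\<lambda>x. (f x, g x)" M] by simp

lemma q_meas [measurable]: "q \<in> borel_measurable borel"
  by (rule borel_measurable_continuous_onI[OF q_cont])

lemma X_meas [measurable]: "X \<in> borel_measurable borel"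
  by (rule borel_measurable_continuous_onI[OF X_cont])

text \<open>The energy replaces the velocity at a fixed position, with \<open>a\<close> for the
  value of \<open>q\<close> there. The cutoff \<open>V\<close> is present because the substitution
  is carried out on a compact interval.\<close>

lemma nn_integral_velocity_substitution:
  assumes F: "F \<in> borel_measurable borel" "\<And>v. F v \<ge> (0::real)" "\<And>v. v > V \<Longrightarrow> F v = 0" and V: "V \<ge> 0"
  shows "(\<integral>\<^sup>+v. F v * indicator {0<..} v \<partial>lborel) =
    (\<integral>\<^sup>+e. F (sqrt (2 * e - a\<^sup>2)) / sqrt (2 * e - a\<^sup>2) * indicator {a\<^sup>2 / 2..} e \<partial>lborel)"
proof -
  note [measurable] = F(1)
  let ?f = "\<lambda>e. F (sqrt (2 * e - a\<^sup>2)) / sqrt (2 * e - a\<^sup>2)"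
  let ?g = "\<lambda>v. v\<^sup>2 / 2 + a\<^sup>2 / 2"
  have "(\<integral>\<^sup>+e. ?f e * indicator {?g 0..?g V} e \<partial>lborel) = (\<integral>\<^sup>+v. ?f (?g v) * v * indicator {0..V} v \<partial>lborel)"
    by (rule nn_integral_substitution)
      (auto intro!: derivative_eq_intros continuous_intros simp: V set_borel_measurable_def)
  moreover have "(\<integral>\<^sup>+e. ?f e * indicator {?g 0..?g V} e \<partial>lborel) = (\<integral>\<^sup>+e. ?f e * indicator {a\<^sup>2 / 2..} e \<partial>lborel)"
  proof (intro nn_integral_cong)
    fix e :: real
    have "F (sqrt (2 * e - a\<^sup>2)) = 0" if "e > V\<^sup>2 / 2 + a\<^sup>2 / 2"
      using that V by (intro F(3) real_less_rsqrt) auto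
    then show "ennreal (?f e * indicator {?g 0..?g V} e) = ennreal (?f e * indicator {a\<^sup>2 / 2..} e)"
      by (auto simp: indicator_def not_le)
  qed
  moreover have "(\<integral>\<^sup>+v. ?f (?g v) * v * indicator {0..V} v \<partial>lborel) = (\<integral>\<^sup>+v. F v * indicator {0<..} v \<partial>lborel)"
  proof (intro nn_integral_cong_AE)
    have "AE v in lborel. v \<noteq> (0::real)" by (simp add: AE_lborel_singleton)
    then show "AE v in lborel. ennreal (?f (?g v) * v * indicator {0..V} v) = ennreal (F v * indicator {0<..} v)"
      by eventually_elim (auto simp: indicator_def F(3) field_simps not_le)
  qed
  ultimately show ?thesis by simp
qed

text \<open>At fixed energy the angle parametrises the position, and the inverse square root,
  singular at the turning points, cancels against \<open>sqrt (2 * e) * sin s\<close>. With constant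
  \<open>F\<close> the same formula evaluates the period integral.\<close>

lemma nn_integral_position_substitution:
  assumes F: "F \<in> borel_measurable (borel \<Otimes>\<^sub>M borel)" "\<And>p. F p \<ge> (0::real)" and e: "e > 0"
  shows "(\<integral>\<^sup>+x. F (x, sqrt (2 * e - (q x)\<^sup>2)) / sqrt (2 * e - (q x)\<^sup>2) * indicator {(q x)\<^sup>2 / 2..} e \<partial>lborel)
    = (\<integral>\<^sup>+s. F (X (- sqrt (2 * e) * cos s), sqrt (2 * e) * sin s) * kap e s * indicator {0..pi} s \<partial>lborel)"
proof -
  note [measurable] = F(1)
  define r where "r = sqrt (2 * e)"
  have r: "r > 0" "r\<^sup>2 = 2 * e" using e by (auto simp: r_def)
  let ?f = "\<lambda>x. F (x, sqrt (2 * e - (q x)\<^sup>2)) / sqrt (2 * e - (q x)\<^sup>2)"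
  let ?g = "\<lambda>s. X (- r * cos s)"
  have "(\<integral>\<^sup>+x. ?f x * indicator {?g 0..?g pi} x \<partial>lborel) = (\<integral>\<^sup>+s. ?f (?g s) * (kap e s * (r * sin s)) * indicator {0..pi} s \<partial>lborel)"
  proof (rule nn_integral_substitution)
    show "(?g has_real_derivative kap e s * (r * sin s)) (at s)" for s
      unfolding kap_def r_def[symmetric]
      by (rule DERIV_chain2[OF X_deriv]) (auto intro!: derivative_eq_intros)
    show "continuous_on {0..pi} (\<lambda>s. kap e s * (r * sin s))"
      by (intro continuous_intros kap_cont)
  qed (use r kap_pos[THEN less_imp_le] in \<open>auto simp: set_borel_measurable_def sin_ge_zero\<close>)
  moreover have "(\<integral>\<^sup>+x. ?f x * indicator {?g 0..?g pi} x \<partial>lborel) = (\<integral>\<^sup>+x. ?f x * indicator {(q x)\<^sup>2 / 2..} e \<partial>lborel)"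
  proof (intro nn_integral_cong)
    fix x :: real
    have "x \<in> {?g 0..?g pi} \<longleftrightarrow> - r \<le> q x \<and> q x \<le> r"
      using X_le[of "-r" "q x"] X_le[of "q x" r] by (simp del: X_le)
    also have "\<dots> \<longleftrightarrow> (q x)\<^sup>2 \<le> r\<^sup>2" using r(1) abs_le_square_iff[of "q x" r] by auto
    finally have "x \<in> {?g 0..?g pi} \<longleftrightarrow> e \<in> {(q x)\<^sup>2 / 2..}" using r(2) by auto
    then show "ennreal (?f x * indicator {?g 0..?g pi} x) = ennreal (?f x * indicator {(q x)\<^sup>2 / 2..} e)"
      by (simp add: indicator_def)
  qed
  moreover have "(\<integral>\<^sup>+s. ?f (?g s) * (kap e s * (r * sin s)) * indicator {0..pi} s \<partial>lborel)
     = (\<integral>\<^sup>+s. F (X (- r * cos s), r * sin s) * kap e s * indicator {0..pi} s \<partial>lborel)"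
  proof (intro nn_integral_cong_AE)
    have "AE s in lborel. s \<noteq> (0::real)" "AE s in lborel. s \<noteq> pi" by (simp_all add: AE_lborel_singleton)
    then show "AE s in lborel. ennreal (?f (?g s) * (kap e s * (r * sin s)) * indicator {0..pi} s)
        = ennreal (F (X (- r * cos s), r * sin s) * kap e s * indicator {0..pi} s)"
    proof eventually_elim
      case (elim s)
      show ?case
      proof (cases "s \<in> {0..pi}")
        case True
        then have s: "sin s > 0" using elim by (intro sin_gt_zero) auto
        have "2 * e - (r * cos s)\<^sup>2 = (r * sin s)\<^sup>2"
          unfolding power_mult_distrib r(2) sin_squared_eq by (simp add: algebra_simps)
        then have "sqrt (2 * e - (- r * cos s)\<^sup>2) = r * sin s" using s r by simp
        then show ?thesis using s r by (simp add: field_simps)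
      qed simp
    qed
  qed
  ultimately show ?thesis by (simp add: r_def)
qed

lemma nn_integral_upper_half:
  assumes F: "F \<in> borel_measurable (borel \<Otimes>\<^sub>M borel)" "\<And>p. F p \<ge> (0::real)"
    and V: "\<And>x v. v > V \<Longrightarrow> F (x, v) = 0" "V \<ge> 0"
  shows "(\<integral>\<^sup>+x. \<integral>\<^sup>+v. F (x, v) * indicator {0<..} v \<partial>lborel \<partial>lborel) =
    (\<integral>\<^sup>+e. (\<integral>\<^sup>+s. F (X (- sqrt (2 * e) * cos s), sqrt (2 * e) * sin s) * kap e s * indicator {0..pi} s \<partial>lborel)
       * indicator {0<..} e \<partial>lborel)"
proof -
  note [measurable] = F(1)
  let ?h = "\<lambda>x e. F (x, sqrt (2 * e - (q x)\<^sup>2)) / sqrt (2 * e - (q x)\<^sup>2) * indicator {(q x)\<^sup>2 / 2..} e"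
  have "(\<integral>\<^sup>+x. \<integral>\<^sup>+v. F (x, v) * indicator {0<..} v \<partial>lborel \<partial>lborel) = (\<integral>\<^sup>+x. \<integral>\<^sup>+e. ?h x e \<partial>lborel \<partial>lborel)"
    by (intro nn_integral_cong nn_integral_velocity_substitution[where V=V]) (use V F(2) in auto)
  also have "\<dots> = (\<integral>\<^sup>+e. \<integral>\<^sup>+x. ?h x e \<partial>lborel \<partial>lborel)"
  proof (rule lborel_pair.Fubini'[symmetric])
    have "(\<lambda>(x, e). ennreal (?h x e)) = (\<lambda>(x, e). ennreal (F (x, sqrt (2 * e - (q x)\<^sup>2)) / sqrt (2 * e - (q x)\<^sup>2) * (if (q x)\<^sup>2 / 2 \<le> e then 1 else 0)))"
      by (auto simp: indicator_def)
    moreover have "\<dots> \<in> borel_measurable (lborel \<Otimes>\<^sub>M lborel)" by measurable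
    ultimately show "(\<lambda>(x, e). ennreal (?h x e)) \<in> borel_measurable (lborel \<Otimes>\<^sub>M lborel)" by simp
  qed
  also have "\<dots> = (\<integral>\<^sup>+e. (\<integral>\<^sup>+s. F (X (- sqrt (2 * e) * cos s), sqrt (2 * e) * sin s) * kap e s * indicator {0..pi} s \<partial>lborel)
       * indicator {0<..} e \<partial>lborel)"
  proof (intro nn_integral_cong_AE)
    have "AE e in lborel. e \<noteq> (0::real)" by (simp add: AE_lborel_singleton)
    then show "AE e in lborel. (\<integral>\<^sup>+x. ?h x e \<partial>lborel) =
        (\<integral>\<^sup>+s. F (X (- sqrt (2 * e) * cos s), sqrt (2 * e) * sin s) * kap e s * indicator {0..pi} s \<partial>lborel) * indicator {0<..} e"
    proof eventually_elim
      case (elim e)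
      show ?case
      proof (cases "e > 0")
        case True
        then show ?thesis using nn_integral_position_substitution[OF F True] by simp
      next
        case False
        have "\<not> (q x)\<^sup>2 / 2 \<le> e" for x
          using False elim zero_le_power2[of "q x"] by linarith
        then show ?thesis using False by simp
      qed
    qed
  qed
  finally show ?thesis .
qed

lemma nn_integral_coords_bounded:
  assumes F: "F \<in> borel_measurable (borel \<Otimes>\<^sub>M borel)" "\<And>p. F p \<ge> (0::real)"
    and V: "\<And>x v. \<bar>v\<bar> > V \<Longrightarrow> F (x, v) = 0" "V \<ge> 0"
  shows "(\<integral>\<^sup>+x. \<integral>\<^sup>+v. F (x, v) \<partial>lborel \<partial>lborel) =
    (\<integral>\<^sup>+e. (\<integral>\<^sup>+s. F (X (- sqrt (2 * e) * cos s), sqrt (2 * e) * sin s) * kap e s * indicator {-pi..pi} s \<partial>lborel)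
       * indicator {0<..} e \<partial>lborel)"
proof -
  note [measurable] = F(1)
  define F' where "F' = (\<lambda>(x, v). F (x, - v))"
  have F': "F' \<in> borel_measurable (borel \<Otimes>\<^sub>M borel)" "\<And>p. F' p \<ge> 0" "\<And>x v. v > V \<Longrightarrow> F' (x, v) = 0"
    using F V by (auto simp: F'_def)
  note [measurable] = F'(1)
  define K where "K e s = F (X (- sqrt (2 * e) * cos s), sqrt (2 * e) * sin s) * kap e s" for e s
  have K_meas[measurable]: "(\<lambda>(e, s). K e s) \<in> borel_measurable (borel \<Otimes>\<^sub>M borel)"
    unfolding K_def by measurable
  have K_meas'[measurable]: "K e \<in> borel_measurable borel" for e
    unfolding K_def by measurable
  have K: "K e s \<ge> 0" for e s using F(2) kap_pos[of e s] by (simp add: K_def)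
  \<comment> \<open>Reversing the velocity amounts to reversing the angle, since \<open>kap\<close>
    is even in it; so the lower half plane reduces to the upper one.\<close>
  have refl: "F' (X (- sqrt (2 * e) * cos s), sqrt (2 * e) * sin s) * kap e s = K e (- s)" for e s
    by (simp add: F'_def K_def kap_def)
  have "(\<integral>\<^sup>+x. \<integral>\<^sup>+v. F (x, v) \<partial>lborel \<partial>lborel) =
     (\<integral>\<^sup>+x. (\<integral>\<^sup>+v. F (x, v) * indicator {0<..} v \<partial>lborel) + (\<integral>\<^sup>+v. F' (x, v) * indicator {0<..} v \<partial>lborel) \<partial>lborel)"
    unfolding F'_def prod.case by (intro nn_integral_cong nn_integral_split_sign) (use F(2) in auto)
  also have "\<dots> = (\<integral>\<^sup>+x. \<integral>\<^sup>+v. F (x, v) * indicator {0<..} v \<partial>lborel \<partial>lborel) + (\<integral>\<^sup>+x. \<integral>\<^sup>+v. F' (x, v) * indicator {0<..} v \<partial>lborel \<partial>lborel)"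
    by (rule nn_integral_add) measurable
  also have "(\<integral>\<^sup>+x. \<integral>\<^sup>+v. F (x, v) * indicator {0<..} v \<partial>lborel \<partial>lborel)
     = (\<integral>\<^sup>+e. (\<integral>\<^sup>+s. K e s * indicator {0..pi} s \<partial>lborel) * indicator {0<..} e \<partial>lborel)"
    unfolding K_def by (rule nn_integral_upper_half[OF F, of V]) (use V in auto)
  also have "(\<integral>\<^sup>+x. \<integral>\<^sup>+v. F' (x, v) * indicator {0<..} v \<partial>lborel \<partial>lborel)
     = (\<integral>\<^sup>+e. (\<integral>\<^sup>+s. K e (- s) * indicator {0..pi} s \<partial>lborel) * indicator {0<..} e \<partial>lborel)"
    unfolding refl[symmetric] by (rule nn_integral_upper_half[OF F'(1,2), of V]) (use F' V in auto)
  also have "(\<integral>\<^sup>+e. (\<integral>\<^sup>+s. K e s * indicator {0..pi} s \<partial>lborel) * indicator {0<..} e \<partial>lborel)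
    + (\<integral>\<^sup>+e. (\<integral>\<^sup>+s. K e (- s) * indicator {0..pi} s \<partial>lborel) * indicator {0<..} e \<partial>lborel)
    = (\<integral>\<^sup>+e. (\<integral>\<^sup>+s. K e s * indicator {0..pi} s \<partial>lborel) * indicator {0<..} e
      + (\<integral>\<^sup>+s. K e (- s) * indicator {0..pi} s \<partial>lborel) * indicator {0<..} e \<partial>lborel)"
    by (rule nn_integral_add[symmetric]) measurable
  also have "\<dots> = (\<integral>\<^sup>+e. (\<integral>\<^sup>+s. K e s * indicator {-pi..pi} s \<partial>lborel) * indicator {0<..} e \<partial>lborel)"
  proof (rule nn_integral_cong)
    fix e :: real
    show "(\<integral>\<^sup>+s. K e s * indicator {0..pi} s \<partial>lborel) * indicator {0<..} e
      + (\<integral>\<^sup>+s. K e (- s) * indicator {0..pi} s \<partial>lborel) * indicator {0<..} e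
      = (\<integral>\<^sup>+s. K e s * indicator {-pi..pi} s \<partial>lborel) * indicator {0<..} e"
      unfolding nn_integral_split_symmetric[OF K_meas' K] by (simp only: distrib_right)
  qed
  finally show ?thesis unfolding K_def .
qed

definition Z2 :: "real \<times> real \<Rightarrow> real \<times> real" where
  "Z2 = (\<lambda>(e, s). (X (- sqrt (2 * e) * cos s), sqrt (2 * e) * sin s))"
definition J2 :: "real \<times> real \<Rightarrow> real" where
  "J2 = (\<lambda>(e, s). indicator {0<..} e * indicator {-pi..pi} s * kap e s)"

lemma Z2_meas [measurable]: "Z2 \<in> borel \<Otimes>\<^sub>M borel \<rightarrow>\<^sub>M borel \<Otimes>\<^sub>M borel"
  unfolding Z2_def by measurable

lemma J2_meas [measurable]: "J2 \<in> borel_measurable (borel \<Otimes>\<^sub>M borel)"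
  unfolding J2_def by measurable

text \<open>An equality of measures, so that integrability and signed integrals are transformed
  along with nonnegative ones. Truncating to \<open>|v| <= n\<close> supplies the cutoff of the
  preceding formula.\<close>

lemma lborel2_coords:
  "lborel = distr (density (lborel \<Otimes>\<^sub>M lborel) (\<lambda>p. ennreal (J2 p))) (lborel \<Otimes>\<^sub>M lborel) Z2" (is "_ = ?M")
proof (rule measure_eqI)
  show "sets lborel = sets ?M" by (simp add: lborel_prod)
  fix B :: "(real \<times> real) set" assume B: "B \<in> sets lborel"
  have B': "B \<in> sets (borel \<Otimes>\<^sub>M borel)" using B by (simp only: borel_prod sets_lborel)
  define Bn where "Bn n = B \<inter> {p. \<bar>snd p\<bar> \<le> real n}" for n
  have Bn: "Bn n \<in> sets (borel \<Otimes>\<^sub>M borel)" for n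
  proof -
    have "{p \<in> space (borel \<Otimes>\<^sub>M borel). \<bar>snd p\<bar> \<le> real n} \<in> sets (borel \<Otimes>\<^sub>M (borel :: real measure) :: (real \<times> real) measure)"
      by measurable
    then show ?thesis using B' by (auto simp: Bn_def space_pair_measure)
  qed
  have inc: "incseq Bn" by (force simp: incseq_def Bn_def)
  have un: "(\<Union>n. Bn n) = B" by (auto simp: Bn_def intro: real_arch_simple)
  have eq: "emeasure lborel (Bn n) = emeasure ?M (Bn n)" for n
  proof -
    have [measurable]: "Bn n \<in> sets (borel \<Otimes>\<^sub>M borel)" by (rule Bn)
    have "emeasure lborel (Bn n) = (\<integral>\<^sup>+p. indicator (Bn n) p \<partial>(lborel \<Otimes>\<^sub>M lborel))"
      using Bn[of n, unfolded borel_prod] by (subst lborel_prod) simp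
    also have "\<dots> = (\<integral>\<^sup>+x. \<integral>\<^sup>+v. ennreal (indicator (Bn n) (x, v)) \<partial>lborel \<partial>lborel)"
    proof -
      have [measurable]: "Bn n \<in> sets (borel \<Otimes>\<^sub>M borel)" by (rule Bn)
      show ?thesis unfolding ennreal_indicator by (rule lborel.nn_integral_fst[symmetric]) measurable
    qed
    also have "\<dots> = (\<integral>\<^sup>+e. (\<integral>\<^sup>+s. ennreal (indicator (Bn n) (X (- sqrt (2 * e) * cos s), sqrt (2 * e) * sin s) *
        kap e s * indicator {-pi..pi} s) \<partial>lborel) * indicator {0<..} e \<partial>lborel)"
    proof (rule nn_integral_coords_bounded[where V="real n"])
      show "indicator (Bn n) \<in> borel_measurable (borel \<Otimes>\<^sub>M borel)" using Bn[of n] by simp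
    qed (auto simp: Bn_def)
    also have "\<dots> = (\<integral>\<^sup>+e. \<integral>\<^sup>+s. ennreal (J2 (e, s)) * indicator (Bn n) (Z2 (e, s)) \<partial>lborel \<partial>lborel)"
    proof (rule nn_integral_cong)
      fix e :: real
      show "(\<integral>\<^sup>+s. ennreal (indicator (Bn n) (X (- sqrt (2 * e) * cos s), sqrt (2 * e) * sin s) *
          kap e s * indicator {-pi..pi} s) \<partial>lborel) * indicator {0<..} e
        = (\<integral>\<^sup>+s. ennreal (J2 (e, s)) * indicator (Bn n) (Z2 (e, s)) \<partial>lborel)"
        by (cases "e > 0") (auto simp: J2_def Z2_def indicator_def intro!: nn_integral_cong)
    qed
    also have "\<dots> = (\<integral>\<^sup>+p. ennreal (J2 p) * indicator (Bn n) (Z2 p) \<partial>(lborel \<Otimes>\<^sub>M lborel))"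
      by (rule lborel.nn_integral_fst) measurable
    also have "\<dots> = (\<integral>\<^sup>+p. indicator (Bn n) (Z2 p) \<partial>density (lborel \<Otimes>\<^sub>M lborel) (\<lambda>p. ennreal (J2 p)))"
      by (rule nn_integral_density[symmetric]) measurable
    also have "\<dots> = (\<integral>\<^sup>+p. indicator (Bn n) p \<partial>?M)"
      by (rule nn_integral_distr[symmetric]) measurable
    also have "\<dots> = emeasure ?M (Bn n)" using Bn by simp
    finally show ?thesis .
  qed
  have "emeasure lborel B = (SUP n. emeasure lborel (Bn n))"
    using SUP_emeasure_incseq[of Bn lborel] Bn[unfolded borel_prod] inc un by (simp add: image_subset_iff)
  also have "\<dots> = (SUP n. emeasure ?M (Bn n))" by (simp add: eq)
  also have "\<dots> = emeasure ?M B"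
    using SUP_emeasure_incseq[of Bn ?M] Bn inc un by (simp add: image_subset_iff)
  finally show "emeasure lborel B = emeasure ?M B" .
qed

lemma nn_integral_coords2:
  assumes F: "F \<in> borel_measurable (borel \<Otimes>\<^sub>M borel)"
  shows "(\<integral>\<^sup>+x. \<integral>\<^sup>+v. F (x, v) \<partial>lborel \<partial>lborel) = (\<integral>\<^sup>+e. \<integral>\<^sup>+s. ennreal (J2 (e, s)) * F (Z2 (e, s)) \<partial>lborel \<partial>lborel)"
proof -
  note [measurable] = F
  have "(\<integral>\<^sup>+x. \<integral>\<^sup>+v. F (x, v) \<partial>lborel \<partial>lborel) = (\<integral>\<^sup>+p. F p \<partial>lborel)"
  proof -
    have "(\<integral>\<^sup>+x. \<integral>\<^sup>+v. F (x, v) \<partial>lborel \<partial>lborel) = (\<integral>\<^sup>+p. F p \<partial>(lborel \<Otimes>\<^sub>M lborel))"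
      by (rule lborel.nn_integral_fst) measurable
    then show ?thesis by (simp only: lborel_prod)
  qed
  also have "\<dots> = (\<integral>\<^sup>+p. F (Z2 p) \<partial>density (lborel \<Otimes>\<^sub>M lborel) (\<lambda>p. ennreal (J2 p)))"
    by (subst lborel2_coords, subst nn_integral_distr) (use F in auto)
  also have "\<dots> = (\<integral>\<^sup>+p. ennreal (J2 p) * F (Z2 p) \<partial>(lborel \<Otimes>\<^sub>M lborel))"
    by (rule nn_integral_density) measurable
  also have "\<dots> = (\<integral>\<^sup>+e. \<integral>\<^sup>+s. ennreal (J2 (e, s)) * F (Z2 (e, s)) \<partial>lborel \<partial>lborel)"
    by (rule lborel.nn_integral_fst[symmetric]) measurable
  finally show ?thesis .
qed

lemma Zc_meas [measurable]: "Zc \<in> borel \<Otimes>\<^sub>M borel \<rightarrow>\<^sub>M borel"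
proof -
  have "Zc \<in> (borel \<Otimes>\<^sub>M borel) \<Otimes>\<^sub>M borel \<rightarrow>\<^sub>M borel \<Otimes>\<^sub>M (borel \<Otimes>\<^sub>M borel)"
    unfolding Zc_def case_prod_beta by measurable
  then show ?thesis by (simp only: borel_prod)
qed

lemma J_meas [measurable]: "J \<in> borel_measurable (borel \<Otimes>\<^sub>M borel)"
proof -
  have "J \<in> borel_measurable ((borel \<Otimes>\<^sub>M borel) \<Otimes>\<^sub>M borel)"
    unfolding J_def case_prod_beta by measurable
  then show ?thesis by (simp only: borel_prod)
qed

lemma nn_integral_coords:
  fixes F :: "real \<times> real \<times> (real \<times> real) \<Rightarrow> ennreal"
  assumes F: "F \<in> borel_measurable borel"
  shows "(\<integral>\<^sup>+z. F z \<partial>lborel) = (\<integral>\<^sup>+\<rho>. \<integral>\<^sup>+s. ennreal (J (\<rho>, s)) * F (Zc (\<rho>, s)) \<partial>lborel \<partial>lborel)"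
proof -
  have F3[measurable]: "F \<in> borel_measurable (borel \<Otimes>\<^sub>M (borel \<Otimes>\<^sub>M borel))" using F by (simp only: borel_prod)
  have F3'[measurable]: "F \<in> borel_measurable (lborel \<Otimes>\<^sub>M (lborel \<Otimes>\<^sub>M lborel))" using F unfolding lborel_prod by simp
  have "(\<integral>\<^sup>+z. F z \<partial>lborel) = (\<integral>\<^sup>+z. F z \<partial>(lborel \<Otimes>\<^sub>M (lborel \<Otimes>\<^sub>M lborel)))" by (simp add: lborel_prod)
  also have "\<dots> = (\<integral>\<^sup>+x. \<integral>\<^sup>+p. F (x, p) \<partial>(lborel \<Otimes>\<^sub>M lborel) \<partial>lborel)"
  proof -
    have "sigma_finite_measure (lborel \<Otimes>\<^sub>M lborel :: (real \<times> (real \<times> real)) measure)"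
      unfolding lborel_prod by (rule lborel.sigma_finite_measure_axioms)
    from sigma_finite_measure.nn_integral_fst[OF this F3'] show ?thesis by simp
  qed
  also have "\<dots> = (\<integral>\<^sup>+x. \<integral>\<^sup>+v. \<integral>\<^sup>+w. F (x, v, w) \<partial>lborel \<partial>lborel \<partial>lborel)"
    by (intro nn_integral_cong lborel.nn_integral_fst[symmetric]) measurable
  also have "\<dots> = (\<integral>\<^sup>+e. \<integral>\<^sup>+s. ennreal (J2 (e, s)) * (\<integral>\<^sup>+w. F (fst (Z2 (e, s)), snd (Z2 (e, s)), w) \<partial>lborel) \<partial>lborel \<partial>lborel)"
    using nn_integral_coords2[of "\<lambda>p. \<integral>\<^sup>+w. F (fst p, snd p, w) \<partial>lborel"] by simp
  also have "\<dots> = (\<integral>\<^sup>+e. \<integral>\<^sup>+s. \<integral>\<^sup>+w. ennreal (J ((e, w), s)) * F (Zc ((e, w), s)) \<partial>lborel \<partial>lborel \<partial>lborel)"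
    by (intro nn_integral_cong, subst nn_integral_cmult[symmetric]) (auto simp: J_def J2_def Zc_def Z2_def)
  also have "\<dots> = (\<integral>\<^sup>+e. \<integral>\<^sup>+w. \<integral>\<^sup>+s. ennreal (J ((e, w), s)) * F (Zc ((e, w), s)) \<partial>lborel \<partial>lborel \<partial>lborel)"
    by (intro nn_integral_cong lborel_pair.Fubini'[symmetric]) (simp add: J_def Zc_def, measurable)
  also have "\<dots> = (\<integral>\<^sup>+\<rho>. \<integral>\<^sup>+s. ennreal (J (\<rho>, s)) * F (Zc (\<rho>, s)) \<partial>lborel \<partial>lborel)"
    by (subst lborel_prod[symmetric], rule lborel.nn_integral_fst) (simp add: J_def Zc_def split_beta', measurable)
  finally show ?thesis .
qed

lemma lborel_coords:
  "lborel = distr (density (lborel \<Otimes>\<^sub>M lborel) (\<lambda>p. ennreal (J p))) borel Zc" (is "_ = ?M")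
proof (rule measure_eqI)
  show "sets lborel = sets ?M" by simp
  fix B :: "(real \<times> real \<times> (real \<times> real)) set" assume "B \<in> sets lborel"
  then have B[measurable]: "B \<in> sets borel" by simp
  have "emeasure lborel B = (\<integral>\<^sup>+z. indicator B z \<partial>lborel)" by simp
  also have "\<dots> = (\<integral>\<^sup>+\<rho>. \<integral>\<^sup>+s. ennreal (J (\<rho>, s)) * indicator B (Zc (\<rho>, s)) \<partial>lborel \<partial>lborel)"
    by (rule nn_integral_coords) simp
  also have "\<dots> = (\<integral>\<^sup>+p. ennreal (J p) * indicator B (Zc p) \<partial>(lborel \<Otimes>\<^sub>M lborel))"
    by (rule lborel.nn_integral_fst) measurable
  also have "\<dots> = (\<integral>\<^sup>+p. indicator B (Zc p) \<partial>density (lborel \<Otimes>\<^sub>M lborel) (\<lambda>p. ennreal (J p)))"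
    by (rule nn_integral_density[symmetric]) measurable
  also have "\<dots> = emeasure ?M B"
    by (subst nn_integral_distr[symmetric, of _ _ borel]) auto
  finally show "emeasure lborel B = emeasure ?M B" .
qed

lemma J_nonneg: "J p \<ge> 0"
  using kap_pos[THEN less_imp_le] by (auto simp: J_def split_beta')

lemma integrable_coords_iff:
  fixes F :: "real \<times> real \<times> (real \<times> real) \<Rightarrow> real"
  assumes [measurable]: "F \<in> borel_measurable borel"
  shows "integrable lborel F \<longleftrightarrow> integrable (lborel \<Otimes>\<^sub>M lborel) (\<lambda>p. J p * F (Zc p))"
  by (subst lborel_coords, subst integrable_distr_eq)
     (auto simp: integrable_density J_nonneg)

lemma integral_coords:
  fixes F :: "real \<times> real \<times> (real \<times> real) \<Rightarrow> real"
  assumes [measurable]: "F \<in> borel_measurable borel"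
  shows "integral\<^sup>L lborel F = (LINT p|(lborel \<Otimes>\<^sub>M lborel). J p * F (Zc p))"
  by (subst lborel_coords, subst integral_distr)
     (auto simp: integral_density J_nonneg)

lemma Zc_en: "e \<ge> 0 \<Longrightarrow> en (Zc ((e, w), s)) = e"
proof -
  assume "e \<ge> 0"
  then have "(sqrt (2 * e) * sin s)\<^sup>2 + (sqrt (2 * e) * cos s)\<^sup>2 = 2 * e"
    by (simp add: power_mult_distrib flip: distrib_left)
  then show ?thesis by (simp add: en_def Zc_def)
qed

lemma Zc_w: "snd (snd (Zc ((e, w), s))) = w"
  by (simp add: Zc_def)

text \<open>The half-angle identity \<open>tan (s / 2) = sin s / (1 + cos s)\<close>, after
  cancelling the radius.\<close>

lemma Zc_ang: "e > 0 \<Longrightarrow> s \<in> {-pi<..<pi} \<Longrightarrow> ang (Zc ((e, w), s)) = s"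
proof -
  assume e: "e > 0" and s: "s \<in> {-pi<..<pi}"
  have en: "en (Zc ((e, w), s)) = e" using e by (intro Zc_en) simp
  have "ang (Zc ((e, w), s)) = 2 * arctan ((sqrt (2 * e) * sin s) / (sqrt (2 * e) + sqrt (2 * e) * cos s))"
    unfolding ang_def en by (simp add: Zc_def)
  also have "(sqrt (2 * e) * sin s) / (sqrt (2 * e) + sqrt (2 * e) * cos s) = (sqrt (2 * e) * sin s) / (sqrt (2 * e) * (1 + cos s))"
    by (simp only: distrib_left mult_1_right)
  also have "\<dots> = sin s / (1 + cos s)" using e by (intro nonzero_mult_divide_mult_cancel_left) simp
  also have "sin s / (1 + cos s) = tan (s / 2)" using tan_half[of "s / 2"] by (simp add: add.commute)
  also have "2 * arctan (tan (s / 2)) = s" using s by (subst arctan_tan) auto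
  finally show ?thesis .
qed

lemma en_meas [measurable]: "en \<in> borel_measurable borel"
  unfolding en_def[abs_def]
  by (intro borel_measurable_continuous_onI continuous_intros continuous_on_compose2[OF q_cont[of UNIV]]) auto

lemma ang_meas [measurable]: "ang \<in> borel_measurable borel"
proof -
  have [measurable]: "(\<lambda>z::real \<times> real \<times> (real \<times> real). fst (snd z)) \<in> borel_measurable borel"
    "(\<lambda>z::real \<times> real \<times> (real \<times> real). q (fst z)) \<in> borel_measurable borel"
    by (intro borel_measurable_continuous_onI continuous_intros continuous_on_compose2[OF q_cont[of UNIV]]; simp)+
  have [measurable]: "arctan \<in> borel_measurable borel"
    by (intro borel_measurable_continuous_onI continuous_intros)
  show ?thesis unfolding ang_def[abs_def] by measurable
qed

end

section \<open>The weighted space in energy-angle coordinates\<close>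

text \<open>Exactly the smoothness clause of \<open>C1c\<close>, separated from the support
  condition so that test functions can be assembled from sums, products and compositions.\<close>

definition C1 :: "('a::euclidean_space \<Rightarrow> real) \<Rightarrow> bool" where
  "C1 f \<longleftrightarrow> (\<exists>f'. (\<forall>z. (f has_derivative f' z) (at z)) \<and> (\<forall>w. continuous_on UNIV (\<lambda>z. f' z w)))"

lemma C1_continuous: "C1 f \<Longrightarrow> continuous_on S f"
  unfolding C1_def by (meson continuous_at_imp_continuous_on has_derivative_continuous)

lemma C1_const: "C1 (\<lambda>z. c)"
  unfolding C1_def by (rule exI[of _ "\<lambda>z w. 0"]) auto

lemma C1_linear: "bounded_linear f \<Longrightarrow> C1 f"
  unfolding C1_def by (rule exI[of _ "\<lambda>z. f"]) (auto simp: bounded_linear_imp_has_derivative)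

lemma C1_add: "C1 f \<Longrightarrow> C1 g \<Longrightarrow> C1 (\<lambda>z. f z + g z)"
proof -
  assume "C1 f" "C1 g"
  then obtain f' g' where "\<forall>z. (f has_derivative f' z) (at z)" "\<forall>w. continuous_on UNIV (\<lambda>z. f' z w)"
    "\<forall>z. (g has_derivative g' z) (at z)" "\<forall>w. continuous_on UNIV (\<lambda>z. g' z w)"
    unfolding C1_def by blast
  then show ?thesis unfolding C1_def
    by (intro exI[of _ "\<lambda>z w. f' z w + g' z w"]) (auto intro!: has_derivative_add continuous_intros)
qed

lemma C1_mult: "C1 f \<Longrightarrow> C1 g \<Longrightarrow> C1 (\<lambda>z. f z * g z)"
proof -
  assume f: "C1 f" and g: "C1 g"
  then obtain f' g' where "\<forall>z. (f has_derivative f' z) (at z)" "\<forall>w. continuous_on UNIV (\<lambda>z. f' z w)"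
    "\<forall>z. (g has_derivative g' z) (at z)" "\<forall>w. continuous_on UNIV (\<lambda>z. g' z w)"
    unfolding C1_def by blast
  then show ?thesis unfolding C1_def
    by (intro exI[of _ "\<lambda>z w. f z * g' z w + f' z w * g z"])
       (auto intro!: has_derivative_mult continuous_on_add continuous_on_mult C1_continuous[OF f] C1_continuous[OF g])
qed

lemma C1_compose:
  assumes f: "C1 f" and g: "\<And>x. (g has_real_derivative g' x) (at x)" and g': "continuous_on UNIV g'"
  shows "C1 (\<lambda>z. g (f z))"
proof -
  obtain f' where f': "\<And>z. (f has_derivative f' z) (at z)" "\<And>w. continuous_on UNIV (\<lambda>z. f' z w)"
    using f unfolding C1_def by blast
  have "((\<lambda>z. g (f z)) has_derivative (\<lambda>w. g' (f z) * f' z w)) (at z)" for z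
    using has_derivative_compose[OF f'(1) g[of "f z", unfolded has_field_derivative_def]] by simp
  moreover have "continuous_on UNIV (\<lambda>z. g' (f z) * f' z w)" for w
    by (intro continuous_intros f' continuous_on_compose2[OF g' C1_continuous[OF f]]) auto
  ultimately show ?thesis unfolding C1_def by (intro exI[of _ "\<lambda>z w. g' (f z) * f' z w"]) auto
qed

lemma max0_square_deriv: "((\<lambda>x::real. (max 0 x)\<^sup>2) has_real_derivative 2 * max 0 x) (at x)"
proof (cases "x = 0")
  case False
  then consider "x > 0" | "x < 0" by linarith
  then show ?thesis
  proof cases
    case 1
    have "((\<lambda>x::real. x\<^sup>2) has_real_derivative 2 * max 0 x) (at x)"
      using 1 by (auto intro!: derivative_eq_intros)
    then show ?thesis
    proof (rule DERIV_eventually_eq)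
      show "\<forall>\<^sub>F s in nhds x. (max 0 s)\<^sup>2 = s\<^sup>2"
        using eventually_nhds_in_open[of "{0<..}" x] 1 by (auto elim!: eventually_mono)
    qed
  next
    case 2
    have "((\<lambda>x::real. 0) has_real_derivative 2 * max 0 x) (at x)"
      using 2 by (auto intro!: derivative_eq_intros)
    then show ?thesis
    proof (rule DERIV_eventually_eq)
      show "\<forall>\<^sub>F s in nhds x. (max 0 s)\<^sup>2 = 0"
        using eventually_nhds_in_open[of "{..<0}" x] 2 by (auto elim!: eventually_mono)
    qed
  qed
next
  case True
  have "((\<lambda>h. (max 0 (0 + h))\<^sup>2 / h) \<longlongrightarrow> 0) (at (0::real))"
  proof (rule Lim_null_comparison)
    show "\<forall>\<^sub>F h in at (0::real). norm ((max 0 (0 + h))\<^sup>2 / h) \<le> \<bar>h\<bar>"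
      by (intro always_eventually allI) (auto simp: power2_eq_square max_def)
    show "((\<lambda>h::real. \<bar>h\<bar>) \<longlongrightarrow> 0) (at 0)" by (rule tendsto_eq_intros refl | simp)+
  qed
  then show ?thesis using True by (simp add: DERIV_def)
qed

text \<open>The squares make the gluing with zero continuously differentiable, and nothing smoother
  is required of a test function.\<close>

definition bump :: "real \<Rightarrow> real \<Rightarrow> real \<Rightarrow> real" where
  "bump a b s = (max 0 (s - a))\<^sup>2 * (max 0 (b - s))\<^sup>2"

lemma bump_nonneg: "bump a b s \<ge> 0"
  by (simp add: bump_def)

lemma bump_pos_iff: "bump a b s > 0 \<longleftrightarrow> s \<in> {a<..<b}"
  by (auto simp: bump_def zero_less_mult_iff max_def)

lemma C1_bump:
  assumes f: "C1 f"
  shows "C1 (\<lambda>z. bump a b (f z))"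
proof (rule C1_compose[OF f, of "bump a b"])
  have d: "((\<lambda>s. (max 0 (s - a))\<^sup>2) has_real_derivative 2 * max 0 (x - a) * 1) (at x)"
    "((\<lambda>s. (max 0 (b - s))\<^sup>2) has_real_derivative 2 * max 0 (b - x) * (-1)) (at x)" for x
    by (rule DERIV_chain2[OF max0_square_deriv]; auto intro!: derivative_eq_intros)+
  show "(bump a b has_real_derivative 2 * max 0 (x - a) * 1 * (max 0 (b - x))\<^sup>2 + 2 * max 0 (b - x) * (-1) * (max 0 (x - a))\<^sup>2) (at x)" for x
    unfolding bump_def[abs_def] by (rule DERIV_mult[OF d])
  show "continuous_on UNIV (\<lambda>x. 2 * max 0 (x - a) * 1 * (max 0 (b - x))\<^sup>2 + 2 * max 0 (b - x) * (-1) * (max 0 (x - a))\<^sup>2)"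
    by (intro continuous_intros)
qed

text \<open>As \<open>n\<close> grows these functions increase to the indicator of the set where
  \<open>f\<close> is positive and stay below one: smooth cutoffs that sharpen to a box.\<close>

lemma C1_saturate:
  assumes "C1 f" "\<And>z. f z \<ge> 0"
  shows "C1 (\<lambda>z. real n * f z / (1 + real n * f z))"
proof -
  obtain f' where f': "\<And>z. (f has_derivative f' z) (at z)" "\<And>w. continuous_on UNIV (\<lambda>z. f' z w)"
    using assms unfolding C1_def by blast
  have pos: "1 + real n * f z \<noteq> 0" for z using assms(2)[of z] by (smt (verit) mult_nonneg_nonneg of_nat_0_le_iff)
  have "((\<lambda>x. real n * x / (1 + real n * x)) has_real_derivative real n / (1 + real n * f z)\<^sup>2) (at (f z))" for z
    using pos[of z] by (auto intro!: derivative_eq_intros simp: field_simps power2_eq_square)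
  then have "((\<lambda>z. real n * f z / (1 + real n * f z)) has_derivative
      (\<lambda>w. real n / (1 + real n * f z)\<^sup>2 * f' z w)) (at z)" for z
    using has_derivative_compose[OF f'(1)] unfolding has_field_derivative_def by blast
  moreover have "continuous_on UNIV (\<lambda>z. real n / (1 + real n * f z)\<^sup>2 * f' z w)" for w
    by (intro continuous_intros f' C1_continuous assms) (use pos in auto)
  ultimately show ?thesis unfolding C1_def
    by (intro exI[of _ "\<lambda>z w. real n / (1 + real n * f z)\<^sup>2 * f' z w"]) auto
qed

text \<open>Real and imaginary parts go through the induction together, because one more complex
  factor mixes them.\<close>

lemma C1_complex_power:
  assumes "C1 a" "C1 b"
  shows "C1 (\<lambda>z. Re (c * Complex (a z) (b z) ^ n)) \<and> C1 (\<lambda>z. Im (c * Complex (a z) (b z) ^ n))"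
proof (induction n)
  case 0 then show ?case by (simp add: C1_const)
next
  case (Suc n)
  have eq: "Re (c * Complex (a z) (b z) ^ Suc n) = a z * Re (c * Complex (a z) (b z) ^ n) + (- 1) * (b z * Im (c * Complex (a z) (b z) ^ n))"
    "Im (c * Complex (a z) (b z) ^ Suc n) = a z * Im (c * Complex (a z) (b z) ^ n) + b z * Re (c * Complex (a z) (b z) ^ n)" for z
    by (simp_all add: algebra_simps)
  show ?case unfolding eq using Suc assms by (intro conjI C1_add C1_mult C1_const) auto
qed

lemma abs_le_square_add_one: "\<bar>x\<bar> \<le> x\<^sup>2 + (1::real)"
  using sum_squares_bound[of "\<bar>x\<bar>" 1] by simp

text \<open>Only the sign of \<open>alpha\<close> and a continuous nonvanishing derivative below
  \<open>E0\<close> enter the spectral argument, so the power law and the exponential model are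
  treated at once.\<close>

locale weighted_well = well_coords q A for q A +
  fixes alpha :: "real \<Rightarrow> real" and beta :: "real \<times> real \<Rightarrow> real" and U0 :: "real \<Rightarrow> real" and u0 E0 :: real
  assumes U0_eq: "\<And>x. U0 x = u0 + (q x)\<^sup>2 / 2" and E0_gt: "u0 < E0"
    and beta_cont: "continuous_on UNIV beta" and beta_nonneg: "\<And>w. beta w \<ge> 0"
    and beta_bdd: "bounded {w. beta w \<noteq> 0}" and beta_ex: "\<exists>w. beta w > 0"
    and alpha_pos: "\<And>E. alpha E > 0 \<longleftrightarrow> E < E0" and alpha_nonneg: "\<And>E. alpha E \<ge> 0"
    and alpha_deriv_cont: "continuous_on {..<E0} (deriv alpha)"
    and alpha_deriv_ne: "\<And>E. E < E0 \<Longrightarrow> deriv alpha E \<noteq> 0"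
begin

abbreviation "Om \<equiv> Omega0 alpha beta U0"
abbreviation "Hin \<equiv> inH alpha beta U0"
abbreviation "Hnorm \<equiv> normH alpha beta U0"
abbreviation "wD \<equiv> weakD alpha beta U0"
definition e0 :: real where "e0 = E0 - u0"
text \<open>The invariants of the nontrivial orbits. The bottom energy is left out: it consists of
  equilibria, a null set in phase space on which no angle exists.\<close>

definition D0 :: "(real \<times> (real \<times> real)) set" where "D0 = {\<rho>. 0 < fst \<rho> \<and> fst \<rho> < e0 \<and> beta (snd \<rho>) > 0}"
definition Wt :: "real \<times> (real \<times> real) \<Rightarrow> real" where "Wt \<rho> = indicator D0 \<rho> / \<bar>deriv alpha (u0 + fst \<rho>) * beta (snd \<rho>)\<bar>"
definition wt :: "phase \<Rightarrow> real" where "wt z = 1 / \<bar>phi' alpha beta U0 z\<bar>"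

lemma energy_eq: "energy U0 z = u0 + en z"
  by (simp add: energy_def en_def U0_eq)

lemma en_nonneg: "en z \<ge> 0"
  by (simp add: en_def)

lemma Om_eq: "Om = {z. en z < e0 \<and> beta (snd (snd z)) > 0}"
  using alpha_pos alpha_nonneg beta_nonneg
  by (auto simp: Omega0_def f0_def energy_eq e0_def zero_less_mult_iff algebra_simps dest: leD)

lemma en_cont: "continuous_on S en"
  unfolding en_def[abs_def] by (intro continuous_intros continuous_on_compose2[OF q_cont[of UNIV]]) auto

lemma open_Om: "open Om"
proof -
  have "Om = {z. en z < e0} \<inter> {z. 0 < beta (snd (snd z))}" by (auto simp: Om_eq)
  also have "open \<dots>"
    by (intro open_Int open_Collect_less en_cont continuous_intros continuous_on_compose2[OF beta_cont]) auto
  finally show ?thesis .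
qed

lemma open_D0: "open D0"
proof -
  have "D0 = {z. 0 < fst z} \<inter> {z. fst z < e0} \<inter> {z. 0 < beta (snd z)}" by (auto simp: D0_def)
  also have "open \<dots>"
    by (intro open_Int open_Collect_less continuous_intros continuous_on_compose2[OF beta_cont]) auto
  finally show ?thesis .
qed

lemma sets_Om [measurable]: "Om \<in> sets borel" and sets_D0 [measurable]: "D0 \<in> sets borel"
  using open_Om open_D0 by auto

lemma phi'_cont: "continuous_on Om (phi' alpha beta U0)"
  unfolding phi'_def[abs_def]
  by (intro continuous_intros continuous_on_compose2[OF alpha_deriv_cont] continuous_on_compose2[OF beta_cont])
     (auto simp: energy_eq[abs_def] Om_eq e0_def intro!: continuous_intros en_cont)

lemma phi'_ne: "z \<in> Om \<Longrightarrow> phi' alpha beta U0 z \<noteq> 0"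
  by (auto simp: phi'_def Om_eq energy_eq e0_def alpha_deriv_ne)

lemma wt_cont: "continuous_on Om wt"
  unfolding wt_def[abs_def] by (intro continuous_intros phi'_cont) (auto simp: phi'_ne)

lemma wt_pos: "z \<in> Om \<Longrightarrow> wt z > 0"
  using phi'_ne by (auto simp: wt_def)

lemma Wt_cont: "continuous_on D0 Wt"
  unfolding Wt_def[abs_def]
  by (subst continuous_on_cong[OF refl, of _ _ "\<lambda>\<rho>. 1 / \<bar>deriv alpha (u0 + fst \<rho>) * beta (snd \<rho>)\<bar>"], simp,
      intro continuous_intros continuous_on_compose2[OF alpha_deriv_cont] continuous_on_compose2[OF beta_cont])
     (auto simp: D0_def e0_def alpha_deriv_ne)

lemma Wt_pos: "\<rho> \<in> D0 \<Longrightarrow> Wt \<rho> > 0"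
  by (auto simp: Wt_def D0_def e0_def alpha_deriv_ne)

lemma wt_ind_meas [measurable]: "(\<lambda>z. indicator Om z * wt z) \<in> borel_measurable borel"
  using borel_measurable_continuous_on_indicator[OF _ wt_cont] by simp

lemma Wt_nonneg: "Wt \<rho> \<ge> 0"
  by (auto simp: Wt_def)

lemma Wt_meas [measurable]: "Wt \<in> borel_measurable borel"
proof -
  have "(\<lambda>\<rho>. indicator D0 \<rho> *\<^sub>R Wt \<rho>) = Wt" by (auto simp: Wt_def indicator_def)
  then show ?thesis using borel_measurable_continuous_on_indicator[OF _ Wt_cont] by simp
qed

lemma fst_real3_meas [measurable]: "fst \<in> borel_measurable (borel :: (real \<times> (real \<times> real)) measure)"
  by (intro borel_measurable_continuous_onI continuous_intros)

lemma Zc_Om: "fst \<rho> > 0 \<Longrightarrow> Zc (\<rho>, s) \<in> Om \<longleftrightarrow> \<rho> \<in> D0"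
  using Zc_en[of "fst \<rho>" "snd \<rho>" s] Zc_w[of "fst \<rho>" "snd \<rho>" s] by (auto simp: Om_eq D0_def)

lemma Zc_wt: "\<rho> \<in> D0 \<Longrightarrow> wt (Zc (\<rho>, s)) = Wt \<rho>"
  using Zc_en[of "fst \<rho>" "snd \<rho>" s] Zc_w[of "fst \<rho>" "snd \<rho>" s]
  by (auto simp: wt_def Wt_def phi'_def energy_eq D0_def)

lemma J_Om: "J (\<rho>, s) * indicator Om (Zc (\<rho>, s)) = indicator D0 \<rho> * (indicator {-pi..pi} s * kap (fst \<rho>) s)"
proof (cases "fst \<rho> > 0")
  case True
  then show ?thesis using Zc_Om[OF True, of s] by (auto simp: J_def split_beta' indicator_def)
next
  case False
  then have "\<rho> \<notin> D0" "indicator {0<..} (fst \<rho>) = (0::real)" by (auto simp: D0_def)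
  then show ?thesis by (simp add: J_def split_beta')
qed

lemma Zc_section_meas [measurable]: "(\<lambda>s. Zc (\<rho>, s)) \<in> borel_measurable borel"
  using measurable_Pair2[OF Zc_meas, of \<rho>] by simp

text \<open>The weight is constant along an orbit and leaves the inner integral; what remains inside
  is integration in time over one period.\<close>

lemma nn_integral_slices:
  assumes [measurable]: "F \<in> borel_measurable borel" and F: "\<And>z. F z \<ge> (0::real)"
  shows "(\<integral>\<^sup>+ z \<in> Om. ennreal (F z / \<bar>phi' alpha beta U0 z\<bar>) \<partial>lborel)
    = (\<integral>\<^sup>+\<rho>. ennreal (Wt \<rho>) * (\<integral>\<^sup>+s. ennreal (F (Zc (\<rho>, s)) * kap (fst \<rho>) s) * indicator {-pi..pi} s \<partial>lborel) \<partial>lborel)"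
proof -
  have "(\<integral>\<^sup>+ z \<in> Om. ennreal (F z / \<bar>phi' alpha beta U0 z\<bar>) \<partial>lborel) = (\<integral>\<^sup>+ z. ennreal (F z * (indicator Om z * wt z)) \<partial>lborel)"
    by (intro nn_integral_cong) (auto simp: wt_def indicator_def)
  also have "\<dots> = (\<integral>\<^sup>+\<rho>. \<integral>\<^sup>+s. ennreal (J (\<rho>, s)) * ennreal (F (Zc (\<rho>, s)) * (indicator Om (Zc (\<rho>, s)) * wt (Zc (\<rho>, s)))) \<partial>lborel \<partial>lborel)"
    by (rule nn_integral_coords) measurable
  also have "\<dots> = (\<integral>\<^sup>+\<rho>. \<integral>\<^sup>+s. ennreal (Wt \<rho>) * (ennreal (F (Zc (\<rho>, s)) * kap (fst \<rho>) s) * indicator {-pi..pi} s) \<partial>lborel \<partial>lborel)"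
  proof (intro nn_integral_cong)
    fix \<rho> :: "real \<times> (real \<times> real)" and s :: real
    have "J (\<rho>, s) * (F (Zc (\<rho>, s)) * (indicator Om (Zc (\<rho>, s)) * wt (Zc (\<rho>, s))))
       = indicator D0 \<rho> * (indicator {-pi..pi} s * kap (fst \<rho>) s) * (F (Zc (\<rho>, s)) * wt (Zc (\<rho>, s)))"
      unfolding J_Om[symmetric] by (simp add: mult_ac)
    also have "\<dots> = Wt \<rho> * (F (Zc (\<rho>, s)) * kap (fst \<rho>) s * indicator {-pi..pi} s)"
      using Zc_wt[of \<rho> s] by (auto simp: indicator_def Wt_def)
    finally have eq: "J (\<rho>, s) * (F (Zc (\<rho>, s)) * (indicator Om (Zc (\<rho>, s)) * wt (Zc (\<rho>, s)))) = \<dots>" .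
    have n: "F (Zc (\<rho>, s)) * kap (fst \<rho>) s * indicator {-pi..pi} s \<ge> 0" using F kap_pos[of "fst \<rho>" s] by simp
    have n2: "Wt \<rho> \<ge> 0" by (rule Wt_nonneg)
    show "ennreal (J (\<rho>, s)) * ennreal (F (Zc (\<rho>, s)) * (indicator Om (Zc (\<rho>, s)) * wt (Zc (\<rho>, s))))
      = ennreal (Wt \<rho>) * (ennreal (F (Zc (\<rho>, s)) * kap (fst \<rho>) s) * indicator {-pi..pi} s)"
    proof -
      have "ennreal (J (\<rho>, s)) * ennreal (F (Zc (\<rho>, s)) * (indicator Om (Zc (\<rho>, s)) * wt (Zc (\<rho>, s))))
        = ennreal (Wt \<rho>) * ennreal (F (Zc (\<rho>, s)) * kap (fst \<rho>) s * indicator {-pi..pi} s)"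
        unfolding ennreal_mult'[OF J_nonneg, symmetric] eq by (rule ennreal_mult'[OF n2])
      then show ?thesis by (cases "s \<in> {-pi..pi}") simp_all
    qed
  qed
  also have "\<dots> = (\<integral>\<^sup>+\<rho>. ennreal (Wt \<rho>) * (\<integral>\<^sup>+s. ennreal (F (Zc (\<rho>, s)) * kap (fst \<rho>) s) * indicator {-pi..pi} s \<partial>lborel) \<partial>lborel)"
    by (intro nn_integral_cong nn_integral_cmult) measurable
  finally show ?thesis .
qed

definition Hsq :: "(phase \<Rightarrow> real) \<Rightarrow> ennreal" where
  "Hsq g = (\<integral>\<^sup>+ z \<in> Om. ennreal ((g z)\<^sup>2 / \<bar>phi' alpha beta U0 z\<bar>) \<partial>lborel)"

lemma Hin_iff: "Hin g \<longleftrightarrow> g \<in> borel_measurable borel \<and> Hsq g < \<infinity>"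
  by (simp add: inH_def Hsq_def)

text \<open>Also correct for infinite norm: the Bochner integral of a non-integrable function and
  \<open>enn2real\<close> of infinity are both 0. A vanishing \<open>Hnorm\<close> is therefore
  informative only together with \<open>Hin\<close>.\<close>

lemma Hnorm_eq: "g \<in> borel_measurable borel \<Longrightarrow> Hnorm g = sqrt (enn2real (Hsq g))"
proof -
  assume [measurable]: "g \<in> borel_measurable borel"
  have eq: "indicator Om z *\<^sub>R ((g z)\<^sup>2 / \<bar>phi' alpha beta U0 z\<bar>) = (g z)\<^sup>2 * (indicator Om z * wt z)" for z
    by (simp add: wt_def)
  have "(LINT z : Om | lborel. (g z)\<^sup>2 / \<bar>phi' alpha beta U0 z\<bar>)
      = enn2real (\<integral>\<^sup>+z. ennreal ((g z)\<^sup>2 * (indicator Om z * wt z)) \<partial>lborel)"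
    unfolding set_lebesgue_integral_def eq
  proof (rule integral_eq_nn_integral)
    show "(\<lambda>z. (g z)\<^sup>2 * (indicator Om z * wt z)) \<in> borel_measurable lborel" by measurable
  qed (simp add: wt_def)
  also have "(\<integral>\<^sup>+z. ennreal ((g z)\<^sup>2 * (indicator Om z * wt z)) \<partial>lborel) = Hsq g"
    unfolding Hsq_def by (intro nn_integral_cong) (auto simp: wt_def indicator_def)
  finally show ?thesis by (simp add: normH_def)
qed

lemma Hsq_slices:
  assumes [measurable]: "g \<in> borel_measurable borel"
  shows "Hsq g = (\<integral>\<^sup>+\<rho>. ennreal (Wt \<rho>) *
     (\<integral>\<^sup>+s. ennreal ((g (Zc (\<rho>, s)))\<^sup>2 * kap (fst \<rho>) s) * indicator {-pi..pi} s \<partial>lborel) \<partial>lborel)"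
  unfolding Hsq_def by (rule nn_integral_slices) auto

lemma slice_L2:
  assumes "Hin g"
  shows "AE \<rho> in lborel. \<rho> \<in> D0 \<longrightarrow> set_integrable lborel {-pi..pi} (\<lambda>s. (g (Zc (\<rho>, s)))\<^sup>2 * kap (fst \<rho>) s)"
proof -
  have [measurable]: "g \<in> borel_measurable borel" using assms by (simp add: Hin_iff)
  let ?f = "\<lambda>\<rho>. (\<integral>\<^sup>+s. ennreal ((g (Zc (\<rho>, s)))\<^sup>2 * kap (fst \<rho>) s) * indicator {-pi..pi} s \<partial>lborel)"
  have "AE \<rho> in lborel. ennreal (Wt \<rho>) * ?f \<rho> \<noteq> \<infinity>"
  proof (rule nn_integral_PInf_AE)
    show "(\<lambda>\<rho>. ennreal (Wt \<rho>) * ?f \<rho>) \<in> borel_measurable lborel" by measurable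
  qed (use assms Hsq_slices[of g] in \<open>auto simp: Hin_iff\<close>)
  then show ?thesis
  proof eventually_elim
    case (elim \<rho>)
    show ?case
    proof
      assume \<rho>: "\<rho> \<in> D0"
      have "?f \<rho> \<noteq> \<infinity>" using elim \<rho> Wt_pos[OF \<rho>] by (auto simp: ennreal_mult_eq_top_iff)
      then have "?f \<rho> < \<infinity>" by (simp add: less_top)
      moreover have "?f \<rho> = (\<integral>\<^sup>+s. ennreal (norm (indicator {-pi..pi} s *\<^sub>R ((g (Zc (\<rho>, s)))\<^sup>2 * kap (fst \<rho>) s))) \<partial>lborel)"
        using less_imp_le[OF kap_pos[of "fst \<rho>"]] by (intro nn_integral_cong) (auto simp: indicator_def abs_mult)
      ultimately show "set_integrable lborel {-pi..pi} (\<lambda>s. (g (Zc (\<rho>, s)))\<^sup>2 * kap (fst \<rho>) s)"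
        unfolding set_integrable_def by (intro integrableI_bounded) auto
    qed
  qed
qed

text \<open>The circle has finite length in time, and \<open>|y| <= y^2 + 1\<close>.\<close>

lemma L1_of_L2:
  assumes "set_integrable lborel {-pi..pi} (\<lambda>s. (y s)\<^sup>2 * kap e s)" and [measurable]: "y \<in> borel_measurable borel"
  shows "set_integrable lborel {-pi..pi} (\<lambda>s. y s * kap e s)"
  unfolding set_integrable_def
proof (rule Bochner_Integration.integrable_bound)
  show "integrable lborel (\<lambda>s. indicator {-pi..pi} s *\<^sub>R ((y s)\<^sup>2 * kap e s) + indicator {-pi..pi} s *\<^sub>R kap e s)"
    using assms(1) set_integrable_continuous_Icc[OF kap_cont[of "{-pi..pi}" e]]
    unfolding set_integrable_def by (rule Bochner_Integration.integrable_add)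
  show "AE s in lborel. norm (indicator {-pi..pi} s *\<^sub>R (y s * kap e s))
     \<le> norm (indicator {-pi..pi} s *\<^sub>R ((y s)\<^sup>2 * kap e s) + indicator {-pi..pi} s *\<^sub>R kap e s)"
  proof (rule AE_I2)
    fix s
    have "\<bar>y s\<bar> \<le> (y s)\<^sup>2 + 1" by (rule abs_le_square_add_one)
    from mult_right_mono[OF this, of "kap e s"]
    show "norm (indicator {-pi..pi} s *\<^sub>R (y s * kap e s))
     \<le> norm (indicator {-pi..pi} s *\<^sub>R ((y s)\<^sup>2 * kap e s) + indicator {-pi..pi} s *\<^sub>R kap e s)"
      using kap_pos[of e s] by (auto simp: indicator_def abs_mult distrib_right)
  qed
qed measurable

lemma slice_meas: "g \<in> borel_measurable borel \<Longrightarrow> (\<lambda>s. g (Zc (\<rho>, s))) \<in> borel_measurable borel"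
  by (rule measurable_compose[OF Zc_section_meas])

text \<open>On compact subsets of the domain \<open>phi'\<close> is bounded, so the weight is
  bounded below there, and \<open>|g| <= g^2 + 1\<close> does the rest.\<close>

lemma Hin_L1loc: "Hin g \<Longrightarrow> L1loc Om g"
  unfolding L1loc_def
proof (intro allI impI)
  fix K assume g: "Hin g" and K: "compact K \<and> K \<subseteq> Om"
  have [measurable]: "g \<in> borel_measurable borel" using g by (simp add: Hin_iff)
  have Kb[measurable]: "K \<in> sets borel" using K by (simp add: borel_compact)
  have "bounded (phi' alpha beta U0 ` K)"
    using K by (intro compact_imp_bounded compact_continuous_image continuous_on_subset[OF phi'_cont]) auto
  then obtain B where B: "\<forall>z\<in>K. \<bar>phi' alpha beta U0 z\<bar> \<le> B" by (auto simp: bounded_iff)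
  have int: "integrable lborel (\<lambda>z. indicator Om z *\<^sub>R ((g z)\<^sup>2 * wt z))"
  proof (rule integrableI_bounded)
    have eq: "indicator Om z *\<^sub>R ((g z)\<^sup>2 * wt z) = (g z)\<^sup>2 * (indicator Om z * wt z)" for z by simp
    show "(\<lambda>z. indicator Om z *\<^sub>R ((g z)\<^sup>2 * wt z)) \<in> borel_measurable lborel" unfolding eq by measurable
    have "(\<integral>\<^sup>+ z. ennreal (norm (indicator Om z *\<^sub>R ((g z)\<^sup>2 * wt z))) \<partial>lborel) = Hsq g"
      unfolding Hsq_def by (intro nn_integral_cong) (auto simp: indicator_def wt_def)
    then show "(\<integral>\<^sup>+ z. ennreal (norm (indicator Om z *\<^sub>R ((g z)\<^sup>2 * wt z))) \<partial>lborel) < \<infinity>"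
      using g by (simp add: Hin_iff)
  qed
  show "set_integrable lborel K g" unfolding set_integrable_def
  proof (rule Bochner_Integration.integrable_bound)
    show "integrable lborel (\<lambda>z. B * (indicator Om z *\<^sub>R ((g z)\<^sup>2 * wt z)) + indicator K z)"
      using K emeasure_compact_finite[of K]
      by (intro Bochner_Integration.integrable_add integrable_mult_right int integrable_real_indicator) auto
    show "AE z in lborel. norm (indicator K z *\<^sub>R g z) \<le> norm (B * (indicator Om z *\<^sub>R ((g z)\<^sup>2 * wt z)) + indicator K z)"
    proof (rule AE_I2)
      fix z
      show "norm (indicator K z *\<^sub>R g z) \<le> norm (B * (indicator Om z *\<^sub>R ((g z)\<^sup>2 * wt z)) + indicator K z)"
      proof (cases "z \<in> K")
        case True
        then have z: "z \<in> Om" "\<bar>phi' alpha beta U0 z\<bar> \<le> B" using K B by auto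
        have "1 \<le> B * wt z" using z phi'_ne[OF z(1)] by (simp add: wt_def)
        then have "(g z)\<^sup>2 \<le> B * ((g z)\<^sup>2 * wt z)" using mult_left_mono[of 1 "B * wt z" "(g z)\<^sup>2"] by (simp add: mult_ac)
        moreover have "\<bar>g z\<bar> \<le> (g z)\<^sup>2 + 1" by (rule abs_le_square_add_one)
        ultimately show ?thesis using True z(1) by simp
      next
        case False
        have "B \<ge> 0 \<or> K = {}" using B by force
        then show ?thesis using False by simp
      qed
    qed
  qed measurable
qed

end

section \<open>Weak derivatives on energy curves\<close>

context weighted_well begin

lemma deriv_U0: "deriv U0 x = q x * A x"
proof -
  have "((\<lambda>x. u0 + (q x)\<^sup>2 / 2) has_real_derivative q x * A x) (at x)"
    by (auto intro!: derivative_eq_intros q_deriv)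
  then have "(U0 has_real_derivative q x * A x) (at x)" using U0_eq by presburger
  then show ?thesis by (rule DERIV_imp_deriv)
qed

lemma U0_deriv_cont: "continuous_on S (deriv U0)"
  unfolding deriv_U0[abs_def] by (intro continuous_intros q_cont continuous_on_subset[OF A_cont]) auto

lemma C1_Dtest_cont:
  assumes "C1 \<xi>" shows "continuous_on S (Dtest U0 \<xi>)"
proof -
  obtain f' where f': "\<And>z. (\<xi> has_derivative f' z) (at z)" "\<And>w. continuous_on UNIV (\<lambda>z. f' z w)"
    using assms unfolding C1_def by blast
  have "frechet_derivative \<xi> (at z) = f' z" for z
    using frechet_derivative_at[OF f'(1)] by simp
  then show ?thesis unfolding Dtest_def[abs_def]
    by (auto intro!: continuous_intros continuous_on_subset[OF f'(2)] continuous_on_compose2[OF U0_deriv_cont[of UNIV]])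
qed

text \<open>In the angle the orbit moves with velocity \<open>kap\<close> times
  \<open>(v1, - U0')\<close>, because \<open>sqrt (2 * e) * cos s = - q\<close>,
  \<open>U0' = q * A\<close> and \<open>kap = 1 / A\<close>.\<close>

lemma Dtest_along_orbit:
  assumes "C1 \<xi>"
  shows "((\<lambda>s. \<xi> (Zc ((e, w), s))) has_real_derivative kap e s * Dtest U0 \<xi> (Zc ((e, w), s))) (at s)"
proof -
  obtain f' where f': "\<And>z. (\<xi> has_derivative f' z) (at z)" using assms unfolding C1_def by blast
  let ?z = "Zc ((e, w), s)"
  have fr: "frechet_derivative \<xi> (at ?z) = f' ?z" using frechet_derivative_at[OF f'] by simp
  have lin: "linear (f' ?z)" using f'[of ?z] by (rule has_derivative_linear)
  have x: "((\<lambda>s. X (- sqrt (2 * e) * cos s)) has_vector_derivative kap e s * (sqrt (2 * e) * sin s)) (at s)"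
    unfolding has_real_derivative_iff_has_vector_derivative[symmetric] kap_def
    by (rule DERIV_chain2[OF X_deriv]) (auto intro!: derivative_eq_intros)
  have v: "((\<lambda>s. sqrt (2 * e) * sin s) has_vector_derivative sqrt (2 * e) * cos s) (at s)"
    unfolding has_real_derivative_iff_has_vector_derivative[symmetric]
    by (auto intro!: derivative_eq_intros)
  have "((\<lambda>s. Zc ((e, w), s)) has_vector_derivative (kap e s * (sqrt (2 * e) * sin s), sqrt (2 * e) * cos s, 0)) (at s)"
    unfolding Zc_def prod.case by (intro has_vector_derivative_Pair x v has_vector_derivative_const)
  then have "((\<lambda>s. \<xi> (Zc ((e, w), s))) has_vector_derivative f' ?z (kap e s * (sqrt (2 * e) * sin s), sqrt (2 * e) * cos s, 0)) (at s)"
    using vector_derivative_diff_chain_within[of "\<lambda>s. Zc ((e, w), s)" _ s UNIV \<xi> "f' ?z"]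
      has_derivative_at_withinI[OF f'[of ?z]] by (simp add: o_def)
  moreover have "f' ?z (kap e s * (sqrt (2 * e) * sin s), sqrt (2 * e) * cos s, 0) = kap e s * Dtest U0 \<xi> ?z"
  proof -
    have "(kap e s * (sqrt (2 * e) * sin s), sqrt (2 * e) * cos s, 0) =
      (kap e s * (sqrt (2 * e) * sin s)) *\<^sub>R (1, 0, 0, 0) + (sqrt (2 * e) * cos s) *\<^sub>R (0, 1, 0, 0 :: real)"
      by (simp add: zero_prod_def)
    then have "f' ?z (kap e s * (sqrt (2 * e) * sin s), sqrt (2 * e) * cos s, 0) =
      f' ?z ((kap e s * (sqrt (2 * e) * sin s)) *\<^sub>R (1, 0, 0, 0) + (sqrt (2 * e) * cos s) *\<^sub>R (0, 1, 0, 0))"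
      by (rule arg_cong)
    also have "\<dots> = (kap e s * (sqrt (2 * e) * sin s)) * f' ?z (1, 0, 0, 0) + (sqrt (2 * e) * cos s) * f' ?z (0, 1, 0, 0)"
      unfolding linear_add[OF lin] linear_scale[OF lin] real_scaleR_def ..
    finally have "f' ?z (kap e s * (sqrt (2 * e) * sin s), sqrt (2 * e) * cos s, 0) =
      (kap e s * (sqrt (2 * e) * sin s)) * f' ?z (1, 0, 0, 0) + (sqrt (2 * e) * cos s) * f' ?z (0, 1, 0, 0)" .
    moreover have "sqrt (2 * e) * cos s = - kap e s * deriv U0 (fst ?z)"
      using A_pos[of "X (- (sqrt (2 * e) * cos s))"] by (simp add: deriv_U0 Zc_def kap_def)
    moreover have "F = k * (v * P - d * Q)" if "F = k * v * P + b * Q" "b = - k * d" for F k v P b Q d :: real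
      using that by (simp add: algebra_simps)
    moreover have "fst (snd ?z) = sqrt (2 * e) * sin s" by (simp add: Zc_def)
    ultimately show ?thesis unfolding Dtest_def fr by (simp only: mult.assoc)
  qed
  ultimately show ?thesis by (simp add: has_real_derivative_iff_has_vector_derivative)
qed

lemma Zc_cont: "continuous_on S (\<lambda>s. Zc ((e, w), s))"
  unfolding Zc_def prod.case
  by (intro continuous_intros continuous_on_compose2[OF X_cont[of UNIV]]) auto

lemma C1_slice_cont:
  "continuous_on UNIV h \<Longrightarrow> continuous_on S (\<lambda>s. h (Zc ((e, w), s)))"
  by (rule continuous_on_compose2[OF _ Zc_cont]) auto

lemma weighted_integrable:
  assumes g: "Hin g" and h[measurable]: "h \<in> borel_measurable borel" and K: "compact K" "K \<subseteq> Om"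
    and hb: "\<And>z. z \<in> K \<Longrightarrow> \<bar>h z\<bar> \<le> M"
  shows "integrable lborel (\<lambda>z. indicator K z * (wt z * g z * h z))"
proof -
  have "set_integrable lborel K g" using Hin_L1loc[OF g] K by (auto simp: L1loc_def)
  moreover have c: "continuous_on K wt" by (rule continuous_on_subset[OF wt_cont K(2)])
  then obtain B where B: "\<forall>z\<in>K. \<bar>wt z\<bar> \<le> B"
    using compact_imp_bounded[OF compact_continuous_image[OF c K(1)]] by (auto simp: bounded_iff)
  then have "\<bar>wt z * h z\<bar> \<le> B * M" if "z \<in> K" for z
    unfolding abs_mult using that hb[OF that] by (intro mult_mono) (auto intro: order_trans[OF abs_ge_zero])
  moreover have "set_borel_measurable lborel K (\<lambda>z. wt z * h z)"
  proof -
    have "(\<lambda>z. (indicator K z *\<^sub>R wt z) * h z) \<in> borel_measurable borel"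
      using borel_measurable_continuous_on_indicator[OF borel_compact[OF K(1)] c] by measurable
    then show ?thesis by (simp add: set_borel_measurable_def mult.assoc)
  qed
  ultimately have "set_integrable lborel K (\<lambda>z. g z * (wt z * h z))"
    by (intro set_integrable_mult_bounded[where B="B * M"]) auto
  then show ?thesis by (simp add: set_integrable_def mult_ac)
qed

text \<open>Continuity of \<open>h\<close> is not demanded, since later \<open>h\<close> carries the
  indicator of a compact tube of orbits.\<close>

lemma weighted_slices_bounded:
  assumes g: "Hin g" and h: "h \<in> borel_measurable borel" and K: "compact K" "K \<subseteq> Om"
    and hb: "\<And>z. z \<in> K \<Longrightarrow> \<bar>h z\<bar> \<le> M"
    and hK: "\<And>z. z \<in> Om \<Longrightarrow> z \<notin> K \<Longrightarrow> h z = 0"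
  shows "(LINT z:Om|lborel. wt z * g z * h z) =
      (LINT \<rho>|lborel. Wt \<rho> * (LINT s:{-pi..pi}|lborel. g (Zc (\<rho>, s)) * (kap (fst \<rho>) s * h (Zc (\<rho>, s)))))"
    and "integrable lborel (\<lambda>\<rho>. Wt \<rho> * (LINT s:{-pi..pi}|lborel. g (Zc (\<rho>, s)) * (kap (fst \<rho>) s * h (Zc (\<rho>, s)))))"
proof -
  have [measurable]: "g \<in> borel_measurable borel" "h \<in> borel_measurable borel"
    using g h by (auto simp: Hin_iff)
  let ?F = "\<lambda>z. (indicator Om z * wt z) * (g z * h z)"
  have eqF: "?F z = indicator K z * (wt z * g z * h z)" for z
    using hK[of z] K by (auto simp: indicator_def)
  have intF: "integrable lborel ?F" unfolding eqF by (rule weighted_integrable[OF g h K hb])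
  have eqS: "indicator Om z *\<^sub>R (wt z * g z * h z) = ?F z" for z by simp
  have F_meas: "?F \<in> borel_measurable borel" by measurable
  have intJ: "integrable (lborel \<Otimes>\<^sub>M lborel) (\<lambda>p. J p * ?F (Zc p))"
    using integrable_coords_iff[OF F_meas] intF by blast
  have JF: "J (\<rho>, s) * ?F (Zc (\<rho>, s)) = Wt \<rho> * (indicator {-pi..pi} s *\<^sub>R (g (Zc (\<rho>, s)) * (kap (fst \<rho>) s * h (Zc (\<rho>, s)))))" for \<rho> s
  proof -
    have "J (\<rho>, s) * ?F (Zc (\<rho>, s)) = (J (\<rho>, s) * indicator Om (Zc (\<rho>, s))) * (wt (Zc (\<rho>, s)) * (g (Zc (\<rho>, s)) * h (Zc (\<rho>, s))))"
      by simp
    also have "\<dots> = Wt \<rho> * (indicator {-pi..pi} s *\<^sub>R (g (Zc (\<rho>, s)) * (kap (fst \<rho>) s * h (Zc (\<rho>, s)))))"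
      unfolding J_Om using Zc_wt[of \<rho> s] by (cases "\<rho> \<in> D0") (auto simp: Wt_def)
    finally show ?thesis .
  qed
  have inner: "(LINT s|lborel. J (\<rho>, s) * ?F (Zc (\<rho>, s))) = Wt \<rho> * (LINT s:{-pi..pi}|lborel. g (Zc (\<rho>, s)) * (kap (fst \<rho>) s * h (Zc (\<rho>, s))))" for \<rho>
    unfolding JF set_lebesgue_integral_def by simp
  have "(LINT z:Om|lborel. wt z * g z * h z) = (LINT p|(lborel \<Otimes>\<^sub>M lborel). J p * ?F (Zc p))"
    unfolding set_lebesgue_integral_def eqS by (rule integral_coords[OF F_meas])
  also have "\<dots> = (LINT \<rho>|lborel. LINT s|lborel. J (\<rho>, s) * ?F (Zc (\<rho>, s)))"
    by (rule lborel_pair.integral_fst'[OF intJ, symmetric])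
  finally show "(LINT z:Om|lborel. wt z * g z * h z) =
      (LINT \<rho>|lborel. Wt \<rho> * (LINT s:{-pi..pi}|lborel. g (Zc (\<rho>, s)) * (kap (fst \<rho>) s * h (Zc (\<rho>, s)))))"
    unfolding inner .
  show "integrable lborel (\<lambda>\<rho>. Wt \<rho> * (LINT s:{-pi..pi}|lborel. g (Zc (\<rho>, s)) * (kap (fst \<rho>) s * h (Zc (\<rho>, s)))))"
    using lborel_pair.integrable_fst'[OF intJ] unfolding inner .
qed

lemma weighted_slices:
  assumes g: "Hin g" and h: "continuous_on UNIV h" and K: "compact K" "K \<subseteq> Om"
    and hK: "\<And>z. z \<in> Om \<Longrightarrow> z \<notin> K \<Longrightarrow> h z = 0"
  shows "(LINT z:Om|lborel. wt z * g z * h z) =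
      (LINT \<rho>|lborel. Wt \<rho> * (LINT s:{-pi..pi}|lborel. g (Zc (\<rho>, s)) * (kap (fst \<rho>) s * h (Zc (\<rho>, s)))))"
    and "integrable lborel (\<lambda>\<rho>. Wt \<rho> * (LINT s:{-pi..pi}|lborel. g (Zc (\<rho>, s)) * (kap (fst \<rho>) s * h (Zc (\<rho>, s)))))"
proof -
  obtain M where "\<forall>z\<in>K. \<bar>h z\<bar> \<le> M"
    using compact_imp_bounded[OF compact_continuous_image[OF continuous_on_subset[OF h subset_UNIV] K(1)]]
    by (auto simp: bounded_iff)
  note * = weighted_slices_bounded[OF g borel_measurable_continuous_onI[OF h] K this[rule_format] hK]
  show "(LINT z:Om|lborel. wt z * g z * h z) =
      (LINT \<rho>|lborel. Wt \<rho> * (LINT s:{-pi..pi}|lborel. g (Zc (\<rho>, s)) * (kap (fst \<rho>) s * h (Zc (\<rho>, s)))))" by (rule *(1))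
  show "integrable lborel (\<lambda>\<rho>. Wt \<rho> * (LINT s:{-pi..pi}|lborel. g (Zc (\<rho>, s)) * (kap (fst \<rho>) s * h (Zc (\<rho>, s)))))" by (rule *(2))
qed

lemma C1c_iff: "C1c Om \<xi> \<longleftrightarrow> C1 \<xi> \<and> (\<exists>K. compact K \<and> K \<subseteq> Om \<and> (\<forall>z. z \<notin> K \<longrightarrow> \<xi> z = 0))"
  by (simp add: C1c_def C1_def)

lemma Dtest_zero_outside:
  assumes K: "closed K" and \<xi>: "\<And>z. z \<notin> K \<Longrightarrow> \<xi> z = 0" and z: "z \<notin> K"
  shows "Dtest U0 \<xi> z = 0"
proof -
  have "(\<xi> has_derivative (\<lambda>_. 0)) (at z)"
  proof (rule has_derivative_transform_within_open[of "\<lambda>_. 0"])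
    show "open (- K)" using K by auto
  qed (use z \<xi> in auto)
  then have "frechet_derivative \<xi> (at z) = (\<lambda>_. 0)" by (rule frechet_derivative_at[symmetric])
  then show ?thesis by (simp add: Dtest_def)
qed

lemma weakD_iff_slice_integrals:
  assumes g: "Hin g" and m: "Hin m"
  shows "wD g m \<longleftrightarrow> (\<forall>\<xi>. C1c Om \<xi> \<longrightarrow>
     (LINT \<rho>|lborel. Wt \<rho> * (LINT s:{-pi..pi}|lborel. g (Zc (\<rho>, s)) * (kap (fst \<rho>) s * Dtest U0 \<xi> (Zc (\<rho>, s))))) =
     - (LINT \<rho>|lborel. Wt \<rho> * (LINT s:{-pi..pi}|lborel. m (Zc (\<rho>, s)) * (kap (fst \<rho>) s * \<xi> (Zc (\<rho>, s))))))"
proof -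
  have "(LINT z:Om|lborel. wt z * g z * Dtest U0 \<xi> z) =
     (LINT \<rho>|lborel. Wt \<rho> * (LINT s:{-pi..pi}|lborel. g (Zc (\<rho>, s)) * (kap (fst \<rho>) s * Dtest U0 \<xi> (Zc (\<rho>, s)))))
    \<and> (LINT z:Om|lborel. wt z * m z * \<xi> z) =
     (LINT \<rho>|lborel. Wt \<rho> * (LINT s:{-pi..pi}|lborel. m (Zc (\<rho>, s)) * (kap (fst \<rho>) s * \<xi> (Zc (\<rho>, s)))))"
    if "C1c Om \<xi>" for \<xi>
  proof -
    have C: "C1 \<xi>" and ex: "\<exists>K. compact K \<and> K \<subseteq> Om \<and> (\<forall>z. z \<notin> K \<longrightarrow> \<xi> z = 0)"
      using that by (simp_all only: C1c_iff)
    from ex obtain K where K: "compact K" "K \<subseteq> Om" "\<forall>z. z \<notin> K \<longrightarrow> \<xi> z = 0" by (elim exE conjE)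
    note K3 = K(3)[rule_format]
    show ?thesis
      by (rule conjI[OF weighted_slices(1)[OF g C1_Dtest_cont[OF C] K(1,2) Dtest_zero_outside[OF compact_imp_closed[OF K(1)] K3]]
            weighted_slices(1)[OF m C1_continuous[OF C] K(1,2) K3]])
  qed
  note E = this
  have "wD g m \<longleftrightarrow> (\<forall>\<xi>. C1c Om \<xi> \<longrightarrow>
      (LINT z:Om|lborel. wt z * g z * Dtest U0 \<xi> z) = - (LINT z:Om|lborel. wt z * m z * \<xi> z))"
    by (simp only: weakD_def Let_def wt_def Hin_L1loc[OF g] Hin_L1loc[OF m] simp_thms)
  also have "\<dots> \<longleftrightarrow> (\<forall>\<xi>. C1c Om \<xi> \<longrightarrow>
     (LINT \<rho>|lborel. Wt \<rho> * (LINT s:{-pi..pi}|lborel. g (Zc (\<rho>, s)) * (kap (fst \<rho>) s * Dtest U0 \<xi> (Zc (\<rho>, s))))) =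
     - (LINT \<rho>|lborel. Wt \<rho> * (LINT s:{-pi..pi}|lborel. m (Zc (\<rho>, s)) * (kap (fst \<rho>) s * \<xi> (Zc (\<rho>, s))))))"
  proof (rule all_cong1, rule imp_cong[OF refl])
    fix \<xi> assume "C1c Om \<xi>"
    note E = E[OF this]
    show "((LINT z:Om|lborel. wt z * g z * Dtest U0 \<xi> z) = - (LINT z:Om|lborel. wt z * m z * \<xi> z)) \<longleftrightarrow>
     ((LINT \<rho>|lborel. Wt \<rho> * (LINT s:{-pi..pi}|lborel. g (Zc (\<rho>, s)) * (kap (fst \<rho>) s * Dtest U0 \<xi> (Zc (\<rho>, s))))) =
     - (LINT \<rho>|lborel. Wt \<rho> * (LINT s:{-pi..pi}|lborel. m (Zc (\<rho>, s)) * (kap (fst \<rho>) s * \<xi> (Zc (\<rho>, s))))))"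
      unfolding E[THEN conjunct1] E[THEN conjunct2] ..
  qed
  finally show ?thesis .
qed

text \<open>A test function restricted to an orbit is a periodic, continuously differentiable
  function of the angle. On each circle the claim is integration by parts, with the weight as a
  constant factor.\<close>

lemma weakD_of_slices:
  assumes g: "Hin g" and m: "Hin m"
    and sl: "AE \<rho> in lborel. \<rho> \<in> D0 \<longrightarrow> circ_prim (kap (fst \<rho>)) (\<lambda>s. g (Zc (\<rho>, s))) (\<lambda>s. m (Zc (\<rho>, s)))"
  shows "wD g m"
  unfolding weakD_iff_slice_integrals[OF g m]
proof (intro allI impI)
  fix \<xi> assume "C1c Om \<xi>"
  then obtain K where K: "compact K" "K \<subseteq> Om" "\<And>z. z \<notin> K \<Longrightarrow> \<xi> z = 0" and C: "C1 \<xi>"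
    unfolding C1c_iff by blast
  have gm: "g \<in> borel_measurable borel" using g by (simp add: Hin_iff)
  note i1 = weighted_slices(2)[OF g C1_Dtest_cont[OF C] K(1,2) Dtest_zero_outside[OF compact_imp_closed[OF K(1)] K(3)]]
  note i2 = weighted_slices(2)[OF m C1_continuous[OF C] K(1,2) K(3)]
  have "(LINT \<rho>|lborel. Wt \<rho> * (LINT s:{-pi..pi}|lborel. g (Zc (\<rho>, s)) * (kap (fst \<rho>) s * Dtest U0 \<xi> (Zc (\<rho>, s))))) =
     (LINT \<rho>|lborel. - (Wt \<rho> * (LINT s:{-pi..pi}|lborel. m (Zc (\<rho>, s)) * (kap (fst \<rho>) s * \<xi> (Zc (\<rho>, s))))))"
  proof (rule integral_cong_AE)
    show "AE \<rho> in lborel. Wt \<rho> * (LINT s:{-pi..pi}|lborel. g (Zc (\<rho>, s)) * (kap (fst \<rho>) s * Dtest U0 \<xi> (Zc (\<rho>, s)))) =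
      - (Wt \<rho> * (LINT s:{-pi..pi}|lborel. m (Zc (\<rho>, s)) * (kap (fst \<rho>) s * \<xi> (Zc (\<rho>, s)))))"
      using sl
    proof eventually_elim
      case (elim \<rho>)
      show ?case
      proof (cases "\<rho> \<in> D0")
        case True
        obtain e w where \<rho>: "\<rho> = (e, w)" by (cases \<rho>)
        have "(LINT s:{-pi..pi}|lborel. g (Zc (\<rho>, s)) * (kap (fst \<rho>) s * Dtest U0 \<xi> (Zc (\<rho>, s))))
          = - (LINT s:{-pi..pi}|lborel. m (Zc (\<rho>, s)) * kap (fst \<rho>) s * \<xi> (Zc (\<rho>, s)))"
        proof (rule circ_prim_by_parts)
          show "circ_prim (kap (fst \<rho>)) (\<lambda>s. g (Zc (\<rho>, s))) (\<lambda>s. m (Zc (\<rho>, s)))" using elim True by blast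
          show "(\<lambda>s. g (Zc (\<rho>, s))) \<in> borel_measurable borel" by (rule slice_meas[OF gm])
          show "((\<lambda>s. \<xi> (Zc (\<rho>, s))) has_real_derivative kap (fst \<rho>) x * Dtest U0 \<xi> (Zc (\<rho>, x))) (at x)" for x
            using Dtest_along_orbit[OF C, of e w x] by (simp add: \<rho>)
          show "continuous_on {-pi..pi} (\<lambda>s. kap (fst \<rho>) s * Dtest U0 \<xi> (Zc (\<rho>, s)))"
            unfolding \<rho> by (intro continuous_intros kap_cont C1_slice_cont C1_Dtest_cont C)
          show "\<xi> (Zc (\<rho>, pi)) = \<xi> (Zc (\<rho>, - pi))" by (simp add: \<rho> Zc_def)
        qed
        then show ?thesis by (simp add: mult.assoc)
      qed (simp add: Wt_def)
    qed
  qed (use i1 i2 in auto)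
  then show "(LINT \<rho>|lborel. Wt \<rho> * (LINT s:{-pi..pi}|lborel. g (Zc (\<rho>, s)) * (kap (fst \<rho>) s * Dtest U0 \<xi> (Zc (\<rho>, s))))) =
     - (LINT \<rho>|lborel. Wt \<rho> * (LINT s:{-pi..pi}|lborel. m (Zc (\<rho>, s)) * (kap (fst \<rho>) s * \<xi> (Zc (\<rho>, s)))))"
    by simp
qed

end

section \<open>From the weak equation to almost every orbit\<close>

lemma AE_open_of_boxes:
  fixes U :: "'a::euclidean_space set"
  assumes U: "open U" and box: "\<And>a b. cbox a b \<subseteq> U \<Longrightarrow> AE x in lborel. x \<in> box a b \<longrightarrow> P x"
  shows "AE x in lborel. x \<in> U \<longrightarrow> P x"
proof -
  obtain D where D: "countable D" "D \<subseteq> Pow U" "\<And>Q. Q \<in> D \<Longrightarrow> \<exists>a b. Q = cbox a b" "\<Union>D = U"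
    using open_countable_Union_open_cbox[OF U] by metis
  have "\<forall>Q\<in>D. AE x in lborel. x \<in> Q \<longrightarrow> P x"
  proof
    fix Q assume Q: "Q \<in> D"
    then obtain a b where ab: "Q = cbox a b" using D by blast
    have "negligible (cbox a b - box a b)" by (rule negligible_frontier_interval)
    then have "cbox a b - box a b \<in> null_sets lborel"
      by (simp add: negligible_iff_null_sets null_sets_completion_iff)
    then have "AE x in lborel. x \<notin> cbox a b - box a b" by (rule AE_not_in)
    moreover have "AE x in lborel. x \<in> box a b \<longrightarrow> P x"
      using Q D(2) ab by (intro box) auto
    ultimately show "AE x in lborel. x \<in> Q \<longrightarrow> P x"
      unfolding ab by eventually_elim auto
  qed
  then have "AE x in lborel. \<forall>Q\<in>D. x \<in> Q \<longrightarrow> P x"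
    by (subst AE_ball_countable[OF D(1)])
  then show ?thesis by eventually_elim (use D(4) in auto)
qed

lemma set_integral_pull_factor:
  fixes a b k :: "real \<Rightarrow> real"
  shows "(LINT s:I|lborel. a s * (c * b s)) = c * (LINT s:I|lborel. a s * b s)"
    "(LINT s:I|lborel. a s * (k s * (c * b s))) = c * (LINT s:I|lborel. a s * k s * b s)"
  by (subst set_integral_mult_right[symmetric], simp add: mult_ac)+

definition bump3 :: "real \<times> (real \<times> real) \<Rightarrow> real \<times> (real \<times> real) \<Rightarrow> real \<times> (real \<times> real) \<Rightarrow> real" where
  "bump3 a b \<rho> = bump (fst a) (fst b) (fst \<rho>) * (bump (fst (snd a)) (fst (snd b)) (fst (snd \<rho>)) * bump (snd (snd a)) (snd (snd b)) (snd (snd \<rho>)))"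

lemma mem_box3: "\<rho> \<in> box a b \<longleftrightarrow> fst a < fst \<rho> \<and> fst \<rho> < fst b \<and> fst (snd a) < fst (snd \<rho>) \<and> fst (snd \<rho>) < fst (snd b)
    \<and> snd (snd a) < snd (snd \<rho>) \<and> snd (snd \<rho>) < snd (snd (b :: real \<times> (real \<times> real)))"
  by (auto simp: mem_box Basis_prod_def inner_prod_def)

lemma bump3_nonneg: "bump3 a b \<rho> \<ge> 0"
  by (simp add: bump3_def bump_nonneg)

lemma bump3_zero: "\<rho> \<notin> box a b \<Longrightarrow> bump3 a b \<rho> = 0"
  using bump_pos_iff[of "fst a" "fst b" "fst \<rho>"] bump_pos_iff[of "fst (snd a)" "fst (snd b)" "fst (snd \<rho>)"]
    bump_pos_iff[of "snd (snd a)" "snd (snd b)" "snd (snd \<rho>)"] bump_nonneg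
  by (auto simp: bump3_def mem_box3 less_le)

lemma bump3_pos: "\<rho> \<in> box a b \<Longrightarrow> bump3 a b \<rho> > 0"
  by (auto simp: bump3_def mem_box3 bump_pos_iff intro!: mult_pos_pos)

text \<open>The saturated bump of a box. It converges to the indicator of the open box at every
  point, as it vanishes identically on the boundary.\<close>

definition satb :: "nat \<Rightarrow> real \<times> (real \<times> real) \<Rightarrow> real \<times> (real \<times> real) \<Rightarrow> real \<times> (real \<times> real) \<Rightarrow> real" where
  "satb n a b \<rho> = real n * bump3 a b \<rho> / (1 + real n * bump3 a b \<rho>)"

lemma satb_zero: "\<rho> \<notin> box a b \<Longrightarrow> satb n a b \<rho> = 0"
  by (simp add: satb_def bump3_zero)

lemma satb_bound: "\<bar>satb n a b \<rho>\<bar> \<le> 1"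
proof -
  have "0 \<le> real n * bump3 a b \<rho>" using bump3_nonneg by simp
  then show ?thesis by (simp add: satb_def abs_divide divide_le_eq)
qed

lemma satb_tendsto: "(\<lambda>n. satb n a b \<rho>) \<longlonglongrightarrow> indicator (box a b) \<rho>"
proof (cases "\<rho> \<in> box a b")
  case True
  define c where "c = bump3 a b \<rho>"
  have c: "c > 0" using bump3_pos[OF True] by (simp add: c_def)
  have "(\<lambda>n. 1 - 1 / (1 + real n * c)) \<longlonglongrightarrow> 1 - 0"
  proof (intro tendsto_diff tendsto_const tendsto_divide_0[OF tendsto_const] filterlim_at_top_imp_at_infinity)
    show "filterlim (\<lambda>n. 1 + real n * c) at_top sequentially"
      by (intro filterlim_tendsto_add_at_top[OF tendsto_const] filterlim_at_top_mult_tendsto_pos[OF tendsto_const c] filterlim_real_sequentially)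
  qed
  moreover have "satb n a b \<rho> = 1 - 1 / (1 + real n * c)" for n
  proof -
    have "1 + real n * c \<noteq> 0" using c by (smt (verit) mult_nonneg_nonneg of_nat_0_le_iff)
    then show ?thesis by (simp add: satb_def c_def[symmetric] field_simps)
  qed
  ultimately show ?thesis using True by simp
qed (simp add: satb_zero)

context weighted_well begin

lemma C1_q: "C1 (\<lambda>z::phase. q (fst z))"
  by (rule C1_compose[OF C1_linear q_deriv A_cont]) (rule bounded_linear_fst)

lemma C1_velocity: "C1 (\<lambda>z::phase. fst (snd z))"
  by (rule C1_linear) (rule bounded_linear_compose[OF bounded_linear_fst bounded_linear_snd])

lemma C1_w: "C1 (\<lambda>z::phase. fst (snd (snd z)))" "C1 (\<lambda>z::phase. snd (snd (snd z)))"
  by (rule C1_linear, intro bounded_linear_compose[OF bounded_linear_fst] bounded_linear_compose[OF bounded_linear_snd] bounded_linear_snd)+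

lemma C1_en: "C1 en"
proof -
  have "en = (\<lambda>z. (1 / 2) * (fst (snd z) * fst (snd z)) + (1 / 2) * (q (fst z) * q (fst z)))"
    by (auto simp: en_def power2_eq_square)
  then show ?thesis by (simp only:) (intro C1_add C1_mult C1_const C1_q C1_velocity)
qed

lemma C1_satb: "C1 (\<lambda>z. satb n a b (en z, snd (snd z)))"
  unfolding satb_def
  by (rule C1_saturate) (auto simp: bump3_def bump_nonneg intro!: C1_mult C1_bump C1_en C1_w)

definition tube :: "real \<times> (real \<times> real) \<Rightarrow> real \<times> (real \<times> real) \<Rightarrow> phase set" where
  "tube a b = {z. (en z, snd (snd z)) \<in> cbox a b}"

text \<open>The energy bounds both the velocity and \<open>q x\<close>, and the increasing inverse
  \<open>X\<close> turns the latter into bounds for the position.\<close>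

lemma tube_compact: "compact (tube a b)"
proof -
  obtain a1 a2 b1 b2 where ab: "a = (a1, a2)" "b = (b1, b2)" by (cases a, cases b)
  define r where "r = sqrt (2 * \<bar>b1\<bar>)"
  have "continuous_on UNIV (\<lambda>z. (en z, snd (snd z)))" by (intro continuous_intros en_cont)
  then have "isCont (\<lambda>z. (en z, snd (snd z))) z" for z
    by (simp only: continuous_on_eq_continuous_at[OF open_UNIV] UNIV_I ball_simps)
  from continuous_closed_vimage[OF closed_cbox this] have "closed (tube a b)"
    unfolding tube_def vimage_def .
  moreover have "tube a b \<subseteq> {X (- r)..X r} \<times> {-r..r} \<times> cbox a2 b2"
  proof
    fix z assume z: "z \<in> tube a b"
    then have e: "en z \<le> \<bar>b1\<bar>" and w: "snd (snd z) \<in> cbox a2 b2" by (auto simp: tube_def ab cbox_Pair_eq)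
    have "(fst (snd z))\<^sup>2 \<le> 2 * \<bar>b1\<bar>" "(q (fst z))\<^sup>2 \<le> 2 * \<bar>b1\<bar>"
      using e zero_le_power2[of "fst (snd z)"] zero_le_power2[of "q (fst z)"] unfolding en_def by linarith+
    then have v: "\<bar>fst (snd z)\<bar> \<le> r" and qx: "\<bar>q (fst z)\<bar> \<le> r"
      unfolding r_def by (metis real_sqrt_abs real_sqrt_le_iff)+
    have "X (-r) \<le> X (q (fst z))" "X (q (fst z)) \<le> X r" unfolding X_le using qx by auto
    then show "z \<in> {X (- r)..X r} \<times> {-r..r} \<times> cbox a2 b2" using v w by (cases z) auto
  qed
  then have "tube a b = ({X (- r)..X r} \<times> {-r..r} \<times> cbox a2 b2) \<inter> tube a b" by blast
  ultimately show ?thesis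
    by (metis compact_Int_closed compact_Times compact_Icc compact_cbox)
qed

lemma tube_Om: "cbox a b \<subseteq> D0 \<Longrightarrow> tube a b \<subseteq> Om"
  by (auto simp: tube_def Om_eq D0_def subset_iff)

lemma Zc_tube: "\<rho> \<in> D0 \<Longrightarrow> Zc (\<rho>, s) \<in> tube a b \<longleftrightarrow> \<rho> \<in> cbox a b"
  using Zc_en[of "fst \<rho>" "snd \<rho>" s] Zc_w[of "fst \<rho>" "snd \<rho>" s] by (simp add: tube_def D0_def)

lemma C1c_satb:
  assumes "C1 h" "cbox a b \<subseteq> D0" "box c d \<subseteq> cbox a b"
  shows "C1c Om (\<lambda>z. satb n c d (en z, snd (snd z)) * h z)"
  unfolding C1c_iff
proof (intro conjI exI[of _ "tube a b"] tube_compact tube_Om allI impI)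
  show "C1 (\<lambda>z. satb n c d (en z, snd (snd z)) * h z)" by (intro C1_mult C1_satb assms)
  fix z assume "z \<notin> tube a b"
  then have "(en z, snd (snd z)) \<notin> box c d" using assms by (auto simp: tube_def)
  then show "satb n c d (en z, snd (snd z)) * h z = 0" by (simp add: satb_zero)
qed (use assms in auto)

lemma Zc_satb: "fst \<rho> > 0 \<Longrightarrow> satb n c d (en (Zc (\<rho>, s)), snd (snd (Zc (\<rho>, s)))) = satb n c d \<rho>"
  using Zc_en[of "fst \<rho>" "snd \<rho>" s] Zc_w[of "fst \<rho>" "snd \<rho>" s] by simp

text \<open>The cutoff is a function of the invariants, constant along the orbit, and factors out.
  Uniqueness of the derivative along the orbit replaces a product rule for
  \<open>frechet_derivative\<close>.\<close>

lemma Dtest_satb: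
  assumes h: "C1 h" and \<rho>: "fst \<rho> > 0"
  shows "kap (fst \<rho>) s * Dtest U0 (\<lambda>z. satb n c d (en z, snd (snd z)) * h z) (Zc (\<rho>, s))
    = satb n c d \<rho> * (kap (fst \<rho>) s * Dtest U0 h (Zc (\<rho>, s)))"
proof -
  obtain e w where ew: "\<rho> = (e, w)" by (cases \<rho>)
  have "((\<lambda>s. satb n c d (en (Zc ((e, w), s)), snd (snd (Zc ((e, w), s)))) * h (Zc ((e, w), s)))
     has_real_derivative kap e s * Dtest U0 (\<lambda>z. satb n c d (en z, snd (snd z)) * h z) (Zc ((e, w), s))) (at s)"
    by (rule Dtest_along_orbit) (intro C1_mult C1_satb h)
  then have 1: "((\<lambda>s. satb n c d \<rho> * h (Zc ((e, w), s)))
     has_real_derivative kap e s * Dtest U0 (\<lambda>z. satb n c d (en z, snd (snd z)) * h z) (Zc ((e, w), s))) (at s)"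
    using Zc_satb[OF \<rho>, of n c d] unfolding ew by simp
  have 2: "((\<lambda>s. satb n c d \<rho> * h (Zc ((e, w), s))) has_real_derivative satb n c d \<rho> * (kap e s * Dtest U0 h (Zc ((e, w), s)))) (at s)"
    by (rule DERIV_cmult[OF Dtest_along_orbit[OF h]])
  show ?thesis using DERIV_unique[OF 1 2] by (simp add: ew)
qed

definition S1 where "S1 g h \<rho> = (LINT s:{-pi..pi}|lborel. g (Zc (\<rho>, s)) * (kap (fst \<rho>) s * h (Zc (\<rho>, s))))"

text \<open>\<open>h\<close> need not have compact support, so integrability is local in the
  invariants. On an orbit the indicator of the tube is the indicator of the box.\<close>

lemma S1_local_integrable:
  assumes g: "Hin g" and h: "continuous_on UNIV h" and ab: "cbox a b \<subseteq> D0"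
  shows "integrable lborel (\<lambda>\<rho>. Wt \<rho> * (indicator (cbox a b) \<rho> * S1 g h \<rho>))"
proof -
  let ?h = "\<lambda>z. indicator (tube a b) z * h z"
  have [measurable]: "h \<in> borel_measurable borel" by (rule borel_measurable_continuous_onI[OF h])
  have [measurable]: "tube a b \<in> sets borel" by (rule borel_compact[OF tube_compact])
  obtain M where M: "\<forall>z\<in>tube a b. \<bar>h z\<bar> \<le> M"
    using compact_imp_bounded[OF compact_continuous_image[OF continuous_on_subset[OF h subset_UNIV] tube_compact[of a b]]]
    by (auto simp: bounded_iff)
  have "integrable lborel (\<lambda>\<rho>. Wt \<rho> * (LINT s:{-pi..pi}|lborel. g (Zc (\<rho>, s)) * (kap (fst \<rho>) s * ?h (Zc (\<rho>, s)))))"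
    by (rule weighted_slices_bounded(2)[OF g _ tube_compact tube_Om[OF ab], where M=M]) (use M in auto)
  moreover have "Wt \<rho> * (LINT s:{-pi..pi}|lborel. g (Zc (\<rho>, s)) * (kap (fst \<rho>) s * ?h (Zc (\<rho>, s))))
     = Wt \<rho> * (indicator (cbox a b) \<rho> * S1 g h \<rho>)" for \<rho>
  proof (cases "\<rho> \<in> D0")
    case True
    have "indicator (tube a b) (Zc (\<rho>, s)) = (indicator (cbox a b) \<rho> :: real)" for s
      using Zc_tube[OF True] by (simp add: indicator_def)
    then show ?thesis by (cases "\<rho> \<in> cbox a b") (auto simp: S1_def)
  qed (simp add: Wt_def)
  ultimately show ?thesis by simp
qed

text \<open>Testing with cutoffs times \<open>h\<close> and letting the cutoffs sharpen gives
  integral zero over every sub-box, hence the slice identity almost everywhere. The positive weight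
  \<open>Wt\<close> is divided out at the very end.\<close>

lemma weak_identity_on_box:
  assumes gm: "wD g m" and g: "Hin g" and m: "Hin m" and h: "C1 h" and ab: "cbox a b \<subseteq> D0"
  shows "AE \<rho> in lborel. \<rho> \<in> box a b \<longrightarrow> S1 g (Dtest U0 h) \<rho> + S1 m h \<rho> = 0"
proof -
  define R where "R \<rho> = Wt \<rho> * (indicator (cbox a b) \<rho> * S1 g (Dtest U0 h) \<rho>) + Wt \<rho> * (indicator (cbox a b) \<rho> * S1 m h \<rho>)" for \<rho>
  note iR1 = S1_local_integrable[OF g C1_Dtest_cont[OF h] ab] and iR2 = S1_local_integrable[OF m C1_continuous[OF h] ab]
  have iR: "integrable lborel R" unfolding R_def by (rule Bochner_Integration.integrable_add[OF iR1 iR2])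
  note [measurable] = borel_measurable_integrable[OF iR]
  have satb_meas [measurable]: "satb n c d \<in> borel_measurable borel" for n c d
  proof -
    have "continuous_on UNIV (bump3 c d)" unfolding bump3_def bump_def by (intro continuous_intros)
    then have [measurable]: "bump3 c d \<in> borel_measurable borel" by (rule borel_measurable_continuous_onI)
    show ?thesis unfolding satb_def by measurable
  qed
  have zero: "(LINT \<rho>|lborel. satb n c d \<rho> * R \<rho>) = 0" if cd: "box c d \<subseteq> cbox a b" for n c d
  proof -
    let ?\<xi> = "\<lambda>z. satb n c d (en z, snd (snd z)) * h z"
    have w: "(LINT \<rho>|lborel. Wt \<rho> * S1 g (Dtest U0 ?\<xi>) \<rho>) = - (LINT \<rho>|lborel. Wt \<rho> * S1 m ?\<xi> \<rho>)"
      unfolding S1_def by (rule gm[unfolded weakD_iff_slice_integrals[OF g m], rule_format, OF C1c_satb[OF h ab cd]])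
    have e1: "Wt \<rho> * S1 g (Dtest U0 ?\<xi>) \<rho> = satb n c d \<rho> * (Wt \<rho> * (indicator (cbox a b) \<rho> * S1 g (Dtest U0 h) \<rho>))" for \<rho>
    proof (cases "\<rho> \<in> D0")
      case True
      then have pos: "fst \<rho> > 0" by (simp add: D0_def)
      have "S1 g (Dtest U0 ?\<xi>) \<rho> = satb n c d \<rho> * S1 g (Dtest U0 h) \<rho>"
        unfolding S1_def Dtest_satb[OF h pos] by (subst set_integral_mult_right[symmetric]) (simp add: mult_ac)
      then show ?thesis using satb_zero[of \<rho> c d n] cd by (cases "\<rho> \<in> box c d") (auto simp: indicator_def)
    qed (simp add: Wt_def)
    have e2: "Wt \<rho> * S1 m ?\<xi> \<rho> = satb n c d \<rho> * (Wt \<rho> * (indicator (cbox a b) \<rho> * S1 m h \<rho>))" for \<rho>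
    proof (cases "\<rho> \<in> D0")
      case True
      then have pos: "fst \<rho> > 0" by (simp add: D0_def)
      have "S1 m ?\<xi> \<rho> = satb n c d \<rho> * S1 m h \<rho>"
        unfolding S1_def Zc_satb[OF pos] by (subst set_integral_mult_right[symmetric]) (simp add: mult_ac)
      then show ?thesis using satb_zero[of \<rho> c d n] cd by (cases "\<rho> \<in> box c d") (auto simp: indicator_def)
    qed (simp add: Wt_def)
    have si: "integrable lborel (\<lambda>\<rho>. satb n c d \<rho> * F \<rho>)" if "integrable lborel F" for F :: "_ \<Rightarrow> real"
    proof (rule Bochner_Integration.integrable_bound[OF that])
      note [measurable] = borel_measurable_integrable[OF that]
      show "(\<lambda>\<rho>. satb n c d \<rho> * F \<rho>) \<in> borel_measurable lborel" by measurable
      show "AE \<rho> in lborel. norm (satb n c d \<rho> * F \<rho>) \<le> norm (F \<rho>)"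
        unfolding real_norm_def abs_mult by (intro AE_I2 mult_left_le_one_le abs_ge_zero satb_bound)
    qed
    have "(LINT \<rho>|lborel. satb n c d \<rho> * R \<rho>) = (LINT \<rho>|lborel. Wt \<rho> * S1 g (Dtest U0 ?\<xi>) \<rho>) + (LINT \<rho>|lborel. Wt \<rho> * S1 m ?\<xi> \<rho>)"
      unfolding e1 e2 R_def distrib_left by (rule Bochner_Integration.integral_add[OF si[OF iR1] si[OF iR2]])
    then show ?thesis using w by simp
  qed
  have boxz: "(LINT \<rho>:box c d|lborel. R \<rho>) = 0" if cd: "box c d \<subseteq> cbox a b" for c d
  proof -
    have "(\<lambda>n. LINT \<rho>|lborel. satb n c d \<rho> * R \<rho>) \<longlonglongrightarrow> (LINT \<rho>|lborel. indicator (box c d) \<rho> *\<^sub>R R \<rho>)"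
    proof (rule integral_dominated_convergence[where w = "\<lambda>\<rho>. norm (R \<rho>)"])
      show "integrable lborel (\<lambda>\<rho>. norm (R \<rho>))" by (rule integrable_norm[OF iR])
      show "AE \<rho> in lborel. (\<lambda>n. satb n c d \<rho> * R \<rho>) \<longlonglongrightarrow> indicator (box c d) \<rho> *\<^sub>R R \<rho>"
        unfolding real_scaleR_def by (intro AE_I2 tendsto_mult satb_tendsto tendsto_const)
      show "AE \<rho> in lborel. norm (satb n c d \<rho> * R \<rho>) \<le> norm (R \<rho>)" for n
        unfolding real_norm_def abs_mult by (intro AE_I2 mult_left_le_one_le abs_ge_zero satb_bound)
    qed measurable
    then show ?thesis using zero[OF cd] by (simp add: set_lebesgue_integral_def LIMSEQ_const_iff)
  qed
  have "AE \<rho> in lborel. indicator (box a b) \<rho> * R \<rho> = 0"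
  proof (rule AE_zero_of_box_integrals)
    show "integrable lborel (\<lambda>\<rho>. indicator (box a b) \<rho> * R \<rho>)"
      using integrable_mult_indicator[OF _ iR, of "box a b"] by simp
    fix c d :: "real \<times> (real \<times> real)"
    obtain c' d' where cd': "box c d \<inter> box a b = box c' d'" by (rule that[OF box_Int_box])
    have "(LINT \<rho>:box c d|lborel. indicator (box a b) \<rho> * R \<rho>) = (LINT \<rho>:box c' d'|lborel. R \<rho>)"
      unfolding set_lebesgue_integral_def cd'[symmetric] by (intro Bochner_Integration.integral_cong) (auto simp: indicator_def)
    also have "\<dots> = 0" by (rule boxz) (use cd' box_subset_cbox[of a b] in blast)
    finally show "(LINT \<rho>:box c d|lborel. indicator (box a b) \<rho> * R \<rho>) = 0" .
  qed
  then show ?thesis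
  proof eventually_elim
    case (elim \<rho>)
    show ?case
    proof
      assume \<rho>: "\<rho> \<in> box a b"
      then have c: "\<rho> \<in> cbox a b" using box_subset_cbox by blast
      then have "\<rho> \<in> D0" using ab by blast
      from Wt_pos[OF this] show "S1 g (Dtest U0 h) \<rho> + S1 m h \<rho> = 0"
        using elim \<rho> c by (auto simp: R_def distrib_left[symmetric])
    qed
  qed
qed

lemma weak_identity_slices:
  assumes "wD g m" "Hin g" "Hin m" "C1 h"
  shows "AE \<rho> in lborel. \<rho> \<in> D0 \<longrightarrow> S1 g (Dtest U0 h) \<rho> + S1 m h \<rho> = 0"
  by (rule AE_open_of_boxes[OF open_D0 weak_identity_on_box[OF assms]])

text \<open>The moment of order zero says that \<open>m * k\<close> has mean zero, so its primitive
  \<open>N\<close> closes up; the others say that \<open>y - N\<close> is orthogonal to all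
  nonconstant modes, hence constant.\<close>

lemma circ_prim_of_moments:
  assumes k: "continuous_on UNIV k" "\<And>s. k s > (0::real)"
    and y: "set_integrable lborel {-pi..pi} (\<lambda>s. y s * k s)"
    and m: "set_integrable lborel {-pi..pi} (\<lambda>s. m s * k s)"
    and c: "\<And>n::nat. (LINT s:{-pi..pi}|lborel. y s * (- real n * sin (real n * s))) + (LINT s:{-pi..pi}|lborel. m s * k s * cos (real n * s)) = 0"
    and s: "\<And>n::nat. (LINT s:{-pi..pi}|lborel. y s * (real n * cos (real n * s))) + (LINT s:{-pi..pi}|lborel. m s * k s * sin (real n * s)) = 0"
  shows "circ_prim k y m"
proof -
  define N where "N x = (LINT u:{-pi..x}|lborel. m u * k u)" for x
  have m0: "(LINT s:{-pi..pi}|lborel. m s * k s) = 0" using c[of 0] by simp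
  have Npi: "N pi = 0" by (simp add: N_def m0)
  have yi: "set_integrable lborel {-pi..pi} y"
  proof -
    have "set_integrable lborel {-pi..pi} (\<lambda>s. (y s * k s) * (1 / k s))"
      by (intro set_integrable_mult_continuous y continuous_intros continuous_on_subset[OF k(1)]) (auto simp: less_imp_neq[OF k(2), symmetric])
    moreover have "(y s * k s) * (1 / k s) = y s" for s using k(2)[of s] by simp
    ultimately show ?thesis by simp
  qed
  have Nc: "continuous_on {-pi..pi} N" unfolding N_def by (rule primitive_continuous_on[OF m])
  have Ni: "set_integrable lborel {-pi..pi} N" by (rule set_integrable_continuous_Icc[OF Nc])
  have V: "set_integrable lborel {-pi..pi} (\<lambda>s. y s - N s)" by (rule set_integral_diff(1)[OF yi Ni])
  have key: "(LINT s:{-pi..pi}|lborel. (y s - N s) * p' s) = 0"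
    if p: "\<And>x. (p has_real_derivative p' x) (at x)" and p': "continuous_on UNIV p'"
      and e: "(LINT s:{-pi..pi}|lborel. y s * p' s) + (LINT s:{-pi..pi}|lborel. m s * k s * p s) = 0" for p p'
  proof -
    have pc: "continuous_on {-pi..pi} p'" by (rule continuous_on_subset[OF p']) simp
    have "(LINT s:{-pi..pi}|lborel. N s * p' s) = - (LINT s:{-pi..pi}|lborel. m s * k s * p s)"
      using set_integral_primitive_by_parts(1)[OF _ m p pc, of 0] m0 by (simp add: N_def)
    moreover have "(LINT s:{-pi..pi}|lborel. y s * p' s - N s * p' s) = (LINT s:{-pi..pi}|lborel. y s * p' s) - (LINT s:{-pi..pi}|lborel. N s * p' s)"
      by (intro set_integral_diff(2) set_integrable_mult_continuous yi Ni pc)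
    ultimately show ?thesis using e by (simp add: left_diff_distrib)
  qed
  have "\<exists>c. AE s in lborel. s \<in> {-pi..pi} \<longrightarrow> y s - N s = c"
  proof (rule circle_const_of_trig_moments[OF V])
    fix n :: nat assume n: "n \<ge> 1"
    have "(LINT s:{-pi..pi}|lborel. (y s - N s) * (real n * cos (real n * s))) = 0"
      by (rule key[of "\<lambda>s. sin (real n * s)", OF _ _ s]) (auto intro!: derivative_eq_intros continuous_intros)
    then have "real n * (LINT s:{-pi..pi}|lborel. (y s - N s) * cos (real n * s)) = 0"
      by (simp only: set_integral_mult_right[symmetric] mult.left_commute)
    then show "(LINT s:{-pi..pi}|lborel. (y s - N s) * cos (real n * s)) = 0" using n by simp
    have "(LINT s:{-pi..pi}|lborel. (y s - N s) * (- real n * sin (real n * s))) = 0"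
      by (rule key[of "\<lambda>s. cos (real n * s)", OF _ _ c]) (auto intro!: derivative_eq_intros continuous_intros)
    then have "- real n * (LINT s:{-pi..pi}|lborel. (y s - N s) * sin (real n * s)) = 0"
      by (simp only: set_integral_mult_right[symmetric] mult.left_commute)
    then show "(LINT s:{-pi..pi}|lborel. (y s - N s) * sin (real n * s)) = 0" using n by simp
  qed
  then obtain d where "AE s in lborel. s \<in> {-pi..pi} \<longrightarrow> y s - N s = d" by blast
  then have "AE s in lborel. s \<in> {-pi..pi} \<longrightarrow> y s = d + N s" by eventually_elim auto
  then show ?thesis using m m0 by (auto simp: circ_prim_def N_def)
qed

text \<open>A polynomial in \<open>q\<close> and the velocity, hence \<open>C1\<close> even at the
  bottom of the well, and nevertheless a pure mode in the angle on every energy circle.\<close>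

definition hpow :: "complex \<Rightarrow> nat \<Rightarrow> phase \<Rightarrow> real" where
  "hpow c n z = Re (c * Complex (- q (fst z)) (fst (snd z)) ^ n)"

lemma C1_hpow: "C1 (hpow c n)"
proof -
  have "C1 (\<lambda>z::phase. (-1) * q (fst z))" by (intro C1_mult C1_const C1_q)
  from C1_complex_power[OF this C1_velocity] show ?thesis by (simp add: hpow_def[abs_def])
qed

lemma hpow_Zc: "hpow c n (Zc ((e, w), s)) = sqrt (2 * e) ^ n * Re (c * cis s ^ n)"
proof -
  have "Complex (- q (fst (Zc ((e, w), s)))) (fst (snd (Zc ((e, w), s)))) = of_real (sqrt (2 * e)) * cis s"
    by (simp add: Zc_def complex_eq_iff)
  then have "hpow c n (Zc ((e, w), s)) = Re (of_real (sqrt (2 * e) ^ n) * (c * cis s ^ n))"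
    by (simp only: hpow_def power_mult_distrib of_real_power mult.left_commute)
  then show ?thesis by (simp only: times_complex.sel Re_complex_of_real Im_complex_of_real mult_zero_left diff_0_right)
qed

lemma Dtest_hpow:
  "kap e s * Dtest U0 (hpow c n) (Zc ((e, w), s)) = sqrt (2 * e) ^ n * (real n * (- Re c * sin (real n * s) - Im c * cos (real n * s)))"
proof -
  have 1: "((\<lambda>s. hpow c n (Zc ((e, w), s))) has_real_derivative kap e s * Dtest U0 (hpow c n) (Zc ((e, w), s))) (at s)"
    by (rule Dtest_along_orbit[OF C1_hpow])
  have "(\<lambda>s. hpow c n (Zc ((e, w), s))) = (\<lambda>s. sqrt (2 * e) ^ n * (Re c * cos (real n * s) - Im c * sin (real n * s)))"
    unfolding hpow_Zc by (simp add: Complex.DeMoivre)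
  moreover have "((\<lambda>s. sqrt (2 * e) ^ n * (Re c * cos (real n * s) - Im c * sin (real n * s)))
    has_real_derivative sqrt (2 * e) ^ n * (real n * (- Re c * sin (real n * s) - Im c * cos (real n * s)))) (at s)"
    by (auto intro!: derivative_eq_intros simp: algebra_simps)
  ultimately show ?thesis using DERIV_unique[OF 1] by metis
qed

text \<open>Converse of \<open>weakD_of_slices\<close>. Countably many modes are tested, so the
  exceptional orbits form one null set, and on the others the radius factor
  \<open>sqrt (2 * e) ^ n\<close> is positive and cancels.\<close>

lemma slices_of_weakD:
  assumes gm: "wD g m" and g: "Hin g" and m: "Hin m"
  shows "AE \<rho> in lborel. \<rho> \<in> D0 \<longrightarrow> circ_prim (kap (fst \<rho>)) (\<lambda>s. g (Zc (\<rho>, s))) (\<lambda>s. m (Zc (\<rho>, s)))"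
proof -
  have "AE \<rho> in lborel. \<forall>n. \<rho> \<in> D0 \<longrightarrow> S1 g (Dtest U0 (hpow c n)) \<rho> + S1 m (hpow c n) \<rho> = 0" for c
    unfolding AE_all_countable by (intro allI weak_identity_slices gm g m C1_hpow)
  \<comment> \<open>The factor 1 yields the cosine moments and \<open>- i\<close> the sine moments,
    since the real part of \<open>- i * cis (n s)\<close> is \<open>sin (n s)\<close>.\<close>
  from this[of 1] this[of "-\<i>"] slice_L2[OF g] slice_L2[OF m] show ?thesis
  proof eventually_elim
    case (elim \<rho>)
    show ?case
    proof
      assume \<rho>: "\<rho> \<in> D0"
      obtain e w where ew: "\<rho> = (e, w)" by (cases \<rho>)
      have e: "sqrt (2 * e) > 0" using \<rho> by (simp add: D0_def ew)
      have gmeas: "g \<in> borel_measurable borel" "m \<in> borel_measurable borel" using g m by (auto simp: Hin_iff)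
      have S1D: "S1 g (Dtest U0 (hpow c n)) \<rho> = sqrt (2 * e) ^ n * (LINT s:{-pi..pi}|lborel. g (Zc (\<rho>, s)) * (real n * (- Re c * sin (real n * s) - Im c * cos (real n * s))))" for c n
        unfolding S1_def ew fst_conv Dtest_hpow by (rule set_integral_pull_factor(1))
      have S1h: "S1 m (hpow c n) \<rho> = sqrt (2 * e) ^ n * (LINT s:{-pi..pi}|lborel. m (Zc (\<rho>, s)) * kap (fst \<rho>) s * Re (c * cis s ^ n))" for c n
        unfolding S1_def ew fst_conv hpow_Zc by (rule set_integral_pull_factor(2))
      have mom: "(LINT s:{-pi..pi}|lborel. g (Zc (\<rho>, s)) * (real n * (- Re c * sin (real n * s) - Im c * cos (real n * s))))
        + (LINT s:{-pi..pi}|lborel. m (Zc (\<rho>, s)) * kap (fst \<rho>) s * Re (c * cis s ^ n)) = 0" if "c = 1 \<or> c = -\<i>" for c n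
      proof -
        have "S1 g (Dtest U0 (hpow c n)) \<rho> + S1 m (hpow c n) \<rho> = 0" using that elim(1)[rule_format, OF \<rho>, of n] elim(2)[rule_format, OF \<rho>, of n] by (elim disjE) simp_all
        then show ?thesis unfolding S1D S1h using e by (simp only: distrib_left[symmetric]) simp
      qed
      show "circ_prim (kap (fst \<rho>)) (\<lambda>s. g (Zc (\<rho>, s))) (\<lambda>s. m (Zc (\<rho>, s)))"
      proof (rule circ_prim_of_moments)
        show "continuous_on UNIV (kap (fst \<rho>))" by (rule kap_cont)
        show "kap (fst \<rho>) s > 0" for s by (rule kap_pos)
        show "set_integrable lborel {-pi..pi} (\<lambda>s. g (Zc (\<rho>, s)) * kap (fst \<rho>) s)"
          by (rule L1_of_L2[OF elim(3)[rule_format, OF \<rho>] slice_meas[OF gmeas(1)]])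
        show "set_integrable lborel {-pi..pi} (\<lambda>s. m (Zc (\<rho>, s)) * kap (fst \<rho>) s)"
          by (rule L1_of_L2[OF elim(4)[rule_format, OF \<rho>] slice_meas[OF gmeas(2)]])
        fix n :: nat
        show "(LINT s:{-pi..pi}|lborel. g (Zc (\<rho>, s)) * (- real n * sin (real n * s))) + (LINT s:{-pi..pi}|lborel. m (Zc (\<rho>, s)) * kap (fst \<rho>) s * cos (real n * s)) = 0"
          using mom[of 1 n] by (simp add: Complex.DeMoivre)
        show "(LINT s:{-pi..pi}|lborel. g (Zc (\<rho>, s)) * (real n * cos (real n * s))) + (LINT s:{-pi..pi}|lborel. m (Zc (\<rho>, s)) * kap (fst \<rho>) s * sin (real n * s)) = 0"
          using mom[of "-\<i>" n] by (simp add: Complex.DeMoivre)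
      qed
    qed
  qed
qed

end

section \<open>The resolvent\<close>

lemma circ_prim_cong_AE:
  assumes ym: "circ_prim k y m" and y: "AE s in lborel. s \<in> {-pi..pi} \<longrightarrow> y s = y' s"
    and m: "AE s in lborel. s \<in> {-pi..pi} \<longrightarrow> m s = m' s"
    and [measurable]: "m' \<in> borel_measurable borel" "k \<in> borel_measurable borel"
  shows "circ_prim k y' m'"
proof -
  obtain c where c: "AE s in lborel. s \<in> {-pi..pi} \<longrightarrow> y s = c + (LINT u:{-pi..s}|lborel. m u * k u)"
    and mi: "set_integrable lborel {-pi..pi} (\<lambda>s. m s * k s)"
    and m0: "(LINT s:{-pi..pi}|lborel. m s * k s) = 0"
    using ym by (auto simp: circ_prim_def)
  have AEs: "AE u in lborel. indicator {-pi..s} u *\<^sub>R (m u * k u) = indicator {-pi..s} u *\<^sub>R (m' u * k u)"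
    if "s \<in> {-pi..pi}" for s
    using m by eventually_elim (use that in \<open>auto simp: indicator_def\<close>)
  have meas: "(\<lambda>u. indicator {-pi..s} u *\<^sub>R (m' u * k u)) \<in> borel_measurable lborel" for s by measurable
  have mi_s: "set_integrable lborel {-pi..s} (\<lambda>s. m s * k s)" if "s \<in> {-pi..pi}" for s
    using that by (intro set_integrable_subset[OF mi]) auto
  have eq: "(LINT u:{-pi..s}|lborel. m u * k u) = (LINT u:{-pi..s}|lborel. m' u * k u)" if s: "s \<in> {-pi..pi}" for s
    unfolding set_lebesgue_integral_def
    by (rule integral_cong_AE[OF _ meas AEs[OF s]]) (use mi_s[OF s] in \<open>auto simp: set_integrable_def\<close>)
  have "set_integrable lborel {-pi..pi} (\<lambda>s. m' s * k s)"
    using mi AEs[of pi] unfolding set_integrable_def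
    by (subst integrable_cong_AE[OF meas borel_measurable_integrable[OF mi[unfolded set_integrable_def]]])
       (auto elim: eventually_mono)
  moreover have "(LINT s:{-pi..pi}|lborel. m' s * k s) = 0" using eq[of pi] m0 by simp
  moreover have "AE s in lborel. s \<in> {-pi..pi} \<longrightarrow> y' s = c + (LINT u:{-pi..s}|lborel. m' u * k u)"
    using c y by eventually_elim (use eq in auto)
  ultimately show ?thesis by (auto simp: circ_prim_def)
qed

section \<open>Period function and norm estimates orbit by orbit\<close>

context weighted_well begin

definition Tper :: "real \<Rightarrow> real" where "Tper e = (LINT s:{-pi..pi}|lborel. kap e s)"

lemma kap_weight: "circle_weight (kap e)"
  by unfold_locales (auto intro: kap_cont kap_pos)

lemma T_eq_Tper: "circle_weight.T (kap e) = Tper e"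
  by (simp add: circle_weight.T_def[OF kap_weight] circle_weight.t_def[OF kap_weight] Tper_def)

lemma Tper_pos: "Tper e > 0"
  using circle_weight.T_pos[OF kap_weight] by (simp add: T_eq_Tper)

lemma kap_set_integrable: "set_integrable lborel {a..b} (kap e)"
  by (rule set_integrable_continuous_Icc[OF kap_cont])

text \<open>An integral with jointly continuous integrand. Continuity at the bottom and at the top
  energy is what the compactness and approximation arguments below live on.\<close>

lemma Tper_cont: "continuous_on UNIV Tper"
proof -
  have "continuous_on UNIV (\<lambda>e. integral (cbox (-pi) pi) (kap e))"
    by (rule integral_continuous_on_param) (rule continuous_on_subset[OF kap_cont2 subset_UNIV])
  moreover have "integral (cbox (-pi) pi) (kap e) = Tper e" for e
    using set_borel_integral_eq_integral(2)[OF kap_set_integrable] by (simp add: Tper_def)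
  ultimately show ?thesis by simp
qed

text \<open>The moving upper limit is shifted into the integrand, where joint measurability is
  visible.\<close>

lemma clock_meas: "(\<lambda>(e, s). circle_weight.t (kap e) s) \<in> borel_measurable (borel \<Otimes>\<^sub>M borel)"
proof -
  have "(\<lambda>(e, s). LINT u|lborel. (if -pi \<le> u \<and> u \<le> s then kap e u else 0)) \<in> borel_measurable (borel \<Otimes>\<^sub>M borel)"
    by measurable
  moreover have "circle_weight.t (kap e) s = (LINT u|lborel. (if -pi \<le> u \<and> u \<le> s then kap e u else 0))" for e s
    unfolding circle_weight.t_def[OF kap_weight] set_lebesgue_integral_def
    by (intro Bochner_Integration.integral_cong) (auto simp: indicator_def)
  ultimately show ?thesis by simp
qed

lemma clock_meas' [measurable (raw)]:
  "f \<in> borel_measurable M \<Longrightarrow> g \<in> borel_measurable M \<Longrightarrow> (\<lambda>x. circle_weight.t (kap (f x)) (g x)) \<in> borel_measurable M"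
  using measurable_compose[OF _ clock_meas, of "\<lambda>x. (f x, g x)" M] by simp

lemma Tper_meas [measurable]: "Tper \<in> borel_measurable borel"
  by (rule borel_measurable_continuous_onI[OF Tper_cont])

definition rho :: "phase \<Rightarrow> real \<times> (real \<times> real)" where "rho z = (en z, snd (snd z))"
lemma rho_meas [measurable]: "rho \<in> borel \<rightarrow>\<^sub>M borel"
  unfolding rho_def[abs_def]
  by (intro borel_measurable_continuous_onI continuous_intros en_cont)

lemma AE_interior: "AE s in lborel. s \<in> {-pi..pi} \<longrightarrow> s \<in> {-pi<..<pi::real}"
proof -
  have "AE s in lborel. s \<noteq> pi" "AE s in lborel. s \<noteq> - pi" by (simp_all add: AE_lborel_singleton)
  then show ?thesis by eventually_elim auto
qed

lemma kap_section_meas: "kap e \<in> borel_measurable borel"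
  by (rule borel_measurable_continuous_onI[OF kap_cont])

lemma Tper_bound: "\<exists>Tm > 0. \<forall>e\<in>{0..e0}. Tper e \<le> Tm"
proof -
  have "bounded (Tper ` {0..e0})"
    by (intro compact_imp_bounded compact_continuous_image continuous_on_subset[OF Tper_cont]) auto
  then obtain B where B: "\<forall>e\<in>{0..e0}. \<bar>Tper e\<bar> \<le> B" by (auto simp: bounded_iff)
  then have "\<forall>e\<in>{0..e0}. Tper e \<le> max B 1" by fastforce
  then show ?thesis by (intro exI[of _ "max B 1"]) auto
qed

lemma Hsq_alt: "Hsq g = (\<integral>\<^sup>+z. ennreal ((g z)\<^sup>2 * (indicator Om z * wt z)) \<partial>lborel)"
  unfolding Hsq_def by (intro nn_integral_cong) (auto simp: wt_def indicator_def)

lemma Hsq_mono: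
  assumes "\<And>z. z \<in> Om \<Longrightarrow> \<bar>g z\<bar> \<le> c * \<bar>f z\<bar>" and [measurable]: "f \<in> borel_measurable borel" and c: "c \<ge> 0"
  shows "Hsq g \<le> ennreal (c\<^sup>2) * Hsq f"
proof -
  have "Hsq g \<le> (\<integral>\<^sup>+z. ennreal (c\<^sup>2) * ennreal ((f z)\<^sup>2 * (indicator Om z * wt z)) \<partial>lborel)"
    unfolding Hsq_alt
  proof (intro nn_integral_mono)
    fix z
    have nn: "0 \<le> indicator Om z * wt z" by (simp add: wt_def)
    have "(g z)\<^sup>2 * (indicator Om z * wt z) \<le> (c\<^sup>2 * (f z)\<^sup>2) * (indicator Om z * wt z)"
    proof (cases "z \<in> Om")
      case True
      have "\<bar>g z\<bar> \<le> \<bar>c * f z\<bar>" using assms(1)[OF True] c by (simp add: abs_mult)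
      then have "(g z)\<^sup>2 \<le> (c * f z)\<^sup>2" by (simp only: abs_le_square_iff)
      then show ?thesis using nn by (intro mult_right_mono) (auto simp: power_mult_distrib)
    qed simp
    then show "ennreal ((g z)\<^sup>2 * (indicator Om z * wt z)) \<le> ennreal (c\<^sup>2) * ennreal ((f z)\<^sup>2 * (indicator Om z * wt z))"
      by (simp add: ennreal_mult'[symmetric] mult.assoc ennreal_leI)
  qed
  also have "\<dots> = ennreal (c\<^sup>2) * Hsq f"
    unfolding Hsq_alt by (intro nn_integral_cmult) measurable
  finally show ?thesis .
qed

lemma Hin_lin:
  assumes g: "Hin g" and h: "Hin h"
  shows "Hin (\<lambda>z. a * g z + b * h z)"
proof -
  have [measurable]: "g \<in> borel_measurable borel" "h \<in> borel_measurable borel" using g h by (auto simp: Hin_iff)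
  have "Hsq (\<lambda>z. a * g z + b * h z) \<le>
    (\<integral>\<^sup>+z. ennreal (2 * a\<^sup>2) * ennreal ((g z)\<^sup>2 * (indicator Om z * wt z)) + ennreal (2 * b\<^sup>2) * ennreal ((h z)\<^sup>2 * (indicator Om z * wt z)) \<partial>lborel)"
    unfolding Hsq_alt
  proof (intro nn_integral_mono)
    fix z
    have nn: "0 \<le> indicator Om z * wt z" by (simp add: wt_def)
    have "(a * g z + b * h z)\<^sup>2 \<le> 2 * a\<^sup>2 * (g z)\<^sup>2 + 2 * b\<^sup>2 * (h z)\<^sup>2"
      using sum_squares_bound[of "a * g z" "b * h z"] by (simp add: power2_sum power_mult_distrib)
    from mult_right_mono[OF this nn]
    have "(a * g z + b * h z)\<^sup>2 * (indicator Om z * wt z) \<le> 2 * a\<^sup>2 * ((g z)\<^sup>2 * (indicator Om z * wt z)) + 2 * b\<^sup>2 * ((h z)\<^sup>2 * (indicator Om z * wt z))"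
      by (simp add: distrib_right mult.assoc)
    then show "ennreal ((a * g z + b * h z)\<^sup>2 * (indicator Om z * wt z)) \<le>
       ennreal (2 * a\<^sup>2) * ennreal ((g z)\<^sup>2 * (indicator Om z * wt z)) + ennreal (2 * b\<^sup>2) * ennreal ((h z)\<^sup>2 * (indicator Om z * wt z))"
      using nn by (simp add: ennreal_mult'[symmetric] ennreal_plus[symmetric] ennreal_leI del: ennreal_plus)
  qed
  also have "\<dots> = (\<integral>\<^sup>+z. ennreal (2 * a\<^sup>2) * ennreal ((g z)\<^sup>2 * (indicator Om z * wt z)) \<partial>lborel)
      + (\<integral>\<^sup>+z. ennreal (2 * b\<^sup>2) * ennreal ((h z)\<^sup>2 * (indicator Om z * wt z)) \<partial>lborel)"
    by (rule nn_integral_add) measurable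
  also have "\<dots> = ennreal (2 * a\<^sup>2) * Hsq g + ennreal (2 * b\<^sup>2) * Hsq h"
    unfolding Hsq_alt by (intro arg_cong2[where f="(+)"] nn_integral_cmult) measurable
  also have "\<dots> < \<infinity>" using g h by (auto simp: Hin_iff ennreal_mult_less_top)
  finally show ?thesis by (auto simp: Hin_iff)
qed

lemma Hin_cmult: "Hin g \<Longrightarrow> Hin (\<lambda>z. a * g z)"
  using Hin_lin[of g g a 0] by simp

text \<open>With \<open>c\<close> the L1 norm, the square of \<open>T * |f| - c\<close> has
  nonnegative integral; expanding it gives the inequality.\<close>

lemma Cauchy_Schwarz_slice:
  assumes f2: "set_integrable lborel {-pi..pi} (\<lambda>s. (f s)\<^sup>2 * kap e s)" and f[measurable]: "f \<in> borel_measurable borel"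
  shows "(LINT s:{-pi..pi}|lborel. \<bar>f s\<bar> * kap e s)\<^sup>2 \<le> Tper e * (LINT s:{-pi..pi}|lborel. (f s)\<^sup>2 * kap e s)"
proof -
  define c where "c = (LINT s:{-pi..pi}|lborel. \<bar>f s\<bar> * kap e s)"
  define Q where "Q = (LINT s:{-pi..pi}|lborel. (f s)\<^sup>2 * kap e s)"
  define T where "T = Tper e"
  have T: "T > 0" by (simp add: T_def Tper_pos)
  have f1: "set_integrable lborel {-pi..pi} (\<lambda>s. \<bar>f s\<bar> * kap e s)"
    by (rule L1_of_L2) (use f2 in auto)
  have "0 \<le> (LINT s:{-pi..pi}|lborel. (T * \<bar>f s\<bar> - c)\<^sup>2 * kap e s)"
    unfolding set_lebesgue_integral_def by (intro Bochner_Integration.integral_nonneg) (auto simp: less_imp_le[OF kap_pos])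
  also have "(\<lambda>s. (T * \<bar>f s\<bar> - c)\<^sup>2 * kap e s) = (\<lambda>s. T\<^sup>2 * ((f s)\<^sup>2 * kap e s) - 2 * T * c * (\<bar>f s\<bar> * kap e s) + c\<^sup>2 * kap e s)"
    by (auto simp: power2_diff power_mult_distrib algebra_simps)
  also have "(LINT s:{-pi..pi}|lborel. T\<^sup>2 * ((f s)\<^sup>2 * kap e s) - 2 * T * c * (\<bar>f s\<bar> * kap e s) + c\<^sup>2 * kap e s)
    = T\<^sup>2 * Q - 2 * T * c * c + c\<^sup>2 * T"
  proof -
    have i: "set_integrable lborel {-pi..pi} (\<lambda>s. T\<^sup>2 * ((f s)\<^sup>2 * kap e s))"
      "set_integrable lborel {-pi..pi} (\<lambda>s. 2 * T * c * (\<bar>f s\<bar> * kap e s))"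
      "set_integrable lborel {-pi..pi} (\<lambda>s. c\<^sup>2 * kap e s)"
      by (rule set_integrable_mult_right, rule f2 f1 kap_set_integrable)+
    show ?thesis
      unfolding set_integral_add(2)[OF set_integral_diff(1)[OF i(1,2)] i(3)] set_integral_diff(2)[OF i(1,2)]
      by (simp only: set_integral_mult_right Q_def c_def T_def Tper_def)
  qed
  also have "\<dots> = T * (T * Q - c\<^sup>2)" by (simp add: algebra_simps power2_eq_square)
  finally have "c\<^sup>2 \<le> T * Q" using T by (simp add: zero_le_mult_iff)
  then show ?thesis by (simp add: c_def Q_def T_def)
qed

text \<open>A pointwise bound by the L1 norm on the circle costs two factors of the period: one from
  Cauchy-Schwarz, one from integrating the resulting constant in time. Hence the square of
  \<open>Tm\<close>.\<close>

lemma Hsq_le_of_slices: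
  assumes g[measurable]: "g \<in> borel_measurable borel" and f: "Hin f" and M: "M \<ge> 0" and Tm: "\<And>e. e \<in> {0..e0} \<Longrightarrow> Tper e \<le> Tm"
    and b: "AE \<rho> in lborel. \<rho> \<in> D0 \<longrightarrow> (AE s in lborel. s \<in> {-pi..pi} \<longrightarrow>
       \<bar>g (Zc (\<rho>, s))\<bar> \<le> M * (LINT r:{-pi..pi}|lborel. \<bar>f (Zc (\<rho>, r))\<bar> * kap (fst \<rho>) r))"
  shows "Hsq g \<le> ennreal (M\<^sup>2 * Tm\<^sup>2) * Hsq f"
proof -
  have fm[measurable]: "f \<in> borel_measurable borel" using f by (simp add: Hin_iff)
  let ?I = "\<lambda>g \<rho>. \<integral>\<^sup>+s. ennreal ((g (Zc (\<rho>, s)))\<^sup>2 * kap (fst \<rho>) s) * indicator {-pi..pi} s \<partial>lborel"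
  have "Hsq g \<le> (\<integral>\<^sup>+\<rho>. ennreal (M\<^sup>2 * Tm\<^sup>2) * (ennreal (Wt \<rho>) * ?I f \<rho>) \<partial>lborel)"
    unfolding Hsq_slices[OF g]
  proof (rule nn_integral_mono_AE)
    show "AE \<rho> in lborel. ennreal (Wt \<rho>) * ?I g \<rho> \<le> ennreal (M\<^sup>2 * Tm\<^sup>2) * (ennreal (Wt \<rho>) * ?I f \<rho>)"
      using b slice_L2[OF f]
    proof eventually_elim
      case (elim \<rho>)
      show ?case
      proof (cases "\<rho> \<in> D0")
        case True
        define F where "F = (LINT r:{-pi..pi}|lborel. \<bar>f (Zc (\<rho>, r))\<bar> * kap (fst \<rho>) r)"
        define Q where "Q = (LINT s:{-pi..pi}|lborel. (f (Zc (\<rho>, s)))\<^sup>2 * kap (fst \<rho>) s)"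
        have e: "fst \<rho> \<in> {0..e0}" using True by (auto simp: D0_def)
        have L2: "set_integrable lborel {-pi..pi} (\<lambda>s. (f (Zc (\<rho>, s)))\<^sup>2 * kap (fst \<rho>) s)" using elim(2) True by blast
        have Q0: "Q \<ge> 0" unfolding Q_def set_lebesgue_integral_def
          by (intro Bochner_Integration.integral_nonneg) (auto simp: less_imp_le[OF kap_pos])
        have If: "?I f \<rho> = ennreal Q"
        proof -
          have "?I f \<rho> = (\<integral>\<^sup>+s. ennreal (indicator {-pi..pi} s *\<^sub>R ((f (Zc (\<rho>, s)))\<^sup>2 * kap (fst \<rho>) s)) \<partial>lborel)"
            by (intro nn_integral_cong) (auto simp: indicator_def)
          also have "\<dots> = ennreal Q" unfolding Q_def set_lebesgue_integral_def
            by (rule nn_integral_eq_integral) (use L2 in \<open>auto simp: set_integrable_def less_imp_le[OF kap_pos]\<close>)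
          finally show ?thesis .
        qed
        have "?I g \<rho> \<le> (\<integral>\<^sup>+s. ennreal ((M * F)\<^sup>2) * ennreal (indicator {-pi..pi} s *\<^sub>R kap (fst \<rho>) s) \<partial>lborel)"
        proof (rule nn_integral_mono_AE)
          have "AE s in lborel. s \<in> {-pi..pi} \<longrightarrow> \<bar>g (Zc (\<rho>, s))\<bar> \<le> M * F" using elim(1) True by (simp add: F_def)
          then show "AE s in lborel. ennreal ((g (Zc (\<rho>, s)))\<^sup>2 * kap (fst \<rho>) s) * indicator {-pi..pi} s
             \<le> ennreal ((M * F)\<^sup>2) * ennreal (indicator {-pi..pi} s *\<^sub>R kap (fst \<rho>) s)"
          proof eventually_elim
            case (elim s)
            show ?case
            proof (cases "s \<in> {-pi..pi}")
              case True
              have "\<bar>g (Zc (\<rho>, s))\<bar> \<le> \<bar>M * F\<bar>" using elim True by linarith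
              then have "(g (Zc (\<rho>, s)))\<^sup>2 \<le> (M * F)\<^sup>2" by (simp only: abs_le_square_iff)
              then have "(g (Zc (\<rho>, s)))\<^sup>2 * kap (fst \<rho>) s \<le> (M * F)\<^sup>2 * kap (fst \<rho>) s"
                by (rule mult_right_mono) (rule less_imp_le[OF kap_pos])
              then show ?thesis using True by (simp add: ennreal_mult'[symmetric] ennreal_leI)
            qed simp
          qed
        qed
        also have "\<dots> = ennreal ((M * F)\<^sup>2) * (\<integral>\<^sup>+s. ennreal (indicator {-pi..pi} s *\<^sub>R kap (fst \<rho>) s) \<partial>lborel)"
          by (rule nn_integral_cmult) measurable
        also have "(\<integral>\<^sup>+s. ennreal (indicator {-pi..pi} s *\<^sub>R kap (fst \<rho>) s) \<partial>lborel) = ennreal (Tper (fst \<rho>))"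
          unfolding Tper_def set_lebesgue_integral_def
          by (rule nn_integral_eq_integral) (use kap_set_integrable[of "-pi" pi "fst \<rho>"] in \<open>auto simp: set_integrable_def less_imp_le[OF kap_pos]\<close>)
        also have "ennreal ((M * F)\<^sup>2) * ennreal (Tper (fst \<rho>)) = ennreal ((M * F)\<^sup>2 * Tper (fst \<rho>))"
          by (simp add: ennreal_mult')
        also have "\<dots> \<le> ennreal (M\<^sup>2 * Tm\<^sup>2 * Q)"
        proof (rule ennreal_leI)
          have "F\<^sup>2 \<le> Tper (fst \<rho>) * Q"
            unfolding F_def Q_def by (rule Cauchy_Schwarz_slice[OF L2 slice_meas[OF fm]])
          then have "F\<^sup>2 * Tper (fst \<rho>) \<le> (Tper (fst \<rho>) * Q) * Tper (fst \<rho>)"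
            by (rule mult_right_mono) (rule less_imp_le[OF Tper_pos])
          also have "\<dots> = (Tper (fst \<rho>))\<^sup>2 * Q" by (simp add: power2_eq_square)
          also have "\<dots> \<le> Tm\<^sup>2 * Q"
            using Tm[OF e] less_imp_le[OF Tper_pos[of "fst \<rho>"]] by (intro mult_right_mono power_mono Q0) auto
          finally have "M\<^sup>2 * (F\<^sup>2 * Tper (fst \<rho>)) \<le> M\<^sup>2 * (Tm\<^sup>2 * Q)" by (rule mult_left_mono) simp
          then show "(M * F)\<^sup>2 * Tper (fst \<rho>) \<le> M\<^sup>2 * Tm\<^sup>2 * Q" by (simp add: power_mult_distrib mult.assoc)
        qed
        finally have "?I g \<rho> \<le> ennreal (M\<^sup>2 * Tm\<^sup>2) * ?I f \<rho>" unfolding If by (simp add: ennreal_mult')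
        from mult_left_mono[OF this, of "ennreal (Wt \<rho>)"] show ?thesis by (simp add: mult.left_commute)
      qed (simp add: Wt_def)
    qed
  qed
  also have "\<dots> = ennreal (M\<^sup>2 * Tm\<^sup>2) * Hsq f"
    unfolding Hsq_slices[OF fm] by (rule nn_integral_cmult) measurable
  finally show ?thesis .
qed

end

text \<open>Nonresonance is required on the closed energy interval, although orbits in
  \<open>D0\<close> lie strictly inside, because a positive lower bound for
  \<open>|S (Tper e / 2)|\<close> is extracted from it.\<close>

locale well_resolvent = weighted_well +
  fixes C S :: "real \<Rightarrow> real" and lam :: real
  assumes C_deriv: "\<And>u. (C has_real_derivative S u) (at u)"
    and S_deriv: "\<And>u. (S has_real_derivative (- lam * C u)) (at u)"
    and C_even: "\<And>u. C (- u) = C u" and S_odd: "\<And>u. S (- u) = - S u"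
    and C0: "C 0 \<noteq> 0" and lam0: "lam \<noteq> 0"
    and nonres: "\<And>e. e \<in> {0..e0} \<Longrightarrow> S (Tper e / 2) \<noteq> 0"
begin

lemma ck: "circle_kernel (kap e) C S lam"
  by (intro circle_kernel.intro kap_weight circle_kernel_axioms.intro C_deriv S_deriv C_even S_odd C0 lam0)

lemma cn: "e \<in> {0..e0} \<Longrightarrow> circle_nonres (kap e) C S lam"
  by (intro circle_nonres.intro ck circle_nonres_axioms.intro) (simp add: T_eq_Tper nonres)

definition kn :: "real \<Rightarrow> real \<Rightarrow> real \<Rightarrow> real" where "kn e = circle_kernel.kern (kap e) C S"
definition kn1 :: "real \<Rightarrow> real \<Rightarrow> real \<Rightarrow> real" where "kn1 e = circle_kernel.kern1 (kap e) S"
text \<open>The Green solution as one function on phase space, read off from the coordinates of its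
  argument, which makes it jointly measurable. On an orbit it agrees with the slice solution at all
  angles except possibly the ends.\<close>

definition sol :: "(phase \<Rightarrow> real) \<Rightarrow> phase \<Rightarrow> real" where
  "sol f z = (LINT r:{-pi..pi}|lborel. kn (en z) (ang z) r * (f (Zc (rho z, r)) * kap (en z) r))"
definition sol1 :: "(phase \<Rightarrow> real) \<Rightarrow> phase \<Rightarrow> real" where
  "sol1 f z = (LINT r:{-pi..pi}|lborel. kn1 (en z) (ang z) r * (f (Zc (rho z, r)) * kap (en z) r))"

lemma C_cont: "continuous_on A' C" and S_cont: "continuous_on A' S"
  by (rule DERIV_continuous_on, rule DERIV_subset[OF _ subset_UNIV], rule C_deriv S_deriv)+

text \<open>\<open>C\<close> and \<open>S\<close> are bounded on all times that occur, and the
  modulus of the denominator attains a positive minimum on the compact energy interval.\<close>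

lemma kernel_bound: "\<exists>M\<ge>0. \<forall>e\<in>{0..e0}. \<forall>s\<in>{-pi..pi}. \<forall>r\<in>{-pi..pi}. \<bar>kn e s r\<bar> \<le> M \<and> \<bar>kn1 e s r\<bar> \<le> M"
proof -
  obtain Tm where Tm: "Tm > 0" "\<And>e. e \<in> {0..e0} \<Longrightarrow> Tper e \<le> Tm" using Tper_bound by blast
  have "bounded (C ` {-Tm..Tm})" "bounded (S ` {-Tm..Tm})"
    by (intro compact_imp_bounded compact_continuous_image C_cont S_cont; simp)+
  then obtain B1 B2 where B: "\<forall>u\<in>{-Tm..Tm}. \<bar>C u\<bar> \<le> B1" "\<forall>u\<in>{-Tm..Tm}. \<bar>S u\<bar> \<le> B2"
    by (auto simp: bounded_iff)
  define B where "B = max B1 B2"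
  have B': "\<bar>C u\<bar> \<le> B" "\<bar>S u\<bar> \<le> B" if "u \<in> {-Tm..Tm}" for u using B that by (fastforce simp: B_def)+
  have B0: "B \<ge> 0" using B'(1)[of 0] Tm(1) by fastforce
  have "\<exists>d>0. \<forall>e\<in>{0..e0}. d \<le> \<bar>S (Tper e / 2)\<bar>"
  proof -
    have "continuous_on {0..e0} (\<lambda>e. \<bar>S (Tper e / 2)\<bar>)"
      by (intro continuous_intros continuous_on_compose2[OF S_cont[of UNIV]] continuous_on_subset[OF Tper_cont]) auto
    moreover have "{0..e0} \<noteq> {}" using E0_gt by (simp add: e0_def)
    ultimately obtain x where "x \<in> {0..e0}" "\<forall>e\<in>{0..e0}. \<bar>S (Tper x / 2)\<bar> \<le> \<bar>S (Tper e / 2)\<bar>"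
      using continuous_attains_inf[of "{0..e0}"] by blast
    then show ?thesis using nonres[of x] by (intro exI[of _ "\<bar>S (Tper x / 2)\<bar>"]) auto
  qed
  then obtain d where d: "d > 0" "\<And>e. e \<in> {0..e0} \<Longrightarrow> d \<le> \<bar>S (Tper e / 2)\<bar>" by blast
  show ?thesis
  proof (intro exI[of _ "B / (2 * d)"] conjI ballI)
    show "0 \<le> B / (2 * d)" using B0 d by simp
    fix e s r assume e: "e \<in> {0..e0}" and s: "s \<in> {-pi..pi}" and r: "r \<in> {-pi..pi}"
    have M: "\<bar>C u\<bar> \<le> B / (2 * d) * (2 * \<bar>S (circle_weight.T (kap e) / 2)\<bar>) \<and> \<bar>S u\<bar> \<le> B / (2 * d) * (2 * \<bar>S (circle_weight.T (kap e) / 2)\<bar>)"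
      if "\<bar>u\<bar> \<le> circle_weight.T (kap e) / 2" for u
    proof -
      have u: "u \<in> {-Tm..Tm}" using that Tm(2)[OF e] Tm(1) by (auto simp: T_eq_Tper abs_le_iff)
      have "B = B / (2 * d) * (2 * d)" using d by simp
      also have "\<dots> \<le> B / (2 * d) * (2 * \<bar>S (Tper e / 2)\<bar>)" using d(1) d(2)[OF e] B0 by (intro mult_left_mono) auto
      finally show ?thesis using B'[OF u] unfolding T_eq_Tper by linarith
    qed
    show "\<bar>kn e s r\<bar> \<le> B / (2 * d)" "\<bar>kn1 e s r\<bar> \<le> B / (2 * d)"
      unfolding kn_def kn1_def using circle_nonres.kern_bounds[OF cn[OF e] M s r] by auto
  qed
qed

lemma C_meas [measurable]: "C \<in> borel_measurable borel" and S_meas [measurable]: "S \<in> borel_measurable borel"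
  by (rule borel_measurable_continuous_onI[OF C_cont], rule borel_measurable_continuous_onI[OF S_cont])

lemma kn_meas' [measurable (raw)]:
  assumes [measurable]: "f \<in> borel_measurable M" "g \<in> borel_measurable M" "h \<in> borel_measurable M"
  shows "(\<lambda>x. kn (f x) (g x) (h x)) \<in> borel_measurable M" "(\<lambda>x. kn1 (f x) (g x) (h x)) \<in> borel_measurable M"
  unfolding kn_def kn1_def circle_kernel.kern_def[OF ck] circle_kernel.kern1_def[OF ck]
    circle_kernel.G_def[OF ck] circle_kernel.G1_def[OF ck] T_eq_Tper
  by measurable

lemma sol_meas:
  assumes [measurable]: "f \<in> borel_measurable borel"
  shows "sol f \<in> borel_measurable borel" "sol1 f \<in> borel_measurable borel"
  unfolding sol_def[abs_def] sol1_def[abs_def] set_lebesgue_integral_def by measurable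

lemma sol_slice:
  assumes \<rho>: "\<rho> \<in> D0" and s: "s \<in> {-pi<..<pi}"
  shows "sol f (Zc (\<rho>, s)) = circle_kernel.solution (kap (fst \<rho>)) C S (\<lambda>r. f (Zc (\<rho>, r))) s"
    "sol1 f (Zc (\<rho>, s)) = circle_kernel.solution1 (kap (fst \<rho>)) S (\<lambda>r. f (Zc (\<rho>, r))) s"
proof -
  obtain e w where ew: "\<rho> = (e, w)" by (cases \<rho>)
  have e: "e > 0" using \<rho> by (simp add: D0_def ew)
  have "en (Zc (\<rho>, s)) = fst \<rho>" "rho (Zc (\<rho>, s)) = \<rho>" "ang (Zc (\<rho>, s)) = s"
    using Zc_en[of e w s] Zc_ang[OF e s, of w] Zc_w[of e w s] e by (simp_all add: ew rho_def)
  then show "sol f (Zc (\<rho>, s)) = circle_kernel.solution (kap (fst \<rho>)) C S (\<lambda>r. f (Zc (\<rho>, r))) s"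
    "sol1 f (Zc (\<rho>, s)) = circle_kernel.solution1 (kap (fst \<rho>)) S (\<lambda>r. f (Zc (\<rho>, r))) s"
    by (simp_all add: sol_def sol1_def circle_kernel.solution_def[OF ck] circle_kernel.solution1_def[OF ck] kn_def kn1_def)
qed

lemma slice_L1:
  assumes f: "Hin f"
  shows "AE \<rho> in lborel. \<rho> \<in> D0 \<longrightarrow> set_integrable lborel {-pi..pi} (\<lambda>s. f (Zc (\<rho>, s)) * kap (fst \<rho>) s)"
  using slice_L2[OF f]
proof eventually_elim
  case (elim \<rho>)
  have "f \<in> borel_measurable borel" using f by (simp add: Hin_iff)
  then show ?case using L1_of_L2[OF _ slice_meas] elim by blast
qed

lemma solution_slice_bound:
  assumes M: "\<forall>e\<in>{0..e0}. \<forall>s\<in>{-pi..pi}. \<forall>r\<in>{-pi..pi}. \<bar>kn e s r\<bar> \<le> M \<and> \<bar>kn1 e s r\<bar> \<le> M"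
    and \<rho>: "\<rho> \<in> D0" and s: "s \<in> {-pi..pi}" and f: "set_integrable lborel {-pi..pi} (\<lambda>s. f s * kap (fst \<rho>) s)"
  shows "\<bar>circle_kernel.solution (kap (fst \<rho>)) C S f s\<bar> \<le> M * (LINT r:{-pi..pi}|lborel. \<bar>f r\<bar> * kap (fst \<rho>) r)"
    "\<bar>circle_kernel.solution1 (kap (fst \<rho>)) S f s\<bar> \<le> M * (LINT r:{-pi..pi}|lborel. \<bar>f r\<bar> * kap (fst \<rho>) r)"
proof -
  have e: "fst \<rho> \<in> {0..e0}" using \<rho> by (auto simp: D0_def)
  show "\<bar>circle_kernel.solution (kap (fst \<rho>)) C S f s\<bar> \<le> M * (LINT r:{-pi..pi}|lborel. \<bar>f r\<bar> * kap (fst \<rho>) r)"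
    "\<bar>circle_kernel.solution1 (kap (fst \<rho>)) S f s\<bar> \<le> M * (LINT r:{-pi..pi}|lborel. \<bar>f r\<bar> * kap (fst \<rho>) r)"
    using circle_nonres.solution_bound[OF cn[OF e] _ _ f s, of M] M e unfolding kn_def kn1_def by auto
qed

lemma sol_Hin:
  assumes f: "Hin f"
  shows "Hin (sol f)" "Hin (sol1 f)"
proof -
  have fm: "f \<in> borel_measurable borel" using f by (simp add: Hin_iff)
  obtain Tm where Tm: "\<And>e. e \<in> {0..e0} \<Longrightarrow> Tper e \<le> Tm" using Tper_bound by blast
  obtain M where M: "M \<ge> 0" "\<forall>e\<in>{0..e0}. \<forall>s\<in>{-pi..pi}. \<forall>r\<in>{-pi..pi}. \<bar>kn e s r\<bar> \<le> M \<and> \<bar>kn1 e s r\<bar> \<le> M"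
    using kernel_bound by blast
  have b: "AE \<rho> in lborel. \<rho> \<in> D0 \<longrightarrow> (AE s in lborel. s \<in> {-pi..pi} \<longrightarrow>
       \<bar>sol f (Zc (\<rho>, s))\<bar> \<le> M * (LINT r:{-pi..pi}|lborel. \<bar>f (Zc (\<rho>, r))\<bar> * kap (fst \<rho>) r) \<and>
       \<bar>sol1 f (Zc (\<rho>, s))\<bar> \<le> M * (LINT r:{-pi..pi}|lborel. \<bar>f (Zc (\<rho>, r))\<bar> * kap (fst \<rho>) r))"
    using slice_L1[OF f]
  proof eventually_elim
    case (elim \<rho>)
    show ?case
    proof
      assume \<rho>: "\<rho> \<in> D0"
      note f1 = elim[rule_format, OF \<rho>]
      show "AE s in lborel. s \<in> {-pi..pi} \<longrightarrow>
       \<bar>sol f (Zc (\<rho>, s))\<bar> \<le> M * (LINT r:{-pi..pi}|lborel. \<bar>f (Zc (\<rho>, r))\<bar> * kap (fst \<rho>) r) \<and>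
       \<bar>sol1 f (Zc (\<rho>, s))\<bar> \<le> M * (LINT r:{-pi..pi}|lborel. \<bar>f (Zc (\<rho>, r))\<bar> * kap (fst \<rho>) r)"
        using AE_interior
      proof eventually_elim
        case (elim s)
        show ?case
        proof
          assume s: "s \<in> {-pi..pi}"
          then have "s \<in> {-pi<..<pi}" using elim by blast
          note sl = sol_slice[OF \<rho> this, of f]
          show "\<bar>sol f (Zc (\<rho>, s))\<bar> \<le> M * (LINT r:{-pi..pi}|lborel. \<bar>f (Zc (\<rho>, r))\<bar> * kap (fst \<rho>) r) \<and>
            \<bar>sol1 f (Zc (\<rho>, s))\<bar> \<le> M * (LINT r:{-pi..pi}|lborel. \<bar>f (Zc (\<rho>, r))\<bar> * kap (fst \<rho>) r)"
            unfolding sl by (rule conjI[OF solution_slice_bound[OF M(2) \<rho> s f1]])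
        qed
      qed
    qed
  qed
  have fin: "ennreal (M\<^sup>2 * Tm\<^sup>2) * Hsq f < \<infinity>" using f by (simp add: Hin_iff ennreal_mult_less_top)
  have "Hsq (sol f) \<le> ennreal (M\<^sup>2 * Tm\<^sup>2) * Hsq f"
  proof (rule Hsq_le_of_slices[OF sol_meas(1)[OF fm] f M(1) Tm])
    show "AE \<rho> in lborel. \<rho> \<in> D0 \<longrightarrow> (AE s in lborel. s \<in> {-pi..pi} \<longrightarrow>
       \<bar>sol f (Zc (\<rho>, s))\<bar> \<le> M * (LINT r:{-pi..pi}|lborel. \<bar>f (Zc (\<rho>, r))\<bar> * kap (fst \<rho>) r))"
      using b by eventually_elim (auto elim: eventually_mono)
  qed
  then show "Hin (sol f)" using fin sol_meas(1)[OF fm] unfolding Hin_iff using order_le_less_trans by blast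
  have "Hsq (sol1 f) \<le> ennreal (M\<^sup>2 * Tm\<^sup>2) * Hsq f"
  proof (rule Hsq_le_of_slices[OF sol_meas(2)[OF fm] f M(1) Tm])
    show "AE \<rho> in lborel. \<rho> \<in> D0 \<longrightarrow> (AE s in lborel. s \<in> {-pi..pi} \<longrightarrow>
       \<bar>sol1 f (Zc (\<rho>, s))\<bar> \<le> M * (LINT r:{-pi..pi}|lborel. \<bar>f (Zc (\<rho>, r))\<bar> * kap (fst \<rho>) r))"
      using b by eventually_elim (auto elim: eventually_mono)
  qed
  then show "Hin (sol1 f)" using fin sol_meas(2)[OF fm] unfolding Hin_iff using order_le_less_trans by blast
qed

lemma sol_Aop:
  assumes f: "Hin f"
  shows "Aop alpha beta U0 (sol f) (\<lambda>z. lam * sol f z + f z)"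
  unfolding Aop_def
proof (intro conjI exI[of _ "sol1 f"])
  have fm: "f \<in> borel_measurable borel" using f by (simp add: Hin_iff)
  show hs: "Hin (sol f)" "Hin (sol1 f)" by (rule sol_Hin[OF f])+
  show hh: "Hin (\<lambda>z. lam * sol f z + f z)" using Hin_lin[OF hs(1) f, of lam 1] by simp
  have hm: "Hin (\<lambda>z. - (lam * sol f z + f z))" using Hin_cmult[OF hh, of "-1"] by simp
  have sl: "AE s in lborel. s \<in> {-pi..pi} \<longrightarrow> sol f (Zc (\<rho>, s)) = circle_kernel.solution (kap (fst \<rho>)) C S (\<lambda>r. f (Zc (\<rho>, r))) s
      \<and> sol1 f (Zc (\<rho>, s)) = circle_kernel.solution1 (kap (fst \<rho>)) S (\<lambda>r. f (Zc (\<rho>, r))) s" if "\<rho> \<in> D0" for \<rho>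
    using AE_interior by eventually_elim (use sol_slice[OF that] in blast)
  have km: "kap e \<in> borel_measurable borel" for e by (rule kap_section_meas)
  show "wD (sol f) (sol1 f)"
  proof (rule weakD_of_slices[OF hs])
    show "AE \<rho> in lborel. \<rho> \<in> D0 \<longrightarrow> circ_prim (kap (fst \<rho>)) (\<lambda>s. sol f (Zc (\<rho>, s))) (\<lambda>s. sol1 f (Zc (\<rho>, s)))"
      using slice_L1[OF f]
    proof eventually_elim
      case (elim \<rho>)
      show ?case
      proof
        assume \<rho>: "\<rho> \<in> D0"
        then have e: "fst \<rho> \<in> {0..e0}" by (auto simp: D0_def)
        show "circ_prim (kap (fst \<rho>)) (\<lambda>s. sol f (Zc (\<rho>, s))) (\<lambda>s. sol1 f (Zc (\<rho>, s)))"
        proof (rule circ_prim_cong_AE[OF circle_nonres.solution_circ_prim[OF cn[OF e] elim[rule_format, OF \<rho>]]])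
        qed (use sl[OF \<rho>] km slice_meas[OF sol_meas(2)[OF fm]] in \<open>auto elim: eventually_mono\<close>)
      qed
    qed
  qed
  show "wD (sol1 f) (\<lambda>z. - (lam * sol f z + f z))"
  proof (rule weakD_of_slices[OF hs(2) hm])
    show "AE \<rho> in lborel. \<rho> \<in> D0 \<longrightarrow> circ_prim (kap (fst \<rho>)) (\<lambda>s. sol1 f (Zc (\<rho>, s))) (\<lambda>s. - (lam * sol f (Zc (\<rho>, s)) + f (Zc (\<rho>, s))))"
      using slice_L1[OF f]
    proof eventually_elim
      case (elim \<rho>)
      show ?case
      proof
        assume \<rho>: "\<rho> \<in> D0"
        then have e: "fst \<rho> \<in> {0..e0}" by (auto simp: D0_def)
        have "(\<lambda>z. - (lam * sol f z + f z)) \<in> borel_measurable borel" using hm by (simp add: Hin_iff)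
        note m = slice_meas[OF this, of \<rho>]
        show "circ_prim (kap (fst \<rho>)) (\<lambda>s. sol1 f (Zc (\<rho>, s))) (\<lambda>s. - (lam * sol f (Zc (\<rho>, s)) + f (Zc (\<rho>, s))))"
        proof (rule circ_prim_cong_AE[OF circle_nonres.solution1_circ_prim[OF cn[OF e] elim[rule_format, OF \<rho>]]])
        qed (use sl[OF \<rho>] km m in \<open>auto elim: eventually_mono\<close>)
      qed
    qed
  qed
qed

text \<open>On almost every orbit an element of the domain is the Green solution of its own
  residual, so the bound for the kernel bounds it as well.\<close>

lemma resolvent_estimate:
  "\<exists>c. \<forall>g h. Aop alpha beta U0 g h \<longrightarrow> Hnorm g \<le> c * Hnorm (\<lambda>z. h z - lam * g z)"
proof -
  obtain Tm where Tm: "\<And>e. e \<in> {0..e0} \<Longrightarrow> Tper e \<le> Tm" using Tper_bound by blast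
  obtain M where M: "M \<ge> 0" "\<forall>e\<in>{0..e0}. \<forall>s\<in>{-pi..pi}. \<forall>r\<in>{-pi..pi}. \<bar>kn e s r\<bar> \<le> M \<and> \<bar>kn1 e s r\<bar> \<le> M"
    using kernel_bound by blast
  have "Hnorm g \<le> sqrt (M\<^sup>2 * Tm\<^sup>2) * Hnorm (\<lambda>z. h z - lam * g z)" if A: "Aop alpha beta U0 g h" for g h
  proof -
    obtain \<mu> where g: "Hin g" and h: "Hin h" and \<mu>: "Hin \<mu>" and w: "wD g \<mu>" "wD \<mu> (\<lambda>z. - h z)"
      using A by (auto simp: Aop_def)
    have hm: "Hin (\<lambda>z. - h z)" using Hin_cmult[OF h, of "-1"] by simp
    define f where "f z = h z - lam * g z" for z
    have f: "Hin f" using Hin_lin[OF h g, of 1 "- lam"] by (simp add: f_def[abs_def])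
    have gm: "g \<in> borel_measurable borel" and fm: "f \<in> borel_measurable borel" using g f by (auto simp: Hin_iff)
    have "Hsq g \<le> ennreal (M\<^sup>2 * Tm\<^sup>2) * Hsq f"
    proof (rule Hsq_le_of_slices[OF gm f M(1) Tm])
      show "AE \<rho> in lborel. \<rho> \<in> D0 \<longrightarrow> (AE s in lborel. s \<in> {-pi..pi} \<longrightarrow>
        \<bar>g (Zc (\<rho>, s))\<bar> \<le> M * (LINT r:{-pi..pi}|lborel. \<bar>f (Zc (\<rho>, r))\<bar> * kap (fst \<rho>) r))"
        using slices_of_weakD[OF w(1) g \<mu>] slices_of_weakD[OF w(2) \<mu> hm] slice_L1[OF f]
      proof eventually_elim
        case (elim \<rho>)
        show ?case
        proof
          assume \<rho>: "\<rho> \<in> D0"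
          then have e: "fst \<rho> \<in> {0..e0}" by (auto simp: D0_def)
          have f1: "set_integrable lborel {-pi..pi} (\<lambda>s. f (Zc (\<rho>, s)) * kap (fst \<rho>) s)"
            using elim(3) \<rho> by blast
          have "AE s in lborel. s \<in> {-pi..pi} \<longrightarrow> g (Zc (\<rho>, s)) = circle_kernel.solution (kap (fst \<rho>)) C S (\<lambda>s. f (Zc (\<rho>, s))) s"
            using circle_nonres.representation[OF cn[OF e] elim(1)[rule_format, OF \<rho>] elim(2)[rule_format, OF \<rho>] f1[unfolded f_def]]
            by (simp only: f_def)
          then show "AE s in lborel. s \<in> {-pi..pi} \<longrightarrow>
            \<bar>g (Zc (\<rho>, s))\<bar> \<le> M * (LINT r:{-pi..pi}|lborel. \<bar>f (Zc (\<rho>, r))\<bar> * kap (fst \<rho>) r)"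
            by eventually_elim (use solution_slice_bound(1)[OF M(2) \<rho> _ f1] in auto)
        qed
      qed
    qed
    then have "enn2real (Hsq g) \<le> enn2real (ennreal (M\<^sup>2 * Tm\<^sup>2) * Hsq f)"
      using f by (intro enn2real_mono) (auto simp: Hin_iff ennreal_mult_less_top)
    also have "\<dots> = M\<^sup>2 * Tm\<^sup>2 * enn2real (Hsq f)" by (simp add: enn2real_mult)
    finally show ?thesis unfolding Hnorm_eq[OF gm] f_def[abs_def, symmetric] Hnorm_eq[OF fm]
      by (simp only: real_sqrt_mult[symmetric] real_sqrt_le_iff)
  qed
  then show ?thesis by blast
qed

theorem resolvent: "lam \<notin> spectrumA alpha beta U0"
proof -
  obtain c where c: "\<forall>g h. Aop alpha beta U0 g h \<longrightarrow> Hnorm g \<le> c * Hnorm (\<lambda>z. h z - lam * g z)"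
    using resolvent_estimate by blast
  have "\<exists>g h. Aop alpha beta U0 g h \<and> Hnorm (\<lambda>z. h z - lam * g z - f z) = 0" if "Hin f" for f
    by (intro exI[of _ "sol f"] exI[of _ "\<lambda>z. lam * sol f z + f z"] conjI sol_Aop that) (simp add: normH_def)
  then show ?thesis using c unfolding spectrumA_def by blast
qed

end

section \<open>Resonances and multiplicity\<close>

text \<open>More unknowns than equations. In the induction on the equations a pivot \<open>p\<close>
  of the new equation \<open>x\<close> is eliminated from the others and recovered by back
  substitution.\<close>

lemma exists_linear_relation:
  fixes c :: "'i \<Rightarrow> 'e \<Rightarrow> real"
  assumes "finite F" "finite I" "card F < card I"
  shows "\<exists>a. (\<exists>i\<in>I. a i \<noteq> 0) \<and> (\<forall>e\<in>F. (\<Sum>i\<in>I. a i * c i e) = 0)"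
  using assms
proof (induction F arbitrary: I c rule: finite_induct)
  case empty
  then have "I \<noteq> {}" by auto
  then show ?case by (intro exI[of _ "\<lambda>_. 1"]) auto
next
  case (insert x F)
  show ?case
  proof (cases "\<forall>i\<in>I. c i x = 0")
    case True
    have "card F < card I" using insert by simp
    then obtain a where "\<exists>i\<in>I. a i \<noteq> 0" "\<forall>e\<in>F. (\<Sum>i\<in>I. a i * c i e) = 0"
      using insert.IH[OF insert.prems(1)] by blast
    then show ?thesis using True by (intro exI[of _ a]) simp
  next
    case False
    then obtain p where p: "p \<in> I" "c p x \<noteq> 0" by blast
    define I' where "I' = I - {p}"
    have I': "finite I'" "card F < card I'" using insert p by (auto simp: I'_def card_Diff_singleton)
    obtain b where b: "\<exists>i\<in>I'. b i \<noteq> 0" "\<forall>e\<in>F. (\<Sum>i\<in>I'. b i * (c i e - c i x / c p x * c p e)) = 0"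
      using insert.IH[OF I', of "\<lambda>i e. c i e - c i x / c p x * c p e"] by blast
    define a where "a i = (if i = p then - (\<Sum>i\<in>I'. b i * (c i x / c p x)) else b i)" for i
    have eq: "(\<Sum>i\<in>I. a i * c i e) = (\<Sum>i\<in>I'. b i * (c i e - c i x / c p x * c p e))" for e
    proof -
      have "(\<Sum>i\<in>I. a i * c i e) = a p * c p e + (\<Sum>i\<in>I'. a i * c i e)"
        unfolding I'_def by (rule sum.remove[OF insert.prems(1) p(1)])
      also have "(\<Sum>i\<in>I'. a i * c i e) = (\<Sum>i\<in>I'. b i * c i e)"
        by (intro sum.cong) (auto simp: a_def I'_def)
      finally show ?thesis
        by (simp add: a_def right_diff_distrib sum_subtractf sum_distrib_right mult.assoc)
    qed
    show ?thesis
    proof (intro exI[of _ a] conjI ballI)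
      show "\<exists>i\<in>I. a i \<noteq> 0" using b(1) by (auto simp: a_def I'_def)
      fix e assume "e \<in> insert x F"
      then show "(\<Sum>i\<in>I. a i * c i e) = 0" unfolding eq using b(2) p(2) by auto
    qed
  qed
qed

text \<open>The polynomial has finitely many roots, so its zero set in phase space is a finite union
  of hyperplanes.\<close>

lemma AE_phase_polynomial_nonzero:
  fixes a :: "nat \<Rightarrow> real"
  assumes "i \<le> n" "a i \<noteq> 0"
  shows "AE z in (lborel :: phase measure). (\<Sum>j\<le>n. a j * fst (snd (snd z)) ^ j) \<noteq> 0"
proof -
  define R where "R = {x. (\<Sum>j\<le>n. a j * x ^ j) = 0}"
  have R: "finite R" unfolding R_def using polyfun_finite_roots[where c=a and n=n] assms by blast
  have b: "((0, 0, 1, 0) :: phase) \<in> Basis" by (simp add: Basis_prod_def zero_prod_def)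
  have "AE z in (lborel :: phase measure). \<forall>x\<in>R. fst (snd (snd z)) \<noteq> x"
  proof (subst AE_finite_all[OF R], intro ballI)
    fix x
    have "negligible {z :: phase. z \<bullet> (0, 0, 1, 0) = x}" by (rule negligible_standard_hyperplane[OF b])
    then have neg: "negligible {z :: phase. fst (snd (snd z)) = x}" by (simp add: inner_prod_def)
    have "closed {z :: phase. fst (snd (snd z)) = x}" by (intro closed_Collect_eq continuous_intros)
    then have "{z :: phase. fst (snd (snd z)) = x} \<in> sets borel" by (rule borel_closed)
    then have "{z :: phase. fst (snd (snd z)) = x} \<in> null_sets lborel"
      using neg by (simp add: negligible_iff_null_sets null_sets_completion_iff)
    from AE_not_in[OF this] show "AE z in (lborel :: phase measure). fst (snd (snd z)) \<noteq> x" by simp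
  qed
  then show ?thesis by eventually_elim (auto simp: R_def)
qed

context weighted_well begin

lemma Hnorm_zero_iff:
  assumes d: "Hin d"
  shows "Hnorm d = 0 \<longleftrightarrow> (AE z in lborel. z \<in> Om \<longrightarrow> d z = 0)"
proof -
  have [measurable]: "d \<in> borel_measurable borel" using d by (simp add: Hin_iff)
  have "Hnorm d = 0 \<longleftrightarrow> Hsq d = 0"
  proof -
    have "Hsq d \<noteq> top" using d by (auto simp: Hin_iff)
    then show ?thesis by (simp add: Hnorm_eq enn2real_eq_0_iff)
  qed
  also have "\<dots> \<longleftrightarrow> (AE z in lborel. ennreal ((d z)\<^sup>2 * (indicator Om z * wt z)) = 0)"
    unfolding Hsq_alt by (rule nn_integral_0_iff_AE) measurable
  also have "\<dots> \<longleftrightarrow> (AE z in lborel. z \<in> Om \<longrightarrow> d z = 0)"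
  proof (intro AE_cong)
    fix z
    show "ennreal ((d z)\<^sup>2 * (indicator Om z * wt z)) = 0 \<longleftrightarrow> (z \<in> Om \<longrightarrow> d z = 0)"
      using wt_pos[of z] by (cases "z \<in> Om") (auto simp: ennreal_eq_0_iff mult_le_0_iff)
  qed
  finally show ?thesis .
qed

lemma Hin_bounded_mult:
  assumes g: "Hin g" and [measurable]: "p \<in> borel_measurable borel" and b: "\<And>z. z \<in> Om \<Longrightarrow> \<bar>p z\<bar> \<le> B"
  shows "Hin (\<lambda>z. p z * g z)"
proof -
  have gm[measurable]: "g \<in> borel_measurable borel" using g by (simp add: Hin_iff)
  have "Hsq (\<lambda>z. p z * g z) \<le> ennreal (\<bar>B\<bar>\<^sup>2) * Hsq g"
  proof (rule Hsq_mono[OF _ gm])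
    fix z assume "z \<in> Om"
    then have "\<bar>p z\<bar> \<le> \<bar>B\<bar>" using b[of z] by linarith
    then show "\<bar>p z * g z\<bar> \<le> \<bar>B\<bar> * \<bar>g z\<bar>" unfolding abs_mult by (rule mult_right_mono) simp
  qed simp
  also have "\<dots> < \<infinity>" using g by (simp add: Hin_iff ennreal_mult_less_top)
  finally show ?thesis by (simp add: Hin_iff)
qed

text \<open>The operator commutes with multiplication by functions of the transversal velocity, because
  trajectories stay in a fixed fibre; this is what makes every eigenvalue infinitely degenerate.\<close>

lemma weakD_mult_w:
  assumes gm: "wD g m" and g: "Hin g" and m: "Hin m"
    and p[measurable]: "p \<in> borel_measurable borel" and b: "\<And>z. z \<in> Om \<Longrightarrow> \<bar>p (snd (snd z))\<bar> \<le> B"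
    and p': "(\<lambda>z::phase. p (snd (snd z))) \<in> borel_measurable borel"
  shows "wD (\<lambda>z. p (snd (snd z)) * g z) (\<lambda>z. p (snd (snd z)) * m z)"
proof (rule weakD_of_slices[OF Hin_bounded_mult[OF g p' b] Hin_bounded_mult[OF m p' b]])
  show "AE \<rho> in lborel. \<rho> \<in> D0 \<longrightarrow> circ_prim (kap (fst \<rho>)) (\<lambda>s. p (snd (snd (Zc (\<rho>, s)))) * g (Zc (\<rho>, s))) (\<lambda>s. p (snd (snd (Zc (\<rho>, s)))) * m (Zc (\<rho>, s)))"
    using slices_of_weakD[OF gm g m]
  proof eventually_elim
    case (elim \<rho>)
    have "snd (snd (Zc (\<rho>, s))) = snd \<rho>" for s using Zc_w[of "fst \<rho>" "snd \<rho>" s] by simp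
    then show ?case using elim by (auto intro: circ_prim_cmult)
  qed
qed

lemma Hin_sum: "finite I \<Longrightarrow> (\<And>i. i \<in> I \<Longrightarrow> Hin (f i)) \<Longrightarrow> Hin (\<lambda>z. \<Sum>i\<in>I. a i * f i z)"
proof (induction I rule: finite_induct)
  case empty
  show ?case by (simp add: Hin_iff Hsq_def)
next
  case (insert i I)
  have 1: "Hin (f i)" and 2: "Hin (\<lambda>z. \<Sum>i\<in>I. a i * f i z)" using insert by auto
  show ?case using Hin_lin[OF 1 2, of "a i" 1] insert by simp
qed

text \<open>Powers of the first transversal velocity times \<open>g\<close> are again
  eigenfunctions. If \<open>F\<close> spanned them all, a nontrivial polynomial in that velocity
  times \<open>g\<close> would vanish, and the polynomial is zero only on a null set.\<close>

lemma no_finite_eigenvalue: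
  assumes ev: "is_eigenvalue alpha beta U0 lam" and fin: "finite_multiplicity alpha beta U0 lam"
  shows False
proof -
  obtain g where gA: "Aop alpha beta U0 g (\<lambda>z. lam * g z)" and gn: "Hnorm g \<noteq> 0"
    using ev by (auto simp: is_eigenvalue_def)
  obtain F where F: "finite F" "\<forall>e\<in>F. Aop alpha beta U0 e (\<lambda>z. lam * e z)"
    "\<forall>g. Aop alpha beta U0 g (\<lambda>z. lam * g z) \<longrightarrow> (\<exists>c. Hnorm (\<lambda>z. g z - (\<Sum>e\<in>F. c e * e z)) = 0)"
    using fin unfolding finite_multiplicity_def by (elim exE conjE)
  obtain \<mu> where g: "Hin g" and \<mu>: "Hin \<mu>" and w1: "wD g \<mu>" and w2: "wD \<mu> (\<lambda>z. - (lam * g z))"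
    using gA by (auto simp: Aop_def)
  have hm: "Hin (\<lambda>z. - (lam * g z))" using Hin_cmult[OF g, of "- lam"] by simp
  \<comment> \<open>Bounded support of \<open>beta\<close> bounds the transversal velocity on the
    domain, so its powers are bounded multipliers.\<close>
  obtain B where B: "\<And>w. beta w \<noteq> 0 \<Longrightarrow> norm w \<le> B" using beta_bdd by (auto simp: bounded_iff)
  define p where "p j w = fst w ^ j" for j :: nat and w :: "real \<times> real"
  have pb: "\<bar>p j (snd (snd z))\<bar> \<le> B ^ j" if "z \<in> Om" for j z
  proof -
    have "\<bar>fst (snd (snd z))\<bar> \<le> norm (snd (snd z))" using norm_fst_le[of "fst (snd (snd z))" "snd (snd (snd z))"] by simp
    also have "\<dots> \<le> B" using that by (intro B) (auto simp: Om_eq)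
    finally show ?thesis by (simp add: p_def power_abs power_mono)
  qed
  have pm: "p j \<in> borel_measurable borel" "(\<lambda>z::phase. p j (snd (snd z))) \<in> borel_measurable borel" for j
    unfolding p_def[abs_def] by (intro borel_measurable_continuous_onI continuous_intros)+
  define gj where "gj j z = p j (snd (snd z)) * g z" for j z
  have gjH: "Hin (gj j)" for j unfolding gj_def[abs_def] by (rule Hin_bounded_mult[OF g pm(2) pb])
  have gjA: "Aop alpha beta U0 (gj j) (\<lambda>z. lam * gj j z)" for j
    unfolding Aop_def
  proof (intro conjI exI[of _ "\<lambda>z. p j (snd (snd z)) * \<mu> z"])
    show "Hin (gj j)" "Hin (\<lambda>z. lam * gj j z)" by (rule gjH, rule Hin_cmult[OF gjH])
    show "Hin (\<lambda>z. p j (snd (snd z)) * \<mu> z)" by (rule Hin_bounded_mult[OF \<mu> pm(2) pb])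
    show "wD (gj j) (\<lambda>z. p j (snd (snd z)) * \<mu> z)"
      unfolding gj_def[abs_def] by (rule weakD_mult_w[OF w1 g \<mu> pm(1) pb pm(2)])
    show "wD (\<lambda>z. p j (snd (snd z)) * \<mu> z) (\<lambda>z. - (lam * gj j z))"
      using weakD_mult_w[OF w2 \<mu> hm pm(1) pb pm(2), of j] by (simp add: gj_def mult.left_commute)
  qed
  have "\<forall>j. \<exists>c. Hnorm (\<lambda>z. gj j z - (\<Sum>e\<in>F. c e * e z)) = 0"
    by (intro allI F(3)[rule_format] gjA)
  from choice[OF this] obtain c where c: "\<And>j. Hnorm (\<lambda>z. gj j z - (\<Sum>e\<in>F. c j e * e z)) = 0" by blast
  \<comment> \<open>The index set \<open>{..N}\<close> has \<open>card F + 1\<close> elements, one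
    more than there are equations.\<close>
  define N where "N = card F"
  obtain a where a: "\<exists>i\<in>{..N}. a i \<noteq> 0" "\<forall>e\<in>F. (\<Sum>i\<in>{..N}. a i * c i e) = 0"
    using exists_linear_relation[OF F(1) finite_atMost, of N c] unfolding N_def card_atMost by blast
  have FH: "Hin e" if "e \<in> F" for e using F(2)[rule_format, OF that] unfolding Aop_def by blast
  have "AE z in lborel. z \<in> Om \<longrightarrow> gj j z - (\<Sum>e\<in>F. c j e * e z) = 0" for j
  proof (rule Hnorm_zero_iff[THEN iffD1])
    have "Hin (\<lambda>z. \<Sum>e\<in>F. c j e * e z)" by (rule Hin_sum[OF F(1), of "\<lambda>e. e"]) (rule FH)
    from Hin_lin[OF gjH[of j] this, of 1 "-1"] show "Hin (\<lambda>z. gj j z - (\<Sum>e\<in>F. c j e * e z))" by simp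
  qed (rule c)
  then have all: "AE z in lborel. \<forall>j. z \<in> Om \<longrightarrow> gj j z - (\<Sum>e\<in>F. c j e * e z) = 0"
    unfolding AE_all_countable by blast
  obtain i where i: "i \<le> N" "a i \<noteq> 0" using a(1) by auto
  have "AE z in lborel. z \<in> Om \<longrightarrow> g z = 0"
    using all AE_phase_polynomial_nonzero[of i N a, OF i]
  proof (eventually_elim, intro impI)
    fix z assume z: "\<forall>j. z \<in> Om \<longrightarrow> gj j z - (\<Sum>e\<in>F. c j e * e z) = 0"
      and P: "(\<Sum>j\<le>N. a j * fst (snd (snd z)) ^ j) \<noteq> 0" and Om: "z \<in> Om"
    have "(\<Sum>j\<le>N. a j * fst (snd (snd z)) ^ j) * g z = (\<Sum>j\<le>N. a j * gj j z)"
      by (simp add: gj_def p_def sum_distrib_right mult.assoc)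
    also have "\<dots> = (\<Sum>j\<le>N. \<Sum>e\<in>F. a j * c j e * e z)"
      using z Om by (intro sum.cong) (auto simp: sum_distrib_left mult.assoc)
    also have "\<dots> = (\<Sum>e\<in>F. (\<Sum>j\<le>N. a j * c j e) * e z)"
      by (subst sum.swap) (simp add: sum_distrib_right)
    also have "\<dots> = 0" using a(2) by simp
    finally show "g z = 0" using P by simp
  qed
  then show False using gn Hnorm_zero_iff[OF g] by simp
qed

lemma discrete_spectrum_empty: "disc_spectrumA alpha beta U0 = {}"
  using no_finite_eigenvalue by (auto simp: disc_spectrumA_def)

section \<open>Approximate eigenfunctions at resonance\<close>

lemma tube_sets [measurable]: "tube a b \<in> sets borel"
  by (rule borel_compact[OF tube_compact])

text \<open>The tube is compact inside the domain, so it has finite measure and the weight is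
  bounded on it.\<close>

lemma Hin_tube:
  assumes ab: "cbox a b \<subseteq> D0" and F[measurable]: "F \<in> borel_measurable borel"
    and bd: "\<And>z. z \<in> tube a b \<Longrightarrow> \<bar>F z\<bar> \<le> B"
  shows "Hin (\<lambda>z. indicator (tube a b) z * F z)"
proof -
  obtain W where W: "\<forall>z\<in>tube a b. \<bar>wt z\<bar> \<le> W"
    using compact_imp_bounded[OF compact_continuous_image[OF continuous_on_subset[OF wt_cont tube_Om[OF ab]] tube_compact]]
    by (auto simp: bounded_iff)
  have "Hsq (\<lambda>z. indicator (tube a b) z * F z) \<le> (\<integral>\<^sup>+z. ennreal (B\<^sup>2 * W) * indicator (tube a b) z \<partial>lborel)"
    unfolding Hsq_alt
  proof (intro nn_integral_mono)
    fix z
    show "ennreal ((indicator (tube a b) z * F z)\<^sup>2 * (indicator Om z * wt z)) \<le> ennreal (B\<^sup>2 * W) * indicator (tube a b) z"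
    proof (cases "z \<in> tube a b")
      case True
      then have Om: "z \<in> Om" using tube_Om[OF ab] by blast
      have "\<bar>F z\<bar> \<le> \<bar>B\<bar>" using bd[OF True] by linarith
      then have "(F z)\<^sup>2 \<le> B\<^sup>2" by (simp only: abs_le_square_iff)
      then have "(F z)\<^sup>2 * wt z \<le> B\<^sup>2 * W"
        using W True wt_pos[OF Om] by (intro mult_mono) auto
      then show ?thesis using True Om by (simp add: ennreal_leI)
    qed simp
  qed
  also have "\<dots> = ennreal (B\<^sup>2 * W) * emeasure lborel (tube a b)" by (rule nn_integral_cmult_indicator) simp
  also have "\<dots> < \<infinity>" using emeasure_compact_finite[OF tube_compact, of a b] by (simp add: ennreal_mult_less_top)
  finally show ?thesis by (simp add: Hin_iff)
qed

definition om :: "nat \<Rightarrow> real \<Rightarrow> real" where "om n e = 2 * pi * real n / Tper e"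
text \<open>The phase of the \<open>n\<close>-th mode, with the frequency adapted to the orbit:
  \<open>n\<close> full turns per period at every energy, so the mode is periodic on all orbits and
  not only on the resonant ones.\<close>

definition phs :: "nat \<Rightarrow> phase \<Rightarrow> real" where "phs n z = om n (en z) * circle_weight.t (kap (en z)) (ang z)"

lemma om_cont: "continuous_on UNIV (om n)"
  unfolding om_def[abs_def] by (intro continuous_intros Tper_cont) (use Tper_pos in \<open>auto simp: less_imp_neq[OF Tper_pos, symmetric]\<close>)

lemma om_meas [measurable]: "om n \<in> borel_measurable borel"
  by (rule borel_measurable_continuous_onI[OF om_cont])

lemma phs_meas [measurable]: "phs n \<in> borel_measurable borel"
  unfolding phs_def[abs_def] by measurable

lemma phs_slice:
  assumes "\<rho> \<in> D0" "s \<in> {-pi<..<pi}"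
  shows "phs n (Zc (\<rho>, s)) = om n (fst \<rho>) * circle_weight.t (kap (fst \<rho>)) s" "en (Zc (\<rho>, s)) = fst \<rho>"
  using assms Zc_en[of "fst \<rho>" "snd \<rho>" s] Zc_ang[of "fst \<rho>" s "snd \<rho>"] by (auto simp: phs_def D0_def)

lemma circ_prim_phase:
  fixes c e n
  defines "w \<equiv> om n e"
  shows "circ_prim (kap e) (\<lambda>s. c * cos (w * circle_weight.t (kap e) s)) (\<lambda>s. c * (- w * sin (w * circle_weight.t (kap e) s)))"
    "circ_prim (kap e) (\<lambda>s. c * (- w * sin (w * circle_weight.t (kap e) s))) (\<lambda>s. - (c * (w\<^sup>2 * cos (w * circle_weight.t (kap e) s))))"
proof -
  have wT: "w * circle_weight.T (kap e) = 2 * pi * real n"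
    using Tper_pos[of e] by (simp add: w_def om_def T_eq_Tper)
  have sc: "sin (2 * pi * real n) = 0" "cos (2 * pi * real n) = 1"
    using sin_2npi[of n] cos_2npi[of n] by (simp_all add: mult_ac)
  show "circ_prim (kap e) (\<lambda>s. c * cos (w * circle_weight.t (kap e) s)) (\<lambda>s. c * (- w * sin (w * circle_weight.t (kap e) s)))"
    by (rule circle_weight.circ_prim_clock[OF kap_weight, of "\<lambda>u. c * cos (w * u)" "\<lambda>u. c * (- w * sin (w * u))"])
       (auto intro!: derivative_eq_intros continuous_intros simp: wT sc)
  show "circ_prim (kap e) (\<lambda>s. c * (- w * sin (w * circle_weight.t (kap e) s))) (\<lambda>s. - (c * (w\<^sup>2 * cos (w * circle_weight.t (kap e) s))))"
    by (rule circle_weight.circ_prim_clock[OF kap_weight, of "\<lambda>u. c * (- w * sin (w * u))" "\<lambda>u. - (c * (w\<^sup>2 * cos (w * u)))"])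
       (auto intro!: derivative_eq_intros continuous_intros simp: wT sc power2_eq_square)
qed

text \<open>The operator differentiates only along orbits, so the sharp cutoff in the invariants
  costs nothing, and on each orbit it multiplies the mode by the squared frequency.\<close>

lemma trial_Aop:
  fixes n
  assumes ab: "cbox a b \<subseteq> D0"
  defines "g \<equiv> \<lambda>z. indicator (tube a b) z * cos (phs n z)"
  shows "Hin g" "Aop alpha beta U0 g (\<lambda>z. (om n (en z))\<^sup>2 * g z)"
proof -
  have "bounded (om n ` {0..e0})"
    by (intro compact_imp_bounded compact_continuous_image continuous_on_subset[OF om_cont]) auto
  then obtain B where B: "\<forall>e\<in>{0..e0}. \<bar>om n e\<bar> \<le> B" by (auto simp: bounded_iff)
  have omb: "\<bar>om n (en z)\<bar> \<le> B" if "z \<in> tube a b" for z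
    using B that tube_Om[OF ab] en_nonneg[of z] by (auto simp: Om_eq)
  define m where "m z = indicator (tube a b) z * (- om n (en z) * sin (phs n z))" for z
  define h where "h z = indicator (tube a b) z * ((om n (en z))\<^sup>2 * cos (phs n z))" for z
  show gH: "Hin g" unfolding g_def by (rule Hin_tube[OF ab, where B=1]) auto
  have mH: "Hin m" unfolding m_def[abs_def]
  proof (rule Hin_tube[OF ab])
    show "\<bar>- om n (en z) * sin (phs n z)\<bar> \<le> B" if "z \<in> tube a b" for z
      using mult_mono[OF omb[OF that] abs_sin_le_one[of "phs n z"]] omb[OF that] by (simp add: abs_mult)
  qed measurable
  have hH: "Hin h" unfolding h_def[abs_def]
  proof (rule Hin_tube[OF ab])
    show "\<bar>(om n (en z))\<^sup>2 * cos (phs n z)\<bar> \<le> B\<^sup>2" if "z \<in> tube a b" for z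
      using mult_mono[OF power_mono[OF omb[OF that], of 2] abs_cos_le_one[of "phs n z"]] omb[OF that] by (simp add: abs_mult)
  qed measurable
  have hmH: "Hin (\<lambda>z. - h z)" using Hin_cmult[OF hH, of "-1"] by simp
  have heq: "h = (\<lambda>z. (om n (en z))\<^sup>2 * g z)" by (auto simp: h_def g_def)
  have ind: "indicator (tube a b) (Zc (\<rho>, s)) = (indicator (cbox a b) \<rho> :: real)" if "\<rho> \<in> D0" for \<rho> s
    using Zc_tube[OF that] by (simp add: indicator_def)
  have AEs: "AE s in lborel. s \<in> {-pi..pi} \<longrightarrow>
      g (Zc (\<rho>, s)) = indicator (cbox a b) \<rho> * cos (om n (fst \<rho>) * circle_weight.t (kap (fst \<rho>)) s) \<and>
      m (Zc (\<rho>, s)) = indicator (cbox a b) \<rho> * (- om n (fst \<rho>) * sin (om n (fst \<rho>) * circle_weight.t (kap (fst \<rho>)) s)) \<and>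
      h (Zc (\<rho>, s)) = indicator (cbox a b) \<rho> * ((om n (fst \<rho>))\<^sup>2 * cos (om n (fst \<rho>) * circle_weight.t (kap (fst \<rho>)) s))"
    if \<rho>: "\<rho> \<in> D0" for \<rho>
    using AE_interior by eventually_elim (auto simp: g_def m_def h_def ind[OF \<rho>] phs_slice[OF \<rho>])
  have mm: "m \<in> borel_measurable borel" "(\<lambda>z. - h z) \<in> borel_measurable borel" using mH hmH by (auto simp: Hin_iff)
  have "wD g m"
  proof (rule weakD_of_slices[OF gH mH], intro AE_I2 impI)
    fix \<rho> assume \<rho>: "\<rho> \<in> D0"
    show "circ_prim (kap (fst \<rho>)) (\<lambda>s. g (Zc (\<rho>, s))) (\<lambda>s. m (Zc (\<rho>, s)))"
      by (rule circ_prim_cong_AE[OF circ_prim_phase(1)[of "fst \<rho>" "indicator (cbox a b) \<rho>" n]])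
         (use AEs[OF \<rho>] slice_meas[OF mm(1)] kap_section_meas in \<open>auto elim: eventually_mono\<close>)
  qed
  moreover have "wD m (\<lambda>z. - h z)"
  proof (rule weakD_of_slices[OF mH hmH], intro AE_I2 impI)
    fix \<rho> assume \<rho>: "\<rho> \<in> D0"
    show "circ_prim (kap (fst \<rho>)) (\<lambda>s. m (Zc (\<rho>, s))) (\<lambda>s. - h (Zc (\<rho>, s)))"
      by (rule circ_prim_cong_AE[OF circ_prim_phase(2)[of "fst \<rho>" "indicator (cbox a b) \<rho>" n]])
         (use AEs[OF \<rho>] slice_meas[OF mm(2)] kap_section_meas in \<open>auto elim: eventually_mono\<close>)
  qed
  ultimately show "Aop alpha beta U0 g (\<lambda>z. (om n (en z))\<^sup>2 * g z)"
    unfolding Aop_def heq[symmetric] using gH mH hH by blast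
qed

text \<open>On each orbit in the box the squared mode is a continuous nonnegative function, and at
  the angle \<open>- pi\<close>, where the time is 0, the cosine equals 1.\<close>

lemma trial_nonzero:
  fixes n
  assumes ab: "cbox a b \<subseteq> D0" and ne: "box a b \<noteq> {}"
  defines "g \<equiv> \<lambda>z. indicator (tube a b) z * cos (phs n z)"
  shows "Hnorm g \<noteq> 0"
proof
  assume zero: "Hnorm g = 0"
  have gH: "Hin g" unfolding g_def by (rule trial_Aop(1)[OF ab])
  have gm: "g \<in> borel_measurable borel" using gH by (simp add: Hin_iff)
  have gm'[measurable]: "g \<in> borel_measurable borel" by (rule gm)
  let ?I = "\<lambda>\<rho>. \<integral>\<^sup>+s. ennreal ((g (Zc (\<rho>, s)))\<^sup>2 * kap (fst \<rho>) s) * indicator {-pi..pi} s \<partial>lborel"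
  have "Hsq g \<noteq> top" using gH by (auto simp: Hin_iff)
  then have "Hsq g = 0" using zero by (simp add: Hnorm_eq enn2real_eq_0_iff)
  then have "AE \<rho> in lborel. ennreal (Wt \<rho>) * ?I \<rho> = 0"
    unfolding Hsq_slices[OF gm] by (subst (asm) nn_integral_0_iff_AE) measurable
  then have "AE \<rho> in lborel. \<rho> \<notin> box a b"
  proof eventually_elim
    case (elim \<rho>)
    show ?case
    proof
      assume \<rho>: "\<rho> \<in> box a b"
      then have c: "\<rho> \<in> cbox a b" using box_subset_cbox by blast
      then have D: "\<rho> \<in> D0" using ab by blast
      define p where "p s = (cos (om n (fst \<rho>) * circle_weight.t (kap (fst \<rho>)) s))\<^sup>2 * kap (fst \<rho>) s" for s
      have pc: "continuous_on {-pi..pi} p" unfolding p_def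
        by (intro continuous_intros kap_cont circle_weight.t_cont[OF kap_weight])
      have "?I \<rho> = 0" using elim Wt_pos[OF D] by (simp add: ennreal_eq_0_iff)
      also have "?I \<rho> = (\<integral>\<^sup>+s. ennreal (indicator {-pi..pi} s *\<^sub>R p s) \<partial>lborel)"
      proof (rule nn_integral_cong_AE)
        show "AE s in lborel. ennreal ((g (Zc (\<rho>, s)))\<^sup>2 * kap (fst \<rho>) s) * indicator {-pi..pi} s = ennreal (indicator {-pi..pi} s *\<^sub>R p s)"
          using AE_interior
        proof eventually_elim
          case (elim s)
          show ?case
          proof (cases "s \<in> {-pi..pi}")
            case True
            then have "s \<in> {-pi<..<pi}" using elim by blast
            then have "g (Zc (\<rho>, s)) = cos (om n (fst \<rho>) * circle_weight.t (kap (fst \<rho>)) s)"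
              using phs_slice[OF D] Zc_tube[OF D] c by (simp add: g_def)
            then show ?thesis using True by (simp add: p_def)
          qed simp
        qed
      qed
      finally have z: "(\<integral>\<^sup>+s. ennreal (indicator {-pi..pi} s *\<^sub>R p s) \<partial>lborel) = 0" by simp
      have "(LINT s:{-pi..pi}|lborel. p s) = 0"
        unfolding set_lebesgue_integral_def
        by (subst integral_eq_nn_integral)
           (use set_integrable_continuous_Icc[OF pc] z in \<open>auto simp: set_integrable_def p_def less_imp_le[OF kap_pos]\<close>)
      then have "integral {-pi..pi} p = 0"
        using set_borel_integral_eq_integral(2)[OF set_integrable_continuous_Icc[OF pc]] by simp
      then have "p (-pi) = 0"
        using integral_eq_0_iff[OF pc] by (auto simp: p_def less_imp_le[OF kap_pos])
      then show False
        using kap_pos[of "fst \<rho>" "-pi"] by (simp add: p_def circle_weight.t_lower[OF kap_weight])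
    qed
  qed
  then have "box a b \<in> null_sets lborel" using AE_iff_null_sets[of "box a b" lborel] by simp
  then have "negligible (box a b)" by (simp add: negligible_iff_null_sets null_sets_completionI)
  then show False using open_not_negligible[OF open_box ne] by blast
qed

theorem resonance:
  assumes e: "e \<in> {0..e0}"
  shows "(2 * pi * real n / Tper e)\<^sup>2 \<in> spectrumA alpha beta U0"
proof (rule ccontr)
  define lam where "lam = (2 * pi * real n / Tper e)\<^sup>2"
  assume "(2 * pi * real n / Tper e)\<^sup>2 \<notin> spectrumA alpha beta U0"
  then obtain C where C: "\<And>g h. Aop alpha beta U0 g h \<Longrightarrow> Hnorm g \<le> C * Hnorm (\<lambda>z. h z - lam * g z)"
    by (auto simp: spectrumA_def lam_def)
  \<comment> \<open>Chosen so that \<open>|C|\<close> times it is below 1: a trial function with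
    this relative defect contradicts the resolvent bound.\<close>
  define \<epsilon> where "\<epsilon> = 1 / (\<bar>C\<bar> + 1)"
  have \<epsilon>: "\<epsilon> > 0" by (simp add: \<epsilon>_def)
  have "isCont (\<lambda>x. (om n x)\<^sup>2) e"
    using om_cont[of n] by (intro continuous_intros) (simp add: continuous_on_eq_continuous_at)
  then obtain \<delta> where \<delta>: "\<delta> > 0" "\<And>x. \<bar>x - e\<bar> < \<delta> \<Longrightarrow> \<bar>(om n x)\<^sup>2 - lam\<bar> < \<epsilon>"
    using \<epsilon> unfolding continuous_at_eps_delta by (auto simp: dist_real_def lam_def om_def)
  have e0: "e0 > 0" using E0_gt by (simp add: e0_def)
  \<comment> \<open>The resonant energy may be an end point, where \<open>D0\<close> leaves no room
    for a box; by continuity of the frequency a nearby interior energy serves.\<close>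
  obtain e1 where e1: "0 < e1" "e1 < e0" "\<bar>e1 - e\<bar> < \<delta>"
  proof (cases "e < e0")
    case True
    show thesis using True e \<delta>(1) by (intro that[of "min ((e + e0) / 2) (e + \<delta> / 2)"]) (auto simp: min_def)
  next
    case False
    then have "e = e0" using e by simp
    then show thesis using \<delta>(1) e0 by (intro that[of "max (e0 / 2) (e0 - \<delta> / 2)"]) (auto simp: max_def)
  qed
  obtain w0 where w0: "beta w0 > 0" using beta_ex by blast
  define S where "S = D0 \<inter> {\<rho>. \<bar>fst \<rho> - e\<bar> < \<delta>}"
  have "open S" unfolding S_def
    by (intro open_Int open_D0 open_Collect_less continuous_intros)
  moreover have "(e1, w0) \<in> S" using e1 w0 by (simp add: S_def D0_def)
  ultimately obtain a b where ab: "(e1, w0) \<in> box a b" "cbox a b \<subseteq> S"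
    using open_contains_cbox[of S "(e1, w0)"] by metis
  have D: "cbox a b \<subseteq> D0" using ab(2) by (auto simp: S_def)
  define g where "g z = indicator (tube a b) z * cos (phs n z)" for z
  have A: "Aop alpha beta U0 g (\<lambda>z. (om n (en z))\<^sup>2 * g z)" and gH: "Hin g"
    unfolding g_def[abs_def] by (rule trial_Aop[OF D])+
  have gn: "Hnorm g \<noteq> 0" unfolding g_def[abs_def] using ab(1) by (intro trial_nonzero[OF D]) auto
  have gm[measurable]: "g \<in> borel_measurable borel" using gH by (simp add: Hin_iff)
  define d where "d z = (om n (en z))\<^sup>2 * g z - lam * g z" for z
  have dm: "d \<in> borel_measurable borel" unfolding d_def[abs_def] by measurable
  have "\<bar>d z\<bar> \<le> \<epsilon> * \<bar>g z\<bar>" for z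
  proof (cases "z \<in> tube a b")
    case True
    then have "\<bar>en z - e\<bar> < \<delta>" using ab(2) by (auto simp: tube_def S_def)
    from \<delta>(2)[OF this] have "\<bar>(om n (en z))\<^sup>2 - lam\<bar> * \<bar>g z\<bar> \<le> \<epsilon> * \<bar>g z\<bar>" by (intro mult_right_mono) auto
    then show ?thesis by (simp add: d_def abs_mult[symmetric] left_diff_distrib)
  qed (simp add: d_def g_def)
  then have "Hsq d \<le> ennreal (\<epsilon>\<^sup>2) * Hsq g" using \<epsilon> by (intro Hsq_mono) auto
  then have "enn2real (Hsq d) \<le> enn2real (ennreal (\<epsilon>\<^sup>2) * Hsq g)"
    using gH by (intro enn2real_mono) (auto simp: Hin_iff ennreal_mult_less_top)
  then have "Hnorm d \<le> sqrt (\<epsilon>\<^sup>2 * enn2real (Hsq g))"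
    unfolding Hnorm_eq[OF dm] by (simp add: enn2real_mult)
  also have "\<dots> = \<epsilon> * Hnorm g" using \<epsilon> by (simp add: Hnorm_eq[OF gm] real_sqrt_mult)
  finally have dle: "Hnorm d \<le> \<epsilon> * Hnorm g" .
  have g0: "Hnorm g > 0" using gn by (simp add: Hnorm_eq[OF gm] less_le)
  have d0: "Hnorm d \<ge> 0" by (simp add: Hnorm_eq[OF dm])
  have "Hnorm g \<le> C * Hnorm d" using C[OF A] by (simp add: d_def[abs_def])
  also have "\<dots> \<le> \<bar>C\<bar> * Hnorm d" using d0 by (intro mult_right_mono) auto
  also have "\<dots> \<le> \<bar>C\<bar> * (\<epsilon> * Hnorm g)" using dle by (intro mult_left_mono) auto
  also have "\<dots> < Hnorm g"
  proof -
    have "\<bar>C\<bar> * \<epsilon> < 1" by (simp add: \<epsilon>_def)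
    from mult_strict_right_mono[OF this g0] show ?thesis by (simp add: mult.assoc)
  qed
  finally show False by simp
qed

theorem spectrum_eq:
  "spectrumA alpha beta U0 = {(2 * pi * real n / Tper e)\<^sup>2 | n e. e \<in> {0..e0}}" (is "_ = ?R")
proof
  show "?R \<subseteq> spectrumA alpha beta U0" using resonance by auto
  show "spectrumA alpha beta U0 \<subseteq> ?R"
  proof
    fix lam assume spec: "lam \<in> spectrumA alpha beta U0"
    show "lam \<in> ?R"
    proof (rule ccontr)
      assume nR: "lam \<notin> ?R"
      have e0: "0 \<in> {0..e0}" using E0_gt by (simp add: e0_def)
      \<comment> \<open>Zero lies in the right-hand side through \<open>n = 0\<close>.\<close>
      have lam0: "lam \<noteq> 0"
      proof
        assume "lam = 0"
        then have "lam = (2 * pi * real 0 / Tper 0)\<^sup>2" by simp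
        then show False using nR e0 by blast
      qed
      show False
      proof (cases "lam > 0")
        case True
        define w where "w = sqrt lam"
        have w: "w > 0" "w\<^sup>2 = lam" using True by (auto simp: w_def)
        \<comment> \<open>For positive \<open>lam\<close> a zero of \<open>S\<close> at half a
          period means \<open>w * T / 2 = i * pi\<close> with an integer \<open>i > 0\<close>, hence
          \<open>lam = (2 * pi * i / T)^2\<close>, a resonance.\<close>
        have "well_resolvent q A alpha beta U0 u0 E0 (\<lambda>u. cos (w * u)) (\<lambda>u. - w * sin (w * u)) lam"
        proof (unfold_locales)
          fix e assume e: "e \<in> {0..weighted_well.e0 u0 E0}"
          show "- w * sin (w * (weighted_well.Tper q A e / 2)) \<noteq> 0"
          proof
            assume "- w * sin (w * (Tper e / 2)) = 0"
            then have "sin (w * (Tper e / 2)) = 0" using w by simp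
            then obtain i :: int where i: "w * (Tper e / 2) = of_int i * pi" by (auto simp: sin_zero_iff_int2)
            have "of_int i * pi > 0" unfolding i[symmetric] using w Tper_pos[of e] by simp
            then have "i > 0" by (simp add: zero_less_mult_iff)
            then have "real (nat i) = of_int i" by simp
            then have "w = 2 * pi * real (nat i) / Tper e" using i Tper_pos[of e] by (simp add: field_simps)
            then have "lam = (2 * pi * real (nat i) / Tper e)\<^sup>2" using w by simp
            then show False using nR e by blast
          qed
        qed (use lam0 w in \<open>auto intro!: derivative_eq_intros simp: power2_eq_square\<close>)
        then show False using well_resolvent.resolvent spec by blast
      next
        case False
        define w where "w = sqrt (- lam)"
        have w: "w > 0" "w * w = - lam" using False lam0 by (auto simp: w_def)
        have ww: "w * (w * x) = - (lam * x)" for x using w(2) by (simp flip: mult.assoc)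
        \<comment> \<open>For negative \<open>lam\<close> nonresonance is automatic, because the
          hyperbolic sine has no positive zero.\<close>
        have "well_resolvent q A alpha beta U0 u0 E0 (\<lambda>u. cosh (w * u)) (\<lambda>u. w * sinh (w * u)) lam"
        proof (unfold_locales)
          fix e assume e: "e \<in> {0..weighted_well.e0 u0 E0}"
          show "w * sinh (w * (weighted_well.Tper q A e / 2)) \<noteq> 0"
            using w Tper_pos[of e] by simp
        qed (use lam0 w in \<open>auto intro!: derivative_eq_intros simp: mult_ac ww\<close>)
        then show False using well_resolvent.resolvent spec by blast
      qed
    qed
  qed
qed

end

section \<open>The potential of the steady state\<close>

text \<open>Smoothness is not among the assumptions but is recovered from the two integral equations
  alternately: \<open>rho0\<close> is integrable, so \<open>U0\<close> is Lipschitz, so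
  \<open>rho0\<close> is continuous, so \<open>U0\<close> is twice continuously
  differentiable.\<close>

locale steady_state =
  fixes alpha :: "real \<Rightarrow> real" and beta :: "real \<times> real \<Rightarrow> real"
    and U0 rho0 :: "real \<Rightarrow> real" and E0 R0 k :: real
  assumes beta_cont: "continuous_on UNIV beta"
    and beta_nonneg: "\<forall>w. beta w \<ge> 0"
    and beta_supp: "\<exists>K. compact K \<and> (\<forall>w. w \<notin> K \<longrightarrow> beta w = 0)"
    and beta_int: "integral\<^sup>L lborel beta = 1"
    and alpha_form:
      "(k > 1/2 \<and> (\<forall>E. alpha E = (if E0 - E > 0 then (E0 - E) powr k else 0)))
       \<or> (\<forall>E. alpha E = (if E0 - E > 0 then exp (E0 - E) - 1 else 0))"
    and rho0_def: "\<forall>x. integrable lborel (\<lambda>v. f0 alpha beta U0 (x, v)) \<and>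
                       rho0 x = integral\<^sup>L lborel (\<lambda>v. f0 alpha beta U0 (x, v))"
    and U0_def: "\<forall>x. integrable lborel (\<lambda>y. \<bar>x - y\<bar> * rho0 y) \<and>
                     U0 x = 2 * pi * integral\<^sup>L lborel (\<lambda>y. \<bar>x - y\<bar> * rho0 y)"
    and U0_even: "\<forall>x. U0 (- x) = U0 x"
    and R0_pos: "R0 > 0"
    and supp_rho0: "closure {x. rho0 x \<noteq> 0} = {- R0 .. R0}"
    and U0_mono: "strict_mono_on {0..} U0"
    and E0_def: "E0 = U0 R0"
begin

lemma alpha_cases:
  obtains "k > 0" "\<And>E. alpha E = (max 0 (E0 - E)) powr k" | "\<And>E. alpha E = max 0 (exp (E0 - E) - 1)"
proof -
  show thesis
    using alpha_form
  proof
    assume *: "k > 1/2 \<and> (\<forall>E. alpha E = (if E0 - E > 0 then (E0 - E) powr k else 0))"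
    show thesis by (rule that(1)) (use * in auto)
  next
    assume *: "\<forall>E. alpha E = (if E0 - E > 0 then exp (E0 - E) - 1 else 0)"
    show thesis
    proof (rule that(2))
      fix E show "alpha E = max 0 (exp (E0 - E) - 1)" using * by (cases "E0 - E > 0") auto
    qed
  qed
qed

lemma alpha_pos: "alpha E > 0 \<longleftrightarrow> E < E0"
  by (rule alpha_cases) (auto simp: less_max_iff_disj)

lemma alpha_nonneg: "alpha E \<ge> 0"
  by (rule alpha_cases) auto

lemma alpha_cont: "continuous_on UNIV alpha"
proof (rule alpha_cases)
  assume k: "k > 0" and a: "\<And>E. alpha E = (max 0 (E0 - E)) powr k"
  have "continuous_on UNIV (\<lambda>E. (max 0 (E0 - E)) powr k)"
    by (intro continuous_on_powr' continuous_intros) (use k in auto)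
  then show ?thesis by (simp add: a[abs_def])
next
  assume a: "\<And>E. alpha E = max 0 (exp (E0 - E) - 1)"
  have "continuous_on UNIV (\<lambda>E. max 0 (exp (E0 - E) - 1))" by (intro continuous_intros)
  then show ?thesis by (simp add: a[abs_def])
qed

lemma alpha_antimono:
  assumes "E \<le> E'"
  shows "alpha E' \<le> alpha E"
proof (rule alpha_cases)
  assume "k > 0" "\<And>E. alpha E = (max 0 (E0 - E)) powr k"
  then show ?thesis using assms by (auto intro!: powr_mono2)
next
  assume "\<And>E. alpha E = max 0 (exp (E0 - E) - 1)"
  moreover have "exp (E0 - E') \<le> exp (E0 - E)" using assms by simp
  ultimately show ?thesis by (smt (verit))
qed

lemma alpha_deriv: "continuous_on {..<E0} (deriv alpha) \<and> (\<forall>E<E0. deriv alpha E \<noteq> 0)"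
proof -
  have ev: "eventually (\<lambda>x. x \<in> {..<E0}) (nhds E)" if "E < E0" for E
    using that by (intro eventually_nhds_in_open) auto
  show ?thesis
  proof (rule alpha_cases)
    assume k: "k > 0" and a: "\<And>E. alpha E = (max 0 (E0 - E)) powr k"
    have d: "deriv alpha E = - k * (E0 - E) powr (k - 1)" if E: "E < E0" for E
    proof (rule DERIV_imp_deriv, rule DERIV_eventually_eq)
      show "((\<lambda>E. (E0 - E) powr k) has_real_derivative - k * (E0 - E) powr (k - 1)) (at E)"
        using E by (auto intro!: derivative_eq_intros)
      show "\<forall>\<^sub>F x in nhds E. alpha x = (E0 - x) powr k"
        using ev[OF E] by eventually_elim (auto simp: a)
    qed
    have "continuous_on {..<E0} (\<lambda>E. - k * (E0 - E) powr (k - 1))"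
      by (intro continuous_intros) auto
    then have "continuous_on {..<E0} (deriv alpha)" by (rule continuous_on_eq) (simp add: d)
    then show ?thesis using d k by auto
  next
    assume a: "\<And>E. alpha E = max 0 (exp (E0 - E) - 1)"
    have d: "deriv alpha E = - exp (E0 - E)" if E: "E < E0" for E
    proof (rule DERIV_imp_deriv, rule DERIV_eventually_eq)
      show "((\<lambda>E. exp (E0 - E) - 1) has_real_derivative - exp (E0 - E)) (at E)"
        by (auto intro!: derivative_eq_intros)
      show "\<forall>\<^sub>F x in nhds E. alpha x = exp (E0 - x) - 1"
        using ev[OF E] by eventually_elim (auto simp: a)
    qed
    have "continuous_on {..<E0} (\<lambda>E. - exp (E0 - E))" by (intro continuous_intros)
    then have "continuous_on {..<E0} (deriv alpha)" by (rule continuous_on_eq) (simp add: d)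
    then show ?thesis using d by auto
  qed
qed

lemma U0_abs: "U0 x = U0 \<bar>x\<bar>"
  using U0_even by (cases "x \<ge> 0") (auto simp: abs_if)

lemma U0_less: "x \<noteq> 0 \<Longrightarrow> U0 0 < U0 x"
  using strict_mono_onD[OF U0_mono, of 0 "\<bar>x\<bar>"] U0_abs[of x] by simp

lemma U0_min: "U0 0 \<le> U0 x"
  using U0_less[of x] by (cases "x = 0") auto

lemma rho0_nonneg: "rho0 x \<ge> 0"
  using rho0_def beta_nonneg alpha_nonneg by (auto simp: f0_def intro!: Bochner_Integration.integral_nonneg)

lemma rho0_outside: "\<bar>x\<bar> > R0 \<Longrightarrow> rho0 x = 0"
proof (rule ccontr)
  assume "\<bar>x\<bar> > R0" "rho0 x \<noteq> 0"
  then have "x \<in> closure {x. rho0 x \<noteq> 0}" using closure_subset by fast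
  then show False using \<open>\<bar>x\<bar> > R0\<close> by (auto simp: supp_rho0)
qed

text \<open>The potential is evaluated at \<open>R0 + 1\<close>, from where every point of the
  support is at distance at least one.\<close>

lemma rho0_integrable: "integrable lborel rho0"
proof (rule Bochner_Integration.integrable_bound)
  have int: "integrable lborel (\<lambda>y. \<bar>R0 + 1 - y\<bar> * rho0 y)" using U0_def by blast
  then show "integrable lborel (\<lambda>y. \<bar>R0 + 1 - y\<bar> * rho0 y)" .
  have "rho0 y = (\<bar>R0 + 1 - y\<bar> * rho0 y) / \<bar>R0 + 1 - y\<bar>" for y
    using rho0_outside[of y] R0_pos by (cases "y = R0 + 1") auto
  moreover have "(\<lambda>y. (\<bar>R0 + 1 - y\<bar> * rho0 y) / \<bar>R0 + 1 - y\<bar>) \<in> borel_measurable lborel"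
    using borel_measurable_integrable[OF int] by measurable
  ultimately show "rho0 \<in> borel_measurable lborel" by presburger
  show "AE y in lborel. norm (rho0 y) \<le> norm (\<bar>R0 + 1 - y\<bar> * rho0 y)"
  proof (rule AE_I2)
    fix y
    show "norm (rho0 y) \<le> norm (\<bar>R0 + 1 - y\<bar> * rho0 y)"
    proof (cases "\<bar>y\<bar> \<le> R0")
      case True
      then have "1 \<le> \<bar>R0 + 1 - y\<bar>" by linarith
      from mult_right_mono[OF this, of "\<bar>rho0 y\<bar>"] show ?thesis by (simp add: abs_mult)
    qed (use rho0_outside[of y] in auto)
  qed
qed

text \<open>The kernel \<open>|x - y|\<close> is 1-Lipschitz in \<open>x\<close>, so
  \<open>U0\<close> is Lipschitz with constant \<open>2 * pi\<close> times the total mass.\<close>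

lemma U0_cont: "continuous_on UNIV U0"
proof -
  define L where "L = 2 * pi * (LINT y|lborel. rho0 y)"
  have "(LINT y|lborel. rho0 y) \<ge> 0" by (intro Bochner_Integration.integral_nonneg rho0_nonneg)
  then have L0: "L \<ge> 0" by (simp add: L_def)
  have "dist (U0 x) (U0 x') \<le> L * dist x x'" for x x'
  proof -
    have i: "integrable lborel (\<lambda>y. \<bar>x - y\<bar> * rho0 y)" "integrable lborel (\<lambda>y. \<bar>x' - y\<bar> * rho0 y)" using U0_def by blast+
    have "U0 x - U0 x' = 2 * pi * (LINT y|lborel. \<bar>x - y\<bar> * rho0 y - \<bar>x' - y\<bar> * rho0 y)"
      using U0_def Bochner_Integration.integral_diff[OF i] by (simp add: right_diff_distrib)
    moreover have "\<bar>LINT y|lborel. \<bar>x - y\<bar> * rho0 y - \<bar>x' - y\<bar> * rho0 y\<bar> \<le> (LINT y|lborel. \<bar>x - x'\<bar> * rho0 y)"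
    proof (rule order_trans[OF integral_abs_bound], rule integral_mono)
      show "integrable lborel (\<lambda>y. \<bar>\<bar>x - y\<bar> * rho0 y - \<bar>x' - y\<bar> * rho0 y\<bar>)"
        using Bochner_Integration.integrable_diff[OF i] by (rule integrable_abs)
      show "integrable lborel (\<lambda>y. \<bar>x - x'\<bar> * rho0 y)" using rho0_integrable by simp
      fix y
      have "\<bar>\<bar>x - y\<bar> - \<bar>x' - y\<bar>\<bar> \<le> \<bar>x - x'\<bar>" by linarith
      from mult_right_mono[OF this rho0_nonneg[of y]]
      show "\<bar>\<bar>x - y\<bar> * rho0 y - \<bar>x' - y\<bar> * rho0 y\<bar> \<le> \<bar>x - x'\<bar> * rho0 y"
        using rho0_nonneg[of y] by (simp add: left_diff_distrib[symmetric] abs_mult)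
    qed
    ultimately show ?thesis by (simp add: dist_real_def L_def abs_mult mult_ac)
  qed
  then have "L-lipschitz_on UNIV U0" using L0 by (intro lipschitz_onI) auto
  then show ?thesis by (rule lipschitz_on_continuous_on)
qed

text \<open>\<open>U0\<close> is least at 0 and \<open>alpha\<close> is decreasing, so the integrand
  at \<open>x = 0\<close> dominates all others. The same function is the majorant for dominated
  convergence.\<close>

lemma rho0_le: "rho0 x \<le> rho0 0" and rho0_cont: "continuous_on UNIV rho0"
proof -
  have int: "integrable lborel (\<lambda>v. f0 alpha beta U0 (x, v))" for x using rho0_def by blast
  have eq: "rho0 x = (LINT v|lborel. f0 alpha beta U0 (x, v))" for x using rho0_def by blast
  have dom: "f0 alpha beta U0 (x, v) \<le> f0 alpha beta U0 (0, v)" for x v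
    unfolding f0_def energy_def fst_conv snd_conv
    by (intro mult_right_mono alpha_antimono add_left_mono U0_min beta_nonneg[rule_format])
  have nn: "0 \<le> f0 alpha beta U0 (x, v)" for x v
    unfolding f0_def by (intro mult_nonneg_nonneg alpha_nonneg beta_nonneg[rule_format])
  show "rho0 x \<le> rho0 0" for x unfolding eq by (rule integral_mono[OF int int dom])
  have "isCont rho0 x" for x
    unfolding continuous_at_sequentially
  proof (intro allI impI)
    fix u :: "nat \<Rightarrow> real" assume u: "u \<longlonglongrightarrow> x"
    have "(\<lambda>n. LINT v|lborel. f0 alpha beta U0 (u n, v)) \<longlonglongrightarrow> (LINT v|lborel. f0 alpha beta U0 (x, v))"
    proof (rule integral_dominated_convergence[where w = "\<lambda>v. f0 alpha beta U0 (0, v)"])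
      have "isCont (\<lambda>x. f0 alpha beta U0 (x, v)) x" for v
      proof -
        have "continuous_on UNIV (\<lambda>x. f0 alpha beta U0 (x, v))" unfolding f0_def energy_def
          by (intro continuous_intros continuous_on_compose2[OF alpha_cont] continuous_on_compose2[OF U0_cont]) auto
        then show ?thesis by (simp add: continuous_on_eq_continuous_at)
      qed
      then show "AE v in lborel. (\<lambda>n. f0 alpha beta U0 (u n, v)) \<longlonglongrightarrow> f0 alpha beta U0 (x, v)"
        by (intro AE_I2 isCont_tendsto_compose[OF _ u])
      show "AE v in lborel. norm (f0 alpha beta U0 (u n, v)) \<le> f0 alpha beta U0 (0, v)" for n
        using nn dom by simp
    qed (use int in auto)
    then show "(rho0 \<circ> u) \<longlonglongrightarrow> rho0 x" by (simp add: o_def eq)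
  qed
  then show "continuous_on UNIV rho0" by (simp add: continuous_at_imp_continuous_on)
qed

text \<open>\<open>rho0\<close> is largest at 0, and its support is not empty.\<close>

lemma rho0_0: "rho0 0 > 0"
proof (rule ccontr)
  assume "\<not> rho0 0 > 0"
  then have "rho0 x = 0" for x using rho0_le[of x] rho0_nonneg[of x] by linarith
  then have "closure {x. rho0 x \<noteq> 0} = {}" by simp
  then show False using supp_rho0 R0_pos by auto
qed

text \<open>The one-dimensional Poisson equation. Splitting the modulus at \<open>x\<close>
  expresses \<open>U0\<close> by the primitives of \<open>rho0\<close> and of
  \<open>y * rho0\<close>, and the terms containing \<open>rho0\<close> itself cancel in the first
  derivative.\<close>

lemma U0_DERIV:
  "(U0 has_real_derivative deriv U0 x) (at x)" "(deriv U0 has_real_derivative 4 * pi * rho0 x) (at x)"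
proof -
  \<comment> \<open>Beyond both \<open>R0\<close> and \<open>|x|\<close>: the density vanishes
    outside the interval and \<open>x\<close> is interior.\<close>
  define L where "L = \<bar>x\<bar> + R0 + 1"
  have L: "L > R0" "x \<in> {-L<..<L}" using R0_pos by (auto simp: L_def)
  define P where "P x = (LINT y:{-L..x}|lborel. rho0 y)" for x
  define Q where "Q x = (LINT y:{-L..x}|lborel. y * rho0 y)" for x
  have rc: "continuous_on A rho0" "continuous_on A (\<lambda>y. y * rho0 y)" for A
    using continuous_on_subset[OF rho0_cont subset_UNIV] by (auto intro!: continuous_intros)
  have Uf: "U0 x = 2 * pi * (x * (2 * P x - P L) - 2 * Q x + Q L)" if x: "x \<in> {-L<..<L}" for x
  proof -
    have c: "set_integrable lborel {a..b} rho0" "set_integrable lborel {a..b} (\<lambda>y. y * rho0 y)"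
      "set_integrable lborel {a..b} (\<lambda>y. x * rho0 y)" for a b
      by (intro set_integrable_continuous_Icc rc continuous_intros)+
    have "(LINT y|lborel. \<bar>x - y\<bar> * rho0 y) = (LINT y:{-L..L}|lborel. \<bar>x - y\<bar> * rho0 y)"
      unfolding set_lebesgue_integral_def
    proof (rule Bochner_Integration.integral_cong[OF refl])
      fix y
      have "rho0 y = 0" if "y \<notin> {-L..L}" using that L(1) by (intro rho0_outside) auto
      then show "\<bar>x - y\<bar> * rho0 y = indicator {-L..L} y *\<^sub>R (\<bar>x - y\<bar> * rho0 y)" by (auto simp: indicator_def)
    qed
    also have "\<dots> = (LINT y:{-L..x}|lborel. \<bar>x - y\<bar> * rho0 y) + (LINT y:{x..L}|lborel. \<bar>x - y\<bar> * rho0 y)"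
      using x by (intro set_integral_split_Icc set_integrable_continuous_Icc continuous_intros rc) auto
    also have "(LINT y:{-L..x}|lborel. \<bar>x - y\<bar> * rho0 y) = (LINT y:{-L..x}|lborel. x * rho0 y - y * rho0 y)"
      by (intro set_lebesgue_integral_cong) (auto simp: left_diff_distrib)
    also have "\<dots> = x * P x - Q x" by (simp add: set_integral_diff(2)[OF c(3,2)] P_def Q_def)
    also have "(LINT y:{x..L}|lborel. \<bar>x - y\<bar> * rho0 y) = (LINT y:{x..L}|lborel. y * rho0 y - x * rho0 y)"
      by (intro set_lebesgue_integral_cong) (auto simp: left_diff_distrib)
    also have "\<dots> = (LINT y:{x..L}|lborel. y * rho0 y) - x * (LINT y:{x..L}|lborel. rho0 y)"
      by (simp add: set_integral_diff(2)[OF c(2,3)])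
    also have "(LINT y:{x..L}|lborel. y * rho0 y) = Q L - Q x"
      using set_integral_split_Icc[OF c(2)[of "-L" L], of x] x by (simp add: Q_def)
    also have "(LINT y:{x..L}|lborel. rho0 y) = P L - P x"
      using set_integral_split_Icc[OF c(1)[of "-L" L], of x] x by (simp add: P_def)
    finally have "(LINT y|lborel. \<bar>x - y\<bar> * rho0 y) = x * (2 * P x - P L) - 2 * Q x + Q L"
      by (simp add: algebra_simps)
    then show ?thesis using U0_def by simp
  qed
  have ev: "eventually (\<lambda>x. x \<in> {-L<..<L}) (nhds x)" if "x \<in> {-L<..<L}" for x
    using that by (intro eventually_nhds_in_open) auto
  have dP: "(P has_real_derivative rho0 x) (at x)" and dQ: "(Q has_real_derivative x * rho0 x) (at x)" if "x \<in> {-L<..<L}" for x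
    unfolding P_def[abs_def] Q_def[abs_def] by (rule primitive_has_real_derivative[OF rc(1) that] primitive_has_real_derivative[OF rc(2) that])+
  have d1: "(U0 has_real_derivative 2 * pi * (2 * P x - P L)) (at x)" if x: "x \<in> {-L<..<L}" for x
  proof (rule DERIV_eventually_eq)
    show "((\<lambda>x. 2 * pi * (x * (2 * P x - P L) - 2 * Q x + Q L)) has_real_derivative 2 * pi * (2 * P x - P L)) (at x)"
      by (rule derivative_eq_intros dP[OF x] dQ[OF x] refl | simp)+
    show "\<forall>\<^sub>F s in nhds x. U0 s = 2 * pi * (s * (2 * P s - P L) - 2 * Q s + Q L)"
      using ev[OF x] by eventually_elim (rule Uf)
  qed
  have dU: "deriv U0 x = 2 * pi * (2 * P x - P L)" if "x \<in> {-L<..<L}" for x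
    by (rule DERIV_imp_deriv[OF d1[OF that]])
  show "(U0 has_real_derivative deriv U0 x) (at x)" using d1[OF L(2)] dU[OF L(2)] by simp
  show "(deriv U0 has_real_derivative 4 * pi * rho0 x) (at x)"
  proof (rule DERIV_eventually_eq)
    show "((\<lambda>x. 2 * pi * (2 * P x - P L)) has_real_derivative 4 * pi * rho0 x) (at x)"
      by (rule derivative_eq_intros dP[OF L(2)] refl | simp)+
    show "\<forall>\<^sub>F s in nhds x. deriv U0 s = 2 * pi * (2 * P s - P L)"
      using ev[OF L(2)] by eventually_elim (rule dU)
  qed
qed

lemma dU_0: "deriv U0 0 = 0"
  by (rule DERIV_local_min[OF U0_DERIV(1), of 1]) (use U0_min in auto)

lemma dU_mono: "x \<le> y \<Longrightarrow> deriv U0 x \<le> deriv U0 y"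
  using DERIV_nonneg_imp_nondecreasing[of x y "deriv U0"] U0_DERIV(2) rho0_nonneg
  by (metis mult_nonneg_nonneg pi_ge_zero zero_le_numeral)

text \<open>A nonpositive slope at \<open>x\<close> would by monotonicity stay nonpositive on all of
  \<open>[0, x]\<close>, against \<open>U0 0 < U0 x\<close>.\<close>

lemma dU_pos: "x > 0 \<Longrightarrow> deriv U0 x > 0"
proof (rule ccontr)
  assume x: "x > 0" and "\<not> deriv U0 x > 0"
  obtain z where z: "0 < z" "z < x" "U0 x - U0 0 = (x - 0) * deriv U0 z"
    using MVT2[OF x, of U0 "deriv U0"] U0_DERIV(1) by blast
  have "deriv U0 z \<le> 0" using dU_mono[of z x] z \<open>\<not> deriv U0 x > 0\<close> by linarith
  then have "U0 x - U0 0 \<le> 0" using z x by (simp add: mult_nonneg_nonpos)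
  then show False using U0_less[of x] x by simp
qed

lemma dU_odd: "deriv U0 (- x) = - deriv U0 x"
proof -
  have "((\<lambda>x. U0 (- x)) has_real_derivative deriv U0 (- x) * (-1)) (at x)"
    by (rule DERIV_chain2[OF U0_DERIV(1)]) (auto intro!: derivative_eq_intros)
  then have "(U0 has_real_derivative - deriv U0 (- x)) (at x)" using U0_even by simp
  from DERIV_unique[OF this U0_DERIV(1)] show ?thesis by simp
qed

section \<open>The signed square root of the potential as a coordinate\<close>

definition qs :: "real \<Rightarrow> real" where "qs x = sgn x * sqrt (2 * (U0 x - U0 0))"
text \<open>The derivative of \<open>qs\<close>. The value at 0 is the limit of the quotient, fixed
  by the second derivative \<open>4 * pi * rho0 0\<close> of the potential at its minimum.\<close>

definition As :: "real \<Rightarrow> real" where "As x = (if x = 0 then sqrt (4 * pi * rho0 0) else deriv U0 x / qs x)"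

lemma qs_0 [simp]: "qs 0 = 0"
  by (simp add: qs_def)

lemma qs_odd: "qs (- x) = - qs x"
  using U0_even by (simp add: qs_def sgn_minus)

lemma qs_square: "(qs x)\<^sup>2 = 2 * (U0 x - U0 0)"
  using U0_min[of x] by (cases "x = 0") (auto simp: qs_def power_mult_distrib sgn_if)

lemma qs_pos: "x > 0 \<Longrightarrow> qs x > 0"
  using U0_less[of x] by (simp add: qs_def)

lemma qs_deriv_pos: "x > 0 \<Longrightarrow> (qs has_real_derivative As x) (at x)"
proof -
  assume x: "x > 0"
  have U: "2 * (U0 x - U0 0) > 0" using U0_less[of x] x by simp
  have "((\<lambda>x. sqrt (2 * (U0 x - U0 0))) has_real_derivative deriv U0 x / sqrt (2 * (U0 x - U0 0))) (at x)"
    using U by (auto intro!: derivative_eq_intros U0_DERIV(1) simp: field_simps)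
  moreover have "\<forall>\<^sub>F s in nhds x. qs s = sqrt (2 * (U0 s - U0 0))"
    using eventually_nhds_in_open[of "{0<..}" x] x by (auto elim!: eventually_mono simp: qs_def)
  ultimately have "(qs has_real_derivative deriv U0 x / sqrt (2 * (U0 x - U0 0))) (at x)"
    by (rule DERIV_eventually_eq)
  then show ?thesis using x by (simp add: As_def qs_def)
qed

lemma As_even: "As (- x) = As x"
  by (simp add: As_def dU_odd qs_odd)

lemma dU_quotient: "((\<lambda>h. deriv U0 h / h) \<longlongrightarrow> 4 * pi * rho0 0) (at 0)"
  using U0_DERIV(2)[of 0] by (simp add: DERIV_def dU_0)

text \<open>One application of l'Hopital suffices, because \<open>U0' h / h\<close> tends to the
  second derivative at 0 by definition. The square root then gives the limit up to the sign, which
  \<open>sgn\<close> matches.\<close>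

lemma qs_quotient: "((\<lambda>h. qs h / h) \<longlongrightarrow> sqrt (4 * pi * rho0 0)) (at 0)"
proof -
  have "((\<lambda>h. (U0 h - U0 0) / h\<^sup>2) \<longlongrightarrow> 4 * pi * rho0 0 / 2) (at 0)"
  proof (rule lhopital)
    have "isCont U0 0" by (rule DERIV_isCont[OF U0_DERIV(1)])
    then show "((\<lambda>h. U0 h - U0 0) \<longlongrightarrow> 0) (at 0)" by (auto simp: isCont_def intro!: tendsto_eq_intros)
    show "((\<lambda>h::real. h\<^sup>2) \<longlongrightarrow> 0) (at 0)" by (auto intro!: tendsto_eq_intros)
    show "\<forall>\<^sub>F x in at (0::real). x\<^sup>2 \<noteq> 0" "\<forall>\<^sub>F x in at (0::real). 2 * x \<noteq> 0"
      by (auto simp: eventually_at_filter)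
    show "\<forall>\<^sub>F x in at 0. ((\<lambda>h. U0 h - U0 0) has_real_derivative deriv U0 x) (at x)"
      by (auto intro!: always_eventually derivative_eq_intros U0_DERIV(1))
    show "\<forall>\<^sub>F x in at (0::real). ((\<lambda>h. h\<^sup>2) has_real_derivative 2 * x) (at x)"
      by (auto intro!: always_eventually derivative_eq_intros)
    show "((\<lambda>x. deriv U0 x / (2 * x)) \<longlongrightarrow> 4 * pi * rho0 0 / 2) (at 0)"
      using tendsto_divide[OF dU_quotient tendsto_const[of 2]] by (simp add: mult.commute)
  qed
  then have lim: "((\<lambda>h. sqrt (2 * ((U0 h - U0 0) / h\<^sup>2))) \<longlongrightarrow> sqrt (2 * (4 * pi * rho0 0 / 2))) (at 0)"
    by (rule tendsto_real_sqrt[OF tendsto_mult[OF tendsto_const]])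
  have "sqrt (2 * ((U0 h - U0 0) / h\<^sup>2)) = qs h / h" if "h \<noteq> 0" for h
  proof -
    have "sqrt (2 * ((U0 h - U0 0) / h\<^sup>2)) = sqrt (2 * (U0 h - U0 0)) / \<bar>h\<bar>"
      by (simp add: real_sqrt_divide)
    also have "\<dots> = qs h / h" using that by (auto simp: qs_def abs_if sgn_if)
    finally show ?thesis .
  qed
  then have "\<forall>\<^sub>F h in at 0. sqrt (2 * ((U0 h - U0 0) / h\<^sup>2)) = qs h / h"
    by (auto simp: eventually_at_filter)
  from Lim_transform_eventually[OF lim this] show ?thesis by (simp add: mult.assoc)
qed

lemma qs_DERIV: "(qs has_real_derivative As x) (at x)"
proof -
  consider "x > 0" | "x = 0" | "x < 0" by linarith
  then show ?thesis
  proof cases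
    case 2
    then show ?thesis using qs_quotient by (simp add: DERIV_def As_def)
  next
    case 3
    have "((\<lambda>s. - qs (- s)) has_real_derivative - (As (- x) * (-1))) (at x)"
      using 3 by (intro DERIV_minus DERIV_chain2[OF qs_deriv_pos]) (auto intro!: derivative_eq_intros)
    moreover have "(\<lambda>s. - qs (- s)) = qs" by (simp add: qs_odd)
    ultimately show ?thesis by (simp add: As_even)
  qed (rule qs_deriv_pos)
qed

lemma As_pos: "As x > 0"
proof -
  have p: "As x > 0" if "x > 0" for x
    using that dU_pos[of x] qs_pos[of x] by (simp add: As_def)
  consider "x > 0" | "x = 0" | "x < 0" by linarith
  then show ?thesis
    using p[of x] p[of "- x"] rho0_0 As_even[of x] by cases (auto simp: As_def)
qed

text \<open>At 0 both \<open>U0'\<close> and \<open>qs\<close> vanish to first order; dividing each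
  by \<open>h\<close> gives the limit \<open>4 * pi * rho0 0 / sqrt (4 * pi * rho0 0)\<close>, the
  prescribed value.\<close>

lemma As_cont: "continuous_on UNIV As"
proof -
  have "isCont As x" for x
  proof (cases "x = 0")
    case True
    have lim: "((\<lambda>h. (deriv U0 h / h) / (qs h / h)) \<longlongrightarrow> 4 * pi * rho0 0 / sqrt (4 * pi * rho0 0)) (at 0)"
      using rho0_0 by (intro tendsto_divide dU_quotient qs_quotient) auto
    have As0: "4 * pi * rho0 0 / sqrt (4 * pi * rho0 0) = As 0"
      using rho0_0 by (simp add: As_def real_div_sqrt)
    have "\<forall>\<^sub>F h in at 0. (deriv U0 h / h) / (qs h / h) = As h"
      by (auto simp: eventually_at_filter As_def)
    from Lim_transform_eventually[OF lim this] show ?thesis unfolding isCont_def True As0 .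
  next
    case False
    have "isCont (\<lambda>x. deriv U0 x / qs x) x"
      using False qs_square[of x] U0_less[OF False]
      by (intro continuous_intros DERIV_isCont[OF U0_DERIV(2)] DERIV_isCont[OF qs_DERIV]) auto
    moreover have "\<forall>\<^sub>F s in nhds x. As s = deriv U0 s / qs s"
    proof -
      have "\<forall>\<^sub>F s in nhds x. s \<in> - {0}" using False by (intro eventually_nhds_in_open) auto
      then show ?thesis by eventually_elim (auto simp: As_def)
    qed
    ultimately show ?thesis using isCont_cong[of As "\<lambda>x. deriv U0 x / qs x" x] by blast
  qed
  then show ?thesis by (simp add: continuous_at_imp_continuous_on)
qed

text \<open>The slope of \<open>U0\<close> is nondecreasing, so beyond 1 it is at least the positive
  slope at 1. This growth is the source of the confinement.\<close>

lemma U0_linear_growth: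
  assumes "x \<ge> 1"
  shows "deriv U0 1 * (x - 1) \<le> U0 x - U0 0"
proof (cases "x = 1")
  case True
  then show ?thesis using U0_min[of 1] by simp
next
  case False
  then have x: "1 < x" using assms by simp
  from MVT2[OF x, of U0 "deriv U0"] obtain z where z: "1 < z" "U0 x - U0 1 = (x - 1) * deriv U0 z"
    using U0_DERIV(1) by blast
  have "deriv U0 1 * (x - 1) \<le> deriv U0 z * (x - 1)"
    using z(1) x by (intro mult_right_mono dU_mono) auto
  also have "\<dots> = U0 x - U0 1" by (simp only: z(2) mult.commute)
  also have "\<dots> \<le> U0 x - U0 0" by (rule diff_left_mono[OF U0_min])
  finally show ?thesis .
qed

lemma qs_unbounded:
  assumes y: "y \<ge> 0"
  shows "\<exists>x\<ge>1. y \<le> qs x"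
proof (intro exI conjI)
  define d where "d = deriv U0 1"
  have d: "d > 0" unfolding d_def by (rule dU_pos) simp
  \<comment> \<open>Chosen so that the linear lower bound for \<open>U0 x - U0 0\<close> is exactly
    \<open>y^2 / 2\<close>.\<close>
  define x where "x = 1 + y\<^sup>2 / 2 / d"
  show x1: "1 \<le> x" using d by (simp add: x_def)
  have "y\<^sup>2 / 2 = d * (x - 1)" using d by (simp add: x_def)
  also have "\<dots> \<le> U0 x - U0 0" unfolding d_def by (rule U0_linear_growth[OF x1])
  finally have "2 * (y\<^sup>2 / 2) \<le> 2 * (U0 x - U0 0)" by (rule mult_left_mono) simp
  then have "y\<^sup>2 \<le> (qs x)\<^sup>2" unfolding qs_square[symmetric] by simp
  then show "y \<le> qs x" by (rule power2_le_imp_le) (use qs_pos[of x] x1 in simp)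
qed

lemma qs_surj: "surj qs"
proof -
  have pos: "\<exists>x. qs x = y" if y: "y \<ge> 0" for y
  proof -
    obtain x where x: "x \<ge> 1" "y \<le> qs x" using qs_unbounded[OF y] by blast
    have "continuous_on {0..x} qs"
      by (rule DERIV_continuous_on[OF DERIV_subset[OF qs_DERIV subset_UNIV]])
    then show ?thesis using IVT'[of qs 0 y x] y x by auto
  qed
  have ex: "\<exists>x. qs x = y" for y
  proof (cases "y \<ge> 0")
    case False
    then obtain x where "qs x = - y" using pos[of "- y"] by auto
    then show ?thesis by (intro exI[of _ "- x"]) (simp add: qs_odd)
  qed (rule pos)
  show ?thesis by (rule surjI[of qs "\<lambda>y. SOME x. qs x = y"]) (rule someI_ex[OF ex])
qed

sublocale W: weighted_well qs As alpha beta U0 "U0 0" E0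
proof
  show "(qs has_real_derivative As x) (at x)" for x by (rule qs_DERIV)
  show "continuous_on UNIV As" by (rule As_cont)
  show "As x > 0" for x by (rule As_pos)
  show "surj qs" by (rule qs_surj)
  show "U0 x = U0 0 + (qs x)\<^sup>2 / 2" for x unfolding qs_square by (simp add: field_simps)
  show "U0 0 < E0" using U0_less[of R0] R0_pos by (simp add: E0_def)
  show "continuous_on UNIV beta" by (rule beta_cont)
  show "beta w \<ge> 0" for w using beta_nonneg by blast
  obtain K where K: "compact K" "\<forall>w. w \<notin> K \<longrightarrow> beta w = 0" using beta_supp by blast
  then have "{w. beta w \<noteq> 0} \<subseteq> K" by blast
  then show "bounded {w. beta w \<noteq> 0}" using K(1) compact_imp_bounded bounded_subset by blast
  show "\<exists>w. beta w > 0"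
  proof (rule ccontr)
    assume "\<not> (\<exists>w. beta w > 0)"
    then have "beta = (\<lambda>w. 0)" using beta_nonneg by (auto simp: fun_eq_iff not_less intro: antisym)
    then show False using beta_int by simp
  qed
  show "alpha E > 0 \<longleftrightarrow> E < E0" for E by (rule alpha_pos)
  show "alpha E \<ge> 0" for E by (rule alpha_nonneg)
  show "continuous_on {..<E0} (deriv alpha)" using alpha_deriv by blast
  show "deriv alpha E \<noteq> 0" if "E < E0" for E using alpha_deriv that by blast
qed

text \<open>At the bottom \<open>kap\<close> is the constant \<open>1 / As 0\<close>, which
  reproduces the prescribed limit. Above it, the angle substitution with integrand 1 covers half of
  the circle, and \<open>kap\<close> is even in the angle; this is the factor 2.\<close>

lemma period_eq:
  assumes e: "e \<ge> 0"
  shows "period U0 rho0 (U0 0 + e) = W.Tper e"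
proof (cases "e = 0")
  case True
  have X0: "W.X 0 = 0" using W.X_q[of 0] by simp
  have "W.Tper 0 = 2 * pi / sqrt (4 * pi * rho0 0)"
    by (simp add: W.Tper_def W.kap_def X0 As_def set_lebesgue_integral_def)
  also have "\<dots> = sqrt (pi / rho0 0)"
  proof (rule real_sqrt_unique[symmetric])
    show "(2 * pi / sqrt (4 * pi * rho0 0))\<^sup>2 = pi / rho0 0"
      using rho0_0 by (simp add: power_divide power_mult_distrib power2_eq_square field_simps)
    show "0 \<le> 2 * pi / sqrt (4 * pi * rho0 0)" using rho0_0 by simp
  qed
  finally show ?thesis using True by (simp add: period_def)
next
  case False
  then have e0: "e > 0" using e by simp
  define r where "r = sqrt (2 * e)"
  have r: "r > 0" "r\<^sup>2 = 2 * e" using e0 by (auto simp: r_def)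
  \<comment> \<open>On the positive axis \<open>qs\<close> is positive and injective, so the turning
    point is the only solution of \<open>qs x = sqrt (2 * e)\<close>.\<close>
  have xp: "xplus U0 (U0 0 + e) = W.X r"
    unfolding xplus_def
  proof (rule the_equality)
    have "W.X 0 < W.X r" unfolding W.X_less by (rule r(1))
    moreover have "W.X 0 = 0" using W.X_q[of 0] by simp
    ultimately have X: "W.X r > 0" by (simp only:)
    have "(qs (W.X r))\<^sup>2 = r\<^sup>2" by simp
    then show "0 < W.X r \<and> U0 (W.X r) = U0 0 + e" using X r qs_square[of "W.X r"] by simp
    fix x assume x: "0 < x \<and> U0 x = U0 0 + e"
    then have "(qs x)\<^sup>2 = r\<^sup>2" using r qs_square[of x] by simp
    then have "qs x = r" by (rule power2_eq_imp_eq[OF _ less_imp_le[OF qs_pos[OF conjunct1[OF x]]] less_imp_le[OF r(1)]])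
    then show "x = W.X r" using W.X_q[of x] by simp
  qed
  have Xodd: "W.X (- r) = - W.X r"
    using W.X_q[of "- W.X r"] by (simp add: qs_odd)
  let ?g = "\<lambda>x. 1 / sqrt (2 * e - (qs x)\<^sup>2) * indicator {(qs x)\<^sup>2 / 2..} e"
  have integrand: "indicator {- W.X r..W.X r} x *\<^sub>R (1 / sqrt (2 * (U0 0 + e) - 2 * U0 x)) = ?g x" for x
  proof -
    have "x \<in> {- W.X r..W.X r} \<longleftrightarrow> - r \<le> qs x \<and> qs x \<le> r"
      unfolding Xodd[symmetric] using W.X_le[of "-r" "qs x"] W.X_le[of "qs x" r] by (simp del: W.X_le)
    also have "\<dots> \<longleftrightarrow> (qs x)\<^sup>2 \<le> r\<^sup>2" using r(1) abs_le_square_iff[of "qs x" r] by auto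
    finally have "x \<in> {- W.X r..W.X r} \<longleftrightarrow> e \<in> {(qs x)\<^sup>2 / 2..}" using r(2) by auto
    moreover have "2 * (U0 0 + e) - 2 * U0 x = 2 * e - (qs x)\<^sup>2" by (simp add: qs_square)
    ultimately show ?thesis by (simp add: indicator_def)
  qed
  have km[measurable]: "W.kap e \<in> borel_measurable borel" by (rule W.kap_section_meas)
  have kap_nn: "0 \<le> W.kap e s" for s using W.kap_pos[of e s] by simp
  have "(LINT x : {- W.X r..W.X r} | lborel. 1 / sqrt (2 * (U0 0 + e) - 2 * U0 x)) = enn2real (\<integral>\<^sup>+x. ?g x \<partial>lborel)"
    unfolding set_lebesgue_integral_def integrand
  proof (rule integral_eq_nn_integral)
    have "?g = (\<lambda>x. 1 / sqrt (2 * e - (qs x)\<^sup>2) * (if (qs x)\<^sup>2 / 2 \<le> e then 1 else 0))"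
      by (auto simp: indicator_def)
    moreover have "\<dots> \<in> borel_measurable lborel" by measurable
    ultimately show "?g \<in> borel_measurable lborel" by simp
    show "AE x in lborel. 0 \<le> ?g x" by (auto simp: indicator_def)
  qed
  also have "(\<integral>\<^sup>+x. ?g x \<partial>lborel) = (\<integral>\<^sup>+s. W.kap e s * indicator {0..pi} s \<partial>lborel)"
    using W.nn_integral_position_substitution[of "\<lambda>_. 1" e] e0 by simp
  finally have half: "(LINT x : {- W.X r..W.X r} | lborel. 1 / sqrt (2 * (U0 0 + e) - 2 * U0 x))
     = enn2real (\<integral>\<^sup>+s. W.kap e s * indicator {0..pi} s \<partial>lborel)" .
  have fin: "(\<integral>\<^sup>+s. W.kap e s * indicator {0..pi} s \<partial>lborel) < \<infinity>"
  proof -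
    have "(\<integral>\<^sup>+s. W.kap e s * indicator {0..pi} s \<partial>lborel) = ennreal (LINT s|lborel. indicator {0..pi} s *\<^sub>R W.kap e s)"
      using W.kap_set_integrable[of 0 pi e] kap_nn unfolding set_integrable_def
      by (subst nn_integral_eq_integral[symmetric]) (auto simp: mult.commute)
    then show ?thesis by simp
  qed
  have "W.Tper e = enn2real (\<integral>\<^sup>+s. W.kap e s * indicator {-pi..pi} s \<partial>lborel)"
    unfolding W.Tper_def set_lebesgue_integral_def
    by (subst integral_eq_nn_integral) (auto simp: kap_nn mult.commute)
  also have "(\<integral>\<^sup>+s. W.kap e s * indicator {-pi..pi} s \<partial>lborel)
      = (\<integral>\<^sup>+s. W.kap e s * indicator {0..pi} s \<partial>lborel) + (\<integral>\<^sup>+s. W.kap e (- s) * indicator {0..pi} s \<partial>lborel)"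
    by (rule nn_integral_split_symmetric[OF km kap_nn])
  also have "(\<integral>\<^sup>+s. W.kap e (- s) * indicator {0..pi} s \<partial>lborel) = (\<integral>\<^sup>+s. W.kap e s * indicator {0..pi} s \<partial>lborel)"
    by (simp add: W.kap_def)
  finally have "W.Tper e = 2 * enn2real (\<integral>\<^sup>+s. W.kap e s * indicator {0..pi} s \<partial>lborel)"
    using fin by (simp add: enn2real_plus)
  then show ?thesis using half e0 by (simp add: period_def xp)
qed

theorem spectrum:
  "spectrumA alpha beta U0 = {(2 * pi * real n / period U0 rho0 E)\<^sup>2 | n E. U0 0 \<le> E \<and> E \<le> E0}"
proof -
  have "(\<exists>n e. lam = (2 * pi * real n / W.Tper e)\<^sup>2 \<and> e \<in> {0..W.e0}) \<longleftrightarrow>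
        (\<exists>n E. lam = (2 * pi * real n / period U0 rho0 E)\<^sup>2 \<and> U0 0 \<le> E \<and> E \<le> E0)" for lam
  proof
    assume "\<exists>n e. lam = (2 * pi * real n / W.Tper e)\<^sup>2 \<and> e \<in> {0..W.e0}"
    then obtain n e where "lam = (2 * pi * real n / W.Tper e)\<^sup>2" "e \<in> {0..W.e0}" by blast
    then show "\<exists>n E. lam = (2 * pi * real n / period U0 rho0 E)\<^sup>2 \<and> U0 0 \<le> E \<and> E \<le> E0"
      using period_eq[of e] by (intro exI[of _ n] exI[of _ "U0 0 + e"]) (auto simp: W.e0_def)
  next
    assume "\<exists>n E. lam = (2 * pi * real n / period U0 rho0 E)\<^sup>2 \<and> U0 0 \<le> E \<and> E \<le> E0"
    then obtain n E where "lam = (2 * pi * real n / period U0 rho0 E)\<^sup>2" "U0 0 \<le> E" "E \<le> E0" by blast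
    then show "\<exists>n e. lam = (2 * pi * real n / W.Tper e)\<^sup>2 \<and> e \<in> {0..W.e0}"
      using period_eq[of "E - U0 0"] by (intro exI[of _ n] exI[of _ "E - U0 0"]) (auto simp: W.e0_def)
  qed
  then show ?thesis unfolding W.spectrum_eq by blast
qed

end

theorem theorem5p15:
  fixes alpha :: "real \<Rightarrow> real" and beta :: "real \<times> real \<Rightarrow> real"
    and U0 rho0 :: "real \<Rightarrow> real" and E0 R0 k :: real
  assumes beta_cont: "continuous_on UNIV beta"
    and beta_nonneg: "\<forall>w. beta w \<ge> 0"
    and beta_supp: "\<exists>K. compact K \<and> (\<forall>w. w \<notin> K \<longrightarrow> beta w = 0)"
    and beta_int: "integrable lborel beta" "integral\<^sup>L lborel beta = 1"
    and alpha_form: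
      "(k > 1/2 \<and> (\<forall>E. alpha E = (if E0 - E > 0 then (E0 - E) powr k else 0)))
       \<or> (\<forall>E. alpha E = (if E0 - E > 0 then exp (E0 - E) - 1 else 0))"
    and rho0_def: "\<forall>x. integrable lborel (\<lambda>v. f0 alpha beta U0 (x, v)) \<and>
                       rho0 x = integral\<^sup>L lborel (\<lambda>v. f0 alpha beta U0 (x, v))"
    and U0_def: "\<forall>x. integrable lborel (\<lambda>y. \<bar>x - y\<bar> * rho0 y) \<and>
                     U0 x = 2 * pi * integral\<^sup>L lborel (\<lambda>y. \<bar>x - y\<bar> * rho0 y)"
    and even: "\<forall>x. U0 (- x) = U0 x" "\<forall>x. rho0 (- x) = rho0 x"
    and R0_pos: "R0 > 0"
    and supp_rho0: "closure {x. rho0 x \<noteq> 0} = {- R0 .. R0}"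
    and U0_convex: "convex_on {0..} U0"
    and U0_mono: "strict_mono_on {0..} U0"
    and E0_def: "E0 = U0 R0"
  shows "spectrumA alpha beta U0 =
           {(2 * pi * real n / period U0 rho0 E)\<^sup>2 | n E. U0 0 \<le> E \<and> E \<le> E0}
       \<and> ess_spectrumA alpha beta U0 = spectrumA alpha beta U0"
proof -
  interpret steady_state alpha beta U0 rho0 E0 R0 k
    by unfold_locales (fact assms)+
  show ?thesis using spectrum W.discrete_spectrum_empty by (simp add: ess_spectrumA_def)
qed

end
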